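(* Let $I$ be an ideal of a commutative, Noetherian ring. Then $I$ is pro Tor-unital, i.e., $\{\operatorname{Tor}_n^{\mathbb Z\ltimes I^r}(\mathbb Z,\mathbb Z)\}_r=0$ for all $n>0$.
   Context: For a non-unital ring $J$, $\mathbb Z\ltimes J$ denotes the unital ring $\mathbb Z\oplus J$ with multiplication $(a,x)(b,y)=(ab,\,ay+bx+xy)$; $\mathbb Z$ is a $\mathbb Z\ltimes J$-module (left and right) via the projection $\mathbb Z\ltimes J\to\mathbb Z$. $\{X_r\}_r$ denotes the pro abelian group given by an inverse system $\cdots\to X_2\to X_1$ (here with transition maps induced by $I^{r+1}\subseteq I^r$); $\{X_r\}_r=0$ means that for each $r\ge1$ there is $s\ge r$ such that the transition map $X_s\to X_r$ is zero. *)

theory Defs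
  imports "HOL-Algebra.Module" "HOL-Algebra.Ideal_Product" "HOL-Algebra.Ring_Divisibility"
    "HOL-Algebra.Free_Abelian_Groups"
begin

text \<open>
  The non-unital ring \<open>J\<close> is a ring record whose field \<open>one\<close> is ignored.
\<close>

definition int_unitization :: "('a, 'b) ring_scheme \<Rightarrow> (int \<times> 'a) ring" where
  "int_unitization J =
    \<lparr> carrier = UNIV \<times> carrier J,
      monoid.mult = (\<lambda>(a, x) (b, y). (a * b, add_pow J a y \<oplus>\<^bsub>J\<^esub> add_pow J b x \<oplus>\<^bsub>J\<^esub> x \<otimes>\<^bsub>J\<^esub> y)),
      one = (1, \<zero>\<^bsub>J\<^esub>),
      ring.zero = (0, \<zero>\<^bsub>J\<^esub>),
      ring.add = (\<lambda>(a, x) (b, y). (a + b, x \<oplus>\<^bsub>J\<^esub> y)) \<rparr>"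

text \<open>
  The integers as a module over \<open>int_unitization J\<close> (for every \<open>J\<close>), via the first projection.
  The fields \<open>mult\<close> and \<open>one\<close> of a module record play no role.
\<close>

definition int_module :: "(int \<times> 'a, int) module" where
  "int_module =
    \<lparr> carrier = UNIV, monoid.mult = (*), one = 1, ring.zero = 0, ring.add = (+), smult = (\<lambda>(a, x) k. a * k) \<rparr>"

section \<open>Tensor products\<close>

definition tensor_relators ::
    "('a, 'r) ring_scheme \<Rightarrow> ('a, 'm, 's) module_scheme \<Rightarrow> ('a, 'n, 't) module_scheme
      \<Rightarrow> ('m \<times> 'n \<Rightarrow>\<^sub>0 int) set" where
  "tensor_relators A M N =
    {frag_of (x \<oplus>\<^bsub>M\<^esub> x', y) - frag_of (x, y) - frag_of (x', y) | x x' y.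
        x \<in> carrier M \<and> x' \<in> carrier M \<and> y \<in> carrier N} \<union>
    {frag_of (x, y \<oplus>\<^bsub>N\<^esub> y') - frag_of (x, y) - frag_of (x, y') | x y y'.
        x \<in> carrier M \<and> y \<in> carrier N \<and> y' \<in> carrier N} \<union>
    {frag_of (a \<odot>\<^bsub>M\<^esub> x, y) - frag_of (x, a \<odot>\<^bsub>N\<^esub> y) | a x y.
        a \<in> carrier A \<and> x \<in> carrier M \<and> y \<in> carrier N}"

definition tensor_kernel ::
    "('a, 'r) ring_scheme \<Rightarrow> ('a, 'm, 's) module_scheme \<Rightarrow> ('a, 'n, 't) module_scheme
      \<Rightarrow> ('m \<times> 'n \<Rightarrow>\<^sub>0 int) set" where
  "tensor_kernel A M N =
    generate (free_Abelian_group (carrier M \<times> carrier N)) (tensor_relators A M N)"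

text \<open>The abelian group \<open>M \<otimes>\<^sub>A N\<close>, written multiplicatively as all groups in the library.\<close>

definition tensor ::
    "('a, 'r) ring_scheme \<Rightarrow> ('a, 'm, 's) module_scheme \<Rightarrow> ('a, 'n, 't) module_scheme
      \<Rightarrow> ('m \<times> 'n \<Rightarrow>\<^sub>0 int) set monoid" where
  "tensor A M N = free_Abelian_group (carrier M \<times> carrier N) Mod tensor_kernel A M N"

text \<open>
  The map into \<open>G Mod H\<close> that a homomorphism \<open>h\<close> into \<open>G\<close> induces on a quotient group whose
  kernel \<open>h\<close> maps into \<open>H\<close>: it sends the coset \<open>X\<close> of \<open>x\<close> to the coset \<open>H <#> h ` X\<close> of \<open>h x\<close>.
\<close>

definition quotient_map ::
    "('b, 'c) monoid_scheme \<Rightarrow> 'b set \<Rightarrow> ('a \<Rightarrow> 'b) \<Rightarrow> 'a set \<Rightarrow> 'b set" where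
  "quotient_map G H h X = H <#>\<^bsub>G\<^esub> (h ` X)"

text \<open>
  \<open>f \<otimes> g\<close> as a map into \<open>M \<otimes>\<^sub>A N\<close>; the source may be a tensor product over another ring
  with a homomorphism to \<open>A\<close> for which \<open>f\<close> and \<open>g\<close> are semilinear.
\<close>

definition tensor_map ::
    "('a, 'r) ring_scheme \<Rightarrow> ('a, 'm, 's) module_scheme \<Rightarrow> ('a, 'n, 't) module_scheme
      \<Rightarrow> ('m' \<Rightarrow> 'm) \<Rightarrow> ('n' \<Rightarrow> 'n) \<Rightarrow> ('m' \<times> 'n' \<Rightarrow>\<^sub>0 int) set \<Rightarrow> ('m \<times> 'n \<Rightarrow>\<^sub>0 int) set" where
  "tensor_map A M N f g =
    quotient_map (free_Abelian_group (carrier M \<times> carrier N)) (tensor_kernel A M N)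
      (frag_extend (\<lambda>(x, y). frag_of (f x, g y)))"

section \<open>The standard free resolution of a module\<close>

definition supp :: "('a, 'r) ring_scheme \<Rightarrow> ('b \<Rightarrow> 'a) \<Rightarrow> 'b set" where
  "supp A f = {b. f b \<noteq> \<zero>\<^bsub>A\<^esub>}"

definition free_module :: "('a, 'r) ring_scheme \<Rightarrow> 'b set \<Rightarrow> ('a, 'b \<Rightarrow> 'a) module" where
  "free_module A B =
    \<lparr> carrier = {f. finite (supp A f) \<and> supp A f \<subseteq> B \<and> range f \<subseteq> carrier A},
      monoid.mult = undefined, one = undefined,
      ring.zero = (\<lambda>_. \<zero>\<^bsub>A\<^esub>),
      ring.add = (\<lambda>f g b. f b \<oplus>\<^bsub>A\<^esub> g b),
      smult = (\<lambda>a f b. a \<otimes>\<^bsub>A\<^esub> f b) \<rparr>"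

text \<open>
  In the standard free resolution \<open>\<dots> \<rightarrow> F\<^sub>1 \<rightarrow> F\<^sub>0 \<rightarrow> M\<close>, the module \<open>F\<^sub>0\<close> is free
  on (copies \<open>Elt m\<close> of) all elements of \<open>M\<close>, and \<open>F\<^sub>n\<^sub>+\<^sub>1\<close> is free on all \<^emph>\<open>expressions\<close> for elements
  of the kernel of the previous map: \<open>Rel [(a\<^sub>1, b\<^sub>1), \<dots>, (a\<^sub>k, b\<^sub>k)]\<close> is a basis element if the
  \<open>b\<^sub>i\<close> are basis elements of \<open>F\<^sub>n\<close> and \<open>\<Sum> a\<^sub>i b\<^sub>i\<close> is in the kernel, and it is mapped to this sum.
  The use of expressions makes the resolution functorial by applying the given maps to all entries.
\<close>

datatype ('a, 'm) res_gen = Elt 'm | Rel "('a \<times> ('a, 'm) res_gen) list"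

fun linear_combination :: "('a, 'r) ring_scheme \<Rightarrow> ('a \<times> 'b) list \<Rightarrow> 'b \<Rightarrow> 'a" where
  "linear_combination A [] = (\<lambda>_. \<zero>\<^bsub>A\<^esub>)"
| "linear_combination A ((a, b) # l) =
    (\<lambda>c. (if c = b then a else \<zero>\<^bsub>A\<^esub>) \<oplus>\<^bsub>A\<^esub> linear_combination A l c)"

fun gen_augment :: "('a, 'm, 's) module_scheme \<Rightarrow> ('a, 'm) res_gen \<Rightarrow> 'm" where
  "gen_augment M (Elt m) = m"
| "gen_augment M (Rel l) = \<zero>\<^bsub>M\<^esub>"

fun gen_boundary :: "('a, 'r) ring_scheme \<Rightarrow> ('a, 'm) res_gen \<Rightarrow> ('a, 'm) res_gen \<Rightarrow> 'a" where
  "gen_boundary A (Elt m) = (\<lambda>_. \<zero>\<^bsub>A\<^esub>)"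
| "gen_boundary A (Rel l) = linear_combination A l"

definition augment ::
    "('a, 'r) ring_scheme \<Rightarrow> ('a, 'm, 's) module_scheme \<Rightarrow> (('a, 'm) res_gen \<Rightarrow> 'a) \<Rightarrow> 'm" where
  "augment A M f = (\<Oplus>\<^bsub>M\<^esub>b\<in>supp A f. f b \<odot>\<^bsub>M\<^esub> gen_augment M b)"

definition boundary ::
    "('a, 'r) ring_scheme \<Rightarrow> (('a, 'm) res_gen \<Rightarrow> 'a) \<Rightarrow> (('a, 'm) res_gen \<Rightarrow> 'a)" where
  "boundary A f = (\<lambda>c. \<Oplus>\<^bsub>A\<^esub>b\<in>supp A f. f b \<otimes>\<^bsub>A\<^esub> gen_boundary A b c)"

fun res_basis ::
    "('a, 'r) ring_scheme \<Rightarrow> ('a, 'm, 's) module_scheme \<Rightarrow> nat \<Rightarrow> ('a, 'm) res_gen set" where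
  "res_basis A M 0 = Elt ` carrier M"
| "res_basis A M (Suc 0) =
    {Rel l | l. set l \<subseteq> carrier A \<times> res_basis A M 0 \<and>
                augment A M (linear_combination A l) = \<zero>\<^bsub>M\<^esub>}"
| "res_basis A M (Suc (Suc n)) =
    {Rel l | l. set l \<subseteq> carrier A \<times> res_basis A M (Suc n) \<and>
                boundary A (linear_combination A l) = (\<lambda>_. \<zero>\<^bsub>A\<^esub>)}"

definition resolution ::
    "('a, 'r) ring_scheme \<Rightarrow> ('a, 'm, 's) module_scheme \<Rightarrow> nat
      \<Rightarrow> ('a, ('a, 'm) res_gen \<Rightarrow> 'a) module" where
  "resolution A M n = free_module A (res_basis A M n)"

text \<open>
  The chain map between standard resolutions over \<open>A\<close> and \<open>B\<close> that a ring homomorphism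
  \<open>\<phi> : A \<rightarrow> B\<close> and a \<open>\<phi>\<close>-semilinear map \<open>\<mu>\<close> of modules induce.
\<close>

definition resolution_map ::
    "('a, 'r) ring_scheme \<Rightarrow> ('b, 's) ring_scheme \<Rightarrow> ('a \<Rightarrow> 'b) \<Rightarrow> ('m \<Rightarrow> 'm')
      \<Rightarrow> (('a, 'm) res_gen \<Rightarrow> 'a) \<Rightarrow> (('b, 'm') res_gen \<Rightarrow> 'b)" where
  "resolution_map A B \<phi> \<mu> f =
    (\<lambda>c. \<Oplus>\<^bsub>B\<^esub>b\<in>{b \<in> supp A f. map_res_gen \<phi> \<mu> b = c}. \<phi> (f b))"

section \<open>Tor\<close>

text \<open>
  \<open>Tor\<^sub>n\<^sup>A(M, N)\<close> is the \<open>n\<close>-th homology of \<open>F \<otimes>\<^sub>A N\<close>, where \<open>F\<close> is the standard resolution of \<open>M\<close>.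
  The ring \<open>A\<close> is meant to be commutative, so that left and right modules need not be distinguished;
  this holds for \<open>\<int> \<ltimes> J\<close> if \<open>J\<close> is commutative.
\<close>

definition Tor_chains ::
    "('a, 'r) ring_scheme \<Rightarrow> ('a, 'm, 's) module_scheme \<Rightarrow> ('a, 'n, 't) module_scheme
      \<Rightarrow> nat \<Rightarrow> ((('a, 'm) res_gen \<Rightarrow> 'a) \<times> 'n \<Rightarrow>\<^sub>0 int) set monoid" where
  "Tor_chains A M N n = tensor A (resolution A M n) N"

definition Tor_boundary ::
    "('a, 'r) ring_scheme \<Rightarrow> ('a, 'm, 's) module_scheme \<Rightarrow> ('a, 'n, 't) module_scheme \<Rightarrow> nat
      \<Rightarrow> ((('a, 'm) res_gen \<Rightarrow> 'a) \<times> 'n \<Rightarrow>\<^sub>0 int) set \<Rightarrow> ((('a, 'm) res_gen \<Rightarrow> 'a) \<times> 'n \<Rightarrow>\<^sub>0 int) set"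
  where
    \<comment> \<open>the boundary map from degree \<open>n + 1\<close> to degree \<open>n\<close>\<close>
  "Tor_boundary A M N n = tensor_map A (resolution A M n) N (boundary A) id"

fun Tor_cycles ::
    "('a, 'r) ring_scheme \<Rightarrow> ('a, 'm, 's) module_scheme \<Rightarrow> ('a, 'n, 't) module_scheme \<Rightarrow> nat
      \<Rightarrow> ((('a, 'm) res_gen \<Rightarrow> 'a) \<times> 'n \<Rightarrow>\<^sub>0 int) set set" where
  "Tor_cycles A M N 0 = carrier (Tor_chains A M N 0)"
| "Tor_cycles A M N (Suc n) =
    kernel (Tor_chains A M N (Suc n)) (Tor_chains A M N n) (Tor_boundary A M N n)"

definition Tor_boundaries ::
    "('a, 'r) ring_scheme \<Rightarrow> ('a, 'm, 's) module_scheme \<Rightarrow> ('a, 'n, 't) module_scheme \<Rightarrow> nat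
      \<Rightarrow> ((('a, 'm) res_gen \<Rightarrow> 'a) \<times> 'n \<Rightarrow>\<^sub>0 int) set set" where
  "Tor_boundaries A M N n = Tor_boundary A M N n ` carrier (Tor_chains A M N (Suc n))"

definition Tor ::
    "('a, 'r) ring_scheme \<Rightarrow> ('a, 'm, 's) module_scheme \<Rightarrow> ('a, 'n, 't) module_scheme \<Rightarrow> nat
      \<Rightarrow> ((('a, 'm) res_gen \<Rightarrow> 'a) \<times> 'n \<Rightarrow>\<^sub>0 int) set set monoid" where
  "Tor A M N n =
    (Tor_chains A M N n)\<lparr>carrier := Tor_cycles A M N n\<rparr> Mod Tor_boundaries A M N n"

text \<open>
  The map \<open>Tor\<^sub>n\<^sup>A(M, N) \<rightarrow> Tor\<^sub>n\<^sup>B(M', N')\<close> induced by a ring homomorphism \<open>\<phi> : A \<rightarrow> B\<close> and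
  \<open>\<phi>\<close>-semilinear maps \<open>\<mu> : M \<rightarrow> M'\<close> and \<open>\<nu> : N \<rightarrow> N'\<close>.  (It does not depend on \<open>M\<close> and \<open>N\<close>
  except through its domain.)
\<close>

definition Tor_map ::
    "('a, 'r) ring_scheme \<Rightarrow> ('b, 's) ring_scheme \<Rightarrow> ('b, 'm', 't) module_scheme
      \<Rightarrow> ('b, 'n', 'u) module_scheme \<Rightarrow> ('a \<Rightarrow> 'b) \<Rightarrow> ('m \<Rightarrow> 'm') \<Rightarrow> ('n \<Rightarrow> 'n') \<Rightarrow> nat
      \<Rightarrow> ((('a, 'm) res_gen \<Rightarrow> 'a) \<times> 'n \<Rightarrow>\<^sub>0 int) set set
      \<Rightarrow> ((('b, 'm') res_gen \<Rightarrow> 'b) \<times> 'n' \<Rightarrow>\<^sub>0 int) set set" where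
  "Tor_map A B M' N' \<phi> \<mu> \<nu> n =
    quotient_map (Tor_chains B M' N' n) (Tor_boundaries B M' N' n)
      (tensor_map B (resolution B M' n) N' (resolution_map A B \<phi> \<mu>) \<nu>)"

section \<open>Pro abelian groups and pro Tor-unitality\<close>

text \<open>
  An inverse system \<open>\<dots> \<rightarrow> X 2 \<rightarrow> X 1\<close> is given with maps \<open>t r : X (r + 1) \<rightarrow> X r\<close>;
  \<open>transition t r k : X (r + k) \<rightarrow> X r\<close> is their composite.
\<close>

fun transition :: "(nat \<Rightarrow> 'x \<Rightarrow> 'x) \<Rightarrow> nat \<Rightarrow> nat \<Rightarrow> 'x \<Rightarrow> 'x" where
  "transition t r 0 = id"
| "transition t r (Suc k) = transition t r k \<circ> t (r + k)"

definition pro_zero :: "(nat \<Rightarrow> ('x, 'y) monoid_scheme) \<Rightarrow> (nat \<Rightarrow> 'x \<Rightarrow> 'x) \<Rightarrow> bool" where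
  "pro_zero X t \<longleftrightarrow>
    (\<forall>r\<ge>1. \<exists>s\<ge>r. \<forall>x\<in>carrier (X s). transition t r (s - r) x = \<one>\<^bsub>X r\<^esub>)"

text \<open>The ring \<open>\<int> \<ltimes> I\<^sup>r\<close>; the power is taken in the semiring of ideals of \<open>R\<close>.\<close>

definition unitized_power :: "('a, 'b) ring_scheme \<Rightarrow> 'a set \<Rightarrow> nat \<Rightarrow> (int \<times> 'a) ring" where
  "unitized_power R I r = int_unitization (R\<lparr>carrier := I [^]\<^bsub>ideals_set R\<^esub> r\<rparr>)"

text \<open>
  All the rings \<open>\<int> \<ltimes> I\<^sup>r\<close> live on the same type, so that the ring homomorphism
  \<open>\<int> \<ltimes> I\<^sup>r\<^sup>+\<^sup>1 \<rightarrow> \<int> \<ltimes> I\<^sup>r\<close> induced by the inclusion is the function \<open>id\<close>.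
\<close>

definition pro_Tor_unital :: "('a, 'b) ring_scheme \<Rightarrow> 'a set \<Rightarrow> bool" where
  "pro_Tor_unital R I \<longleftrightarrow>
    (\<forall>n>0. pro_zero
      (\<lambda>r. Tor (unitized_power R I r) int_module int_module n)
      (\<lambda>r. Tor_map (unitized_power R I (Suc r)) (unitized_power R I r) int_module int_module
             id id id n))"

end

theory Submission
  imports Defs
begin

text \<open>
  Write \<open>A\<^sub>r = \<int> \<ltimes> I\<^sup>r\<close> and let \<open>F\<close> be the standard resolution of \<open>\<int>\<close> over \<open>A\<^sub>r\<close>, with basis \<open>B r n\<close>
  in degree \<open>n\<close>.  When \<open>r\<close> grows, the rings \<open>A\<^sub>r\<close> and the bases \<open>B r n\<close> shrink, and all transition
  maps are inclusions (\<open>basis_mono\<close>, \<open>Tor_map_tor_class\<close>).  The ring homomorphism \<open>A\<^sub>r \<rightarrow> R\<close>,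
  \<open>(k, x) \<mapsto> k\<cdot>1 + x\<close>, makes every \<open>R\<close>-module an \<open>A\<^sub>r\<close>-module and turns the boundary of \<open>F\<close> into a
  matrix \<open>D\<close> over \<open>R\<close>, the same for all \<open>r\<close>.  So for a submodule \<open>G\<close> of \<open>R\<^sup>k\<close> the groups
  \<open>Tor\<^sub>n(\<int>, G)\<close> over \<open>A\<^sub>r\<close> are the homology of the finitely supported \<open>G\<close>-valued functions on
  \<open>B r n\<close>, with boundary \<open>D\<close>.

  The theorem follows by a dimension shift along \<open>0 \<rightarrow> I\<^sup>r \<rightarrow> A\<^sub>r \<rightarrow> \<int> \<rightarrow> 0\<close> (\<open>pro_exactness\<close>) from a
  statement about coefficients \<open>G\<close> (\<open>cycles_are_boundaries\<close>): for each \<open>r\<close> there is a \<open>q\<close> such that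
  every cycle over \<open>A\<^sub>q\<close> with values in \<open>I\<^sup>q G\<close> bounds a \<open>G\<close>-valued chain over \<open>A\<^sub>r\<close>.
  This is an induction on the degree.  Let \<open>g\<^sub>1, \<dots>, g\<^sub>N\<close> generate \<open>G\<close> and let \<open>K\<close> be the kernel of
  the map \<open>R\<^sup>N \<rightarrow> G\<close> that they define.  A cycle \<open>z\<close> with values in \<open>I\<^sup>q G\<close> lifts to a chain \<open>t\<close> with
  values in \<open>(I\<^sup>q)\<^sup>N\<close>, and the boundary of \<open>t\<close> is a cycle with values in \<open>K \<inter> (I\<^sup>q)\<^sup>N\<close>.  For large \<open>q\<close>
  these values are in \<open>I\<^sup>u (K \<inter> (I\<^sup>r)\<^sup>N)\<close> by a weak form of the Artin-Rees lemma
  (\<open>weak_Artin_Rees\<close>), so the induction hypothesis gives a chain \<open>w\<close> over \<open>A\<^sub>r\<close> with values in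
  \<open>K \<inter> (I\<^sup>r)\<^sup>N\<close> and the same boundary.  Now \<open>t - w\<close> is a cycle that still lifts \<open>z\<close>, and its \<open>N\<close>
  components \<open>c\<^sub>j\<close> have coefficients in \<open>I\<^sup>r\<close>, hence are cycles of \<open>F\<close> itself.  As \<open>F\<close> is exact,
  \<open>c\<^sub>j\<close> is the boundary of a basis element \<open>b\<^sub>j\<close>, and \<open>z = \<Sum> g\<^sub>j c\<^sub>j\<close> is the boundary of the
  \<open>G\<close>-valued chain \<open>\<Sum> g\<^sub>j b\<^sub>j\<close>.  The step rests on the double role of \<open>I\<^sup>r\<close> as a module of
  coefficients and as the augmentation ideal of \<open>A\<^sub>r\<close>.
\<close>

section \<open>Linear maps between free modules\<close>

text \<open>
  The linear map that is \<open>D\<close> on the basis.  It occurs as the boundary of a resolution over \<open>\<int> \<ltimes> J\<close>,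
  as the boundary with coefficients in \<open>R\<close>, and as the map \<open>R\<^sup>N \<rightarrow> R\<^sup>k\<close> given by \<open>N\<close> vectors.
\<close>

definition linear_extension :: "('a, 'r) ring_scheme \<Rightarrow> ('b \<Rightarrow> 'c \<Rightarrow> 'a) \<Rightarrow> ('b \<Rightarrow> 'a) \<Rightarrow> 'c \<Rightarrow> 'a" where
  "linear_extension A D f = (\<lambda>c. \<Oplus>\<^bsub>A\<^esub>b\<in>supp A f. f b \<otimes>\<^bsub>A\<^esub> D b c)"

lemma boundary_eq_linear_extension: "boundary A = linear_extension A (gen_boundary A)"
  by (simp add: fun_eq_iff boundary_def linear_extension_def)

abbreviation vectors :: "('a, 'r) ring_scheme \<Rightarrow> 'b set \<Rightarrow> ('b \<Rightarrow> 'a) set" where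
  "vectors A B \<equiv> carrier (free_module A B)"

lemma vectors_iff:
  "f \<in> vectors A B \<longleftrightarrow> finite (supp A f) \<and> supp A f \<subseteq> B \<and> (\<forall>b. f b \<in> carrier A)"
  by (auto simp: free_module_def)

lemma vectors_mono: "B \<subseteq> C \<Longrightarrow> f \<in> vectors A B \<Longrightarrow> f \<in> vectors A C"
  by (auto simp: vectors_iff)

lemma vectors_carrier: "f \<in> vectors A B \<Longrightarrow> f b \<in> carrier A"
  by (auto simp: vectors_iff)

lemma vectors_outside: "f \<in> vectors A B \<Longrightarrow> b \<notin> B \<Longrightarrow> f b = \<zero>\<^bsub>A\<^esub>"
  by (auto simp: vectors_iff supp_def)

lemma vectors_finiteI:
  assumes "finite S" "S \<subseteq> B" "\<And>b. f b \<in> carrier A" "\<And>b. b \<notin> S \<Longrightarrow> f b = \<zero>\<^bsub>A\<^esub>"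
  shows "f \<in> vectors A B"
proof -
  have "supp A f \<subseteq> S"
    using assms(4) by (auto simp: supp_def)
  then show ?thesis
    using assms(1-3) finite_subset unfolding vectors_iff by blast
qed

context abelian_monoid
begin

lemma finsum_swap:
  assumes "finite S" "finite T" "\<And>x y. x \<in> S \<Longrightarrow> y \<in> T \<Longrightarrow> f x y \<in> carrier G"
  shows "(\<Oplus>x\<in>S. \<Oplus>y\<in>T. f x y) = (\<Oplus>y\<in>T. \<Oplus>x\<in>S. f x y)"
  using assms(1,3)
proof (induction S)
  case empty
  then show ?case by simp
next
  case (insert s S)
  have "(\<Oplus>x\<in>insert s S. \<Oplus>y\<in>T. f x y) = (\<Oplus>y\<in>T. f s y) \<oplus> (\<Oplus>y\<in>T. \<Oplus>x\<in>S. f x y)"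
    using insert by (subst finsum_insert) (auto simp: Pi_def)
  also have "\<dots> = (\<Oplus>y\<in>T. f s y \<oplus> (\<Oplus>x\<in>S. f x y))"
    using insert by (subst finsum_addf) (auto simp: Pi_def)
  also have "\<dots> = (\<Oplus>y\<in>T. \<Oplus>x\<in>insert s S. f x y)"
    using insert by (intro finsum_cong') (auto simp: Pi_def)
  finally show ?case .
qed

lemma finsum_zeroI: "(\<And>x. x \<in> S \<Longrightarrow> f x = \<zero>) \<Longrightarrow> (\<Oplus>x\<in>S. f x) = \<zero>"
  by (rule add.finprod_one_eqI)

lemma finsum_delta:
  assumes "finite S" "s \<in> S" "a \<in> carrier G"
  shows "(\<Oplus>x\<in>S. if x = s then a else \<zero>) = a"
  using add.finprod_singleton_swap[OF assms(2,1), of "\<lambda>_. a"] assms(3) by simp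

end

context cring
begin

lemma zero_vectors: "(\<lambda>_. \<zero>) \<in> vectors R B"
  by (rule vectors_finiteI[of "{}"]) auto

lemma add_vectors:
  assumes "f \<in> vectors R B" "g \<in> vectors R B"
  shows "(\<lambda>b. f b \<oplus> g b) \<in> vectors R B"
  using assms by (intro vectors_finiteI[of "supp R f \<union> supp R g"]) (auto simp: vectors_iff supp_def)

lemma smult_vectors:
  assumes "f \<in> vectors R B" "a \<in> carrier R"
  shows "(\<lambda>b. a \<otimes> f b) \<in> vectors R B"
  using assms by (intro vectors_finiteI[of "supp R f"]) (auto simp: vectors_iff supp_def)

lemma diff_vectors:
  assumes "f \<in> vectors R B" "g \<in> vectors R B"
  shows "(\<lambda>b. f b \<ominus> g b) \<in> vectors R B"
  using assms by (intro vectors_finiteI[of "supp R f \<union> supp R g"]) (auto simp: vectors_iff supp_def minus_eq)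

lemma single_vectors:
  assumes "b \<in> B" "a \<in> carrier R"
  shows "(\<lambda>c. if c = b then a else \<zero>) \<in> vectors R B"
  using assms by (intro vectors_finiteI[of "{b}"]) auto

lemma linear_combination_vectors:
  "set l \<subseteq> carrier R \<times> B \<Longrightarrow> linear_combination R l \<in> vectors R B"
  by (induction l) (auto simp: zero_vectors intro!: add_vectors single_vectors)

lemma vectors_linear_combination:
  assumes "f \<in> vectors R B"
  shows "\<exists>l. set l \<subseteq> carrier R \<times> B \<and> f = linear_combination R l"
proof -
  have "\<exists>l. set l \<subseteq> carrier R \<times> B \<and> f = linear_combination R l"
    if "finite S" "f \<in> vectors R B" "supp R f \<subseteq> S" for S f
    using that
  proof (induction S arbitrary: f)
    case empty
    then have "f = linear_combination R []"
      by (auto simp: supp_def fun_eq_iff)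
    then show ?case
      by (intro exI[of _ "[]"]) auto
  next
    case (insert b S)
    show ?case
    proof (cases "b \<in> supp R f")
      case False
      then show ?thesis
        using insert.IH[of f] insert.prems by blast
    next
      case True
      let ?g = "f(b := \<zero>)"
      have g: "?g \<in> vectors R B"
        using insert.prems by (intro vectors_finiteI[of "supp R f"]) (auto simp: vectors_iff supp_def)
      moreover have "supp R ?g \<subseteq> S"
        using insert.prems by (auto simp: supp_def)
      ultimately obtain l where l: "set l \<subseteq> carrier R \<times> B" "?g = linear_combination R l"
        using insert.IH by blast
      have "f = linear_combination R ((f b, b) # l)"
        using insert.prems(1) by (auto simp: fun_eq_iff vectors_iff simp flip: l(2))
      moreover have "set ((f b, b) # l) \<subseteq> carrier R \<times> B"
        using l True insert.prems(1) by (auto simp: vectors_iff)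
      ultimately show ?thesis by blast
    qed
  qed
  then show ?thesis
    using assms by (auto simp: vectors_iff)
qed

lemma linear_extension_superset:
  assumes "finite S" "supp R f \<subseteq> S" "\<And>b. f b \<in> carrier R" "\<And>b. b \<in> S \<Longrightarrow> D b c \<in> carrier R"
  shows "linear_extension R D f c = (\<Oplus>b\<in>S. f b \<otimes> D b c)"
  unfolding linear_extension_def
  by (rule add.finprod_mono_neutral_cong_left) (use assms in \<open>auto simp: supp_def\<close>)

context
  fixes D :: "'d \<Rightarrow> 'c \<Rightarrow> 'a" and B :: "'d set" and C :: "'c set"
  assumes D: "b \<in> B \<Longrightarrow> D b \<in> vectors R C"
begin

lemma linear_extension_closed:
  assumes f: "f \<in> vectors R B"
  shows "linear_extension R D f \<in> vectors R C"
proof (rule vectors_finiteI)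
  show "finite (\<Union>b\<in>supp R f. supp R (D b))" "(\<Union>b\<in>supp R f. supp R (D b)) \<subseteq> C"
    using D f by (fastforce simp: vectors_iff)+
  show "linear_extension R D f c \<in> carrier R" for c
    using D f unfolding linear_extension_def by (intro finsum_closed) (auto simp: vectors_iff)
  fix c assume "c \<notin> (\<Union>b\<in>supp R f. supp R (D b))"
  then show "linear_extension R D f c = \<zero>"
    using f unfolding linear_extension_def by (intro finsum_zeroI) (auto simp: supp_def vectors_iff)
qed

lemma linear_extension_add:
  assumes "f \<in> vectors R B" "g \<in> vectors R B"
  shows "linear_extension R D (\<lambda>b. f b \<oplus> g b) c = linear_extension R D f c \<oplus> linear_extension R D g c"
proof -
  let ?S = "supp R f \<union> supp R g"
  have S: "finite ?S" "?S \<subseteq> B" "\<And>b. f b \<in> carrier R" "\<And>b. g b \<in> carrier R"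
    using assms by (auto simp: vectors_iff)
  have D': "\<And>b c. b \<in> ?S \<Longrightarrow> D b c \<in> carrier R"
    using D S(2) by (meson subsetD vectors_carrier)
  have "linear_extension R D (\<lambda>b. f b \<oplus> g b) c = (\<Oplus>b\<in>?S. (f b \<oplus> g b) \<otimes> D b c)"
    using S D' by (intro linear_extension_superset) (auto simp: supp_def)
  also have "\<dots> = (\<Oplus>b\<in>?S. f b \<otimes> D b c \<oplus> g b \<otimes> D b c)"
    using S D' by (intro finsum_cong') (auto simp: l_distr)
  also have "\<dots> = (\<Oplus>b\<in>?S. f b \<otimes> D b c) \<oplus> (\<Oplus>b\<in>?S. g b \<otimes> D b c)"
    using S D' by (intro finsum_addf) auto
  also have "(\<Oplus>b\<in>?S. f b \<otimes> D b c) = linear_extension R D f c"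
    using S D' by (intro linear_extension_superset[symmetric]) auto
  also have "(\<Oplus>b\<in>?S. g b \<otimes> D b c) = linear_extension R D g c"
    using S D' by (intro linear_extension_superset[symmetric]) auto
  finally show ?thesis .
qed

lemma linear_extension_smult:
  assumes "f \<in> vectors R B" "a \<in> carrier R"
  shows "linear_extension R D (\<lambda>b. a \<otimes> f b) c = a \<otimes> linear_extension R D f c"
proof -
  let ?S = "supp R f"
  have S: "finite ?S" "?S \<subseteq> B" "\<And>b. f b \<in> carrier R"
    using assms by (auto simp: vectors_iff)
  have D': "\<And>b c. b \<in> ?S \<Longrightarrow> D b c \<in> carrier R"
    using D S(2) by (meson subsetD vectors_carrier)
  have "linear_extension R D (\<lambda>b. a \<otimes> f b) c = (\<Oplus>b\<in>?S. a \<otimes> f b \<otimes> D b c)"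
    using S D' assms(2) by (intro linear_extension_superset) (auto simp: supp_def)
  also have "\<dots> = (\<Oplus>b\<in>?S. a \<otimes> (f b \<otimes> D b c))"
    using S D' assms(2) by (intro finsum_cong') (auto simp: m_assoc)
  also have "\<dots> = a \<otimes> (\<Oplus>b\<in>?S. f b \<otimes> D b c)"
    using S D' assms(2) by (intro finsum_rdistr[symmetric]) auto
  finally show ?thesis
    by (simp add: linear_extension_def)
qed

lemma linear_extension_diff:
  assumes "f \<in> vectors R B" "g \<in> vectors R B"
  shows "linear_extension R D (\<lambda>b. f b \<ominus> g b) c = linear_extension R D f c \<ominus> linear_extension R D g c"
proof -
  have fg: "f b \<in> carrier R" "g b \<in> carrier R" for b
    using assms by (auto simp: vectors_iff)
  have "linear_extension R D (\<lambda>b. f b \<ominus> g b) c = linear_extension R D (\<lambda>b. f b \<oplus> (\<ominus> \<one>) \<otimes> g b) c"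
    using fg by (simp add: minus_eq l_minus)
  also have "\<dots> = linear_extension R D f c \<oplus> (\<ominus> \<one>) \<otimes> linear_extension R D g c"
    using assms by (simp add: linear_extension_add linear_extension_smult smult_vectors)
  finally show ?thesis
    using vectors_carrier[OF linear_extension_closed] assms by (simp add: minus_eq l_minus)
qed

lemma linear_extension_single:
  assumes "b \<in> B" "a \<in> carrier R"
  shows "linear_extension R D (\<lambda>c. if c = b then a else \<zero>) c = a \<otimes> D b c"
proof -
  have "D b c \<in> carrier R"
    using D[OF assms(1)] by (rule vectors_carrier)
  moreover have "linear_extension R D (\<lambda>c. if c = b then a else \<zero>) c
      = (\<Oplus>b'\<in>{b}. (if b' = b then a else \<zero>) \<otimes> D b' c)"
    using assms calculation by (intro linear_extension_superset) (auto simp: supp_def)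
  ultimately show ?thesis
    using assms by simp
qed

lemma linear_extension_eq_zeroI:
  assumes f: "f \<in> vectors R B" and "\<And>b. b \<in> B \<Longrightarrow> D b c = \<zero>"
  shows "linear_extension R D f c = \<zero>"
  unfolding linear_extension_def using assms by (intro finsum_zeroI) (auto simp: vectors_iff)

lemma linear_extension_linear_extension_eq_zero:
  assumes "\<And>b. b \<in> B \<Longrightarrow> linear_extension R E (D b) = (\<lambda>_. \<zero>)"
    and E: "\<And>c. c \<in> C \<Longrightarrow> E c \<in> vectors R C'" and f: "f \<in> vectors R B"
  shows "linear_extension R E (linear_extension R D f) = (\<lambda>_. \<zero>)"
proof -
  obtain l where l: "set l \<subseteq> carrier R \<times> B" and fl: "f = linear_combination R l"
    using vectors_linear_combination[OF f] by blast
  show ?thesis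
    using l unfolding fl
  proof (induction l)
    case Nil
    show ?case
      by (auto simp: fun_eq_iff linear_extension_def supp_def)
  next
    case (Cons p l)
    obtain a b where [simp]: "p = (a, b)" and ab: "a \<in> carrier R" "b \<in> B"
      using Cons.prems by (cases p) auto
    have l: "set l \<subseteq> carrier R \<times> B"
      using Cons.prems by auto
    have 1: "linear_extension R D (linear_combination R (p # l))
      = (\<lambda>c. a \<otimes> D b c \<oplus> linear_extension R D (linear_combination R l) c)"
      using ab l by (auto simp: fun_eq_iff linear_extension_add single_vectors
          linear_combination_vectors linear_extension_single)
    show ?case
      unfolding 1
      using ab l E assms(1) Cons.IH
      by (simp add: fun_eq_iff cring.linear_extension_add[OF cring_axioms, of C E C']
          cring.linear_extension_smult[OF cring_axioms, of C E C'] smult_vectors D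
          linear_combination_vectors linear_extension_closed)
  qed
qed

end

end


section \<open>Submodules of finite free modules over a Noetherian ring\<close>

definition vector_submodule :: "('a, 'r) ring_scheme \<Rightarrow> 'b set \<Rightarrow> ('b \<Rightarrow> 'a) set \<Rightarrow> bool" where
  "vector_submodule R B G \<longleftrightarrow>
    G \<subseteq> vectors R B \<and> (\<lambda>_. \<zero>\<^bsub>R\<^esub>) \<in> G \<and>
    (\<forall>v\<in>G. \<forall>w\<in>G. (\<lambda>i. v i \<oplus>\<^bsub>R\<^esub> w i) \<in> G) \<and>
    (\<forall>a\<in>carrier R. \<forall>v\<in>G. (\<lambda>i. a \<otimes>\<^bsub>R\<^esub> v i) \<in> G)"

lemma vector_submoduleD:
  assumes "vector_submodule R B G"
  shows "G \<subseteq> vectors R B" "(\<lambda>_. \<zero>\<^bsub>R\<^esub>) \<in> G"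
    "v \<in> G \<Longrightarrow> w \<in> G \<Longrightarrow> (\<lambda>i. v i \<oplus>\<^bsub>R\<^esub> w i) \<in> G"
    "a \<in> carrier R \<Longrightarrow> v \<in> G \<Longrightarrow> (\<lambda>i. a \<otimes>\<^bsub>R\<^esub> v i) \<in> G"
    "v \<in> G \<Longrightarrow> v i \<in> carrier R"
  using assms unfolding vector_submodule_def by (auto dest: vectors_carrier)

text \<open>
  For an ideal \<open>J\<close> and a submodule \<open>G\<close> this is the submodule \<open>J G\<close>: zero is \<open>0 \<cdot> 0\<close>, and scalars
  are absorbed by \<open>J\<close>.
\<close>

inductive_set ideal_smult ::
    "('a, 'r) ring_scheme \<Rightarrow> 'a set \<Rightarrow> ('b \<Rightarrow> 'a) set \<Rightarrow> ('b \<Rightarrow> 'a) set"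
  for R and J and G where
    prod: "a \<in> J \<Longrightarrow> v \<in> G \<Longrightarrow> (\<lambda>i. a \<otimes>\<^bsub>R\<^esub> v i) \<in> ideal_smult R J G"
  | sum: "v \<in> ideal_smult R J G \<Longrightarrow> w \<in> ideal_smult R J G \<Longrightarrow>
      (\<lambda>i. v i \<oplus>\<^bsub>R\<^esub> w i) \<in> ideal_smult R J G"

context cring
begin

lemma vector_submodule_diff:
  assumes "vector_submodule R B G" "v \<in> G" "w \<in> G"
  shows "(\<lambda>i. v i \<ominus> w i) \<in> G"
proof -
  have "(\<lambda>i. v i \<ominus> w i) = (\<lambda>i. v i \<oplus> (\<ominus> \<one>) \<otimes> w i)"
    using vector_submoduleD(5)[OF assms(1)] assms(2,3) by (simp add: minus_eq l_minus)
  then show ?thesis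
    using vector_submoduleD(3)[OF assms(1)] vector_submoduleD(4)[OF assms(1), of "\<ominus> \<one>"] assms(2,3) by simp
qed

lemma vector_submodule_finsum:
  assumes G: "vector_submodule R B G" and "finite S"
    and "\<And>s. s \<in> S \<Longrightarrow> a s \<in> carrier R" "\<And>s. s \<in> S \<Longrightarrow> v s \<in> G"
  shows "(\<lambda>i. \<Oplus>s\<in>S. a s \<otimes> v s i) \<in> G"
  using assms(2-4)
proof (induction S)
  case empty
  then show ?case
    using vector_submoduleD(2)[OF G] by simp
next
  case (insert s S)
  have "v t i \<in> carrier R" if "t \<in> insert s S" for t i
    using insert.prems that vector_submoduleD(5)[OF G] by blast
  then have "(\<lambda>i. \<Oplus>s\<in>insert s S. a s \<otimes> v s i) = (\<lambda>i. a s \<otimes> v s i \<oplus> (\<Oplus>s\<in>S. a s \<otimes> v s i))"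
    using insert by (auto simp: fun_eq_iff Pi_def)
  moreover have "(\<lambda>i. a s \<otimes> v s i \<oplus> (\<Oplus>s\<in>S. a s \<otimes> v s i)) \<in> G"
    using insert by (intro vector_submoduleD(3)[OF G] vector_submoduleD(4)[OF G]) auto
  ultimately show ?case by simp
qed

lemma vector_submodule_vectors: "vector_submodule R B (vectors R B)"
  by (auto simp: vector_submodule_def intro: zero_vectors add_vectors smult_vectors)

lemma vector_submodule_Int:
  "vector_submodule R B G \<Longrightarrow> vector_submodule R B H \<Longrightarrow> vector_submodule R B (G \<inter> H)"
  by (auto simp: vector_submodule_def)

lemma linear_extension_in_submodule:
  assumes G: "vector_submodule R B G" and "\<And>j. j \<in> C \<Longrightarrow> g j \<in> G" and f: "f \<in> vectors R C"
  shows "linear_extension R g f \<in> G"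
  unfolding linear_extension_def
  using assms by (intro vector_submodule_finsum[OF G]) (auto simp: vectors_iff)

lemma vector_submodule_image:
  assumes g: "\<And>j. j \<in> C \<Longrightarrow> g j \<in> vectors R B"
  shows "vector_submodule R B (linear_extension R g ` vectors R C)"
  unfolding vector_submodule_def
proof (intro conjI ballI)
  show "linear_extension R g ` vectors R C \<subseteq> vectors R B"
    using linear_extension_closed[of C g B] g by auto
  have "linear_extension R g (\<lambda>_. \<zero>) = (\<lambda>_. \<zero>)"
    by (auto simp: linear_extension_def supp_def)
  then show "(\<lambda>_. \<zero>) \<in> linear_extension R g ` vectors R C"
    using zero_vectors by (metis imageI)
next
  fix v w assume "v \<in> linear_extension R g ` vectors R C" "w \<in> linear_extension R g ` vectors R C"
  then obtain x y where *: "x \<in> vectors R C" "y \<in> vectors R C"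
    and vw: "v = linear_extension R g x" "w = linear_extension R g y" by blast
  have "(\<lambda>i. v i \<oplus> w i) = linear_extension R g (\<lambda>j. x j \<oplus> y j)"
    unfolding vw using linear_extension_add[OF g *] by (intro ext) simp
  then show "(\<lambda>i. v i \<oplus> w i) \<in> linear_extension R g ` vectors R C"
    using add_vectors[OF *] by (rule image_eqI)
next
  fix a v assume a: "a \<in> carrier R" and "v \<in> linear_extension R g ` vectors R C"
  then obtain x where *: "x \<in> vectors R C" and v: "v = linear_extension R g x" by blast
  have "(\<lambda>i. a \<otimes> v i) = linear_extension R g (\<lambda>j. a \<otimes> x j)"
    unfolding v using linear_extension_smult[OF g * a] by (intro ext) simp
  then show "(\<lambda>i. a \<otimes> v i) \<in> linear_extension R g ` vectors R C"
    using smult_vectors[OF * a] by (rule image_eqI)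
qed

lemma vector_submodule_kernel:
  assumes g: "\<And>j. j \<in> C \<Longrightarrow> g j \<in> vectors R B"
  shows "vector_submodule R C {v \<in> vectors R C. linear_extension R g v = (\<lambda>_. \<zero>)}"
proof -
  have "linear_extension R g (\<lambda>_. \<zero>) = (\<lambda>_. \<zero>)"
    by (auto simp: linear_extension_def supp_def)
  then show ?thesis
    unfolding vector_submodule_def
    using linear_extension_add[of C g B] linear_extension_smult[of C g B] g
    by (auto simp: zero_vectors add_vectors smult_vectors fun_eq_iff)
qed

lemma ideal_addI:
  assumes "S \<subseteq> carrier R" "\<zero> \<in> S" "\<And>a b. a \<in> S \<Longrightarrow> b \<in> S \<Longrightarrow> a \<oplus> b \<in> S"
    "\<And>a r. a \<in> S \<Longrightarrow> r \<in> carrier R \<Longrightarrow> r \<otimes> a \<in> S"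
  shows "ideal S R"
proof (rule idealI)
  show "subgroup S (add_monoid R)"
  proof (rule subgroup.intro)
    fix x assume "x \<in> S"
    then have "\<ominus> x = (\<ominus> \<one>) \<otimes> x"
      using assms(1) by (auto simp: l_minus)
    then show "inv\<^bsub>add_monoid R\<^esub> x \<in> S"
      using assms(4)[OF \<open>x \<in> S\<close>, of "\<ominus> \<one>"] by (simp add: a_inv_def)
  qed (use assms in auto)
  show "a \<otimes> x \<in> S" if "a \<in> S" "x \<in> carrier R" for a x
    using assms(1) assms(4)[OF that] that m_comm by (metis subsetD)
qed (use assms ring_axioms in auto)

lemma vector_submodule_ideal_valued:
  assumes "ideal J R"
  shows "vector_submodule R B {v \<in> vectors R B. \<forall>i. v i \<in> J}"
proof -
  interpret J: ideal J R by fact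
  show ?thesis
    unfolding vector_submodule_def
    by (auto simp: zero_vectors add_vectors smult_vectors J.I_l_closed)
qed

lemma vector_submodule_ideal_smult:
  assumes G: "vector_submodule R B G" and "ideal J R"
  shows "vector_submodule R B (ideal_smult R J G)" and "ideal_smult R J G \<subseteq> G"
proof -
  interpret J: ideal J R by fact
  have sub: "v \<in> G" if "v \<in> ideal_smult R J G" for v
    using that by induction (auto intro: vector_submoduleD[OF G] J.Icarr)
  then show "ideal_smult R J G \<subseteq> G" by blast
  have "(\<lambda>i. \<zero> \<otimes> \<zero>) \<in> ideal_smult R J G"
    using ideal_smult.prod[OF J.zero_closed vector_submoduleD(2)[OF G]] .
  moreover have "(\<lambda>i. a \<otimes> v i) \<in> ideal_smult R J G" if "v \<in> ideal_smult R J G" "a \<in> carrier R" for a v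
    using that(1)
  proof induction
    case (prod b v)
    have "(\<lambda>i. a \<otimes> (b \<otimes> v i)) = (\<lambda>i. (a \<otimes> b) \<otimes> v i)"
      using that(2) prod vector_submoduleD(5)[OF G] J.Icarr by (simp add: m_assoc)
    then show ?case
      using prod that(2) by (simp add: ideal_smult.prod J.I_l_closed)
  next
    case (sum v w)
    have "(\<lambda>i. a \<otimes> (v i \<oplus> w i)) = (\<lambda>i. a \<otimes> v i \<oplus> a \<otimes> w i)"
      using that(2) sub[OF sum(1)] sub[OF sum(2)] vector_submoduleD(5)[OF G] by (simp add: r_distr)
    then show ?case
      using sum by (simp add: ideal_smult.sum)
  qed
  ultimately show "vector_submodule R B (ideal_smult R J G)"
    unfolding vector_submodule_def
    using sub vector_submoduleD(1)[OF G] by (auto intro: ideal_smult.sum)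
qed

end

locale noetherian_cring = cring R + noetherian_ring R for R (structure)

context noetherian_cring
begin

text \<open>
  Finite generation says here that \<open>G\<close> is contained in every submodule that contains \<open>A\<close>, which
  avoids linear combinations in the induction on \<open>k\<close>.  The last entries of the elements of \<open>G\<close> form
  an ideal; lifts of its generators, together with generators of the submodule of all elements of
  \<open>G\<close> with last entry \<open>0\<close>, generate \<open>G\<close>.
\<close>

lemma vector_submodule_finitely_generated:
  fixes k :: nat
  assumes "vector_submodule R {..<k} G"
  shows "\<exists>A. finite A \<and> A \<subseteq> G \<and> (\<forall>H. vector_submodule R {..<k} H \<and> A \<subseteq> H \<longrightarrow> G \<subseteq> H)"
  using assms
proof (induction k arbitrary: G)
  case 0
  have "v = (\<lambda>_. \<zero>)" if "v \<in> vectors R {..<0::nat}" for v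
    using that by (auto simp: fun_eq_iff vectors_iff supp_def)
  then have "G \<subseteq> {\<lambda>_. \<zero>}"
    using vector_submoduleD(1)[OF 0] by blast
  then show ?case
    by (intro exI[of _ "{}"]) (auto dest: vector_submoduleD(2))
next
  case (Suc k)
  note G = Suc.prems
  have sub: "vector_submodule R {..<k} (H \<inter> vectors R {..<k})"
    if "vector_submodule R {..<Suc k} H" for H
    using that by (auto simp: vector_submodule_def zero_vectors add_vectors smult_vectors)
  have lead: "ideal ((\<lambda>v. v k) ` H) R" if H: "vector_submodule R {..<Suc k} H" for H
  proof (rule ideal_addI)
    show "(\<lambda>v. v k) ` H \<subseteq> carrier R"
      using vector_submoduleD(5)[OF H] by auto
    show "\<zero> \<in> (\<lambda>v. v k) ` H"
      using vector_submoduleD(2)[OF H] by (metis image_eqI)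
    show "a \<oplus> b \<in> (\<lambda>v. v k) ` H" if "a \<in> (\<lambda>v. v k) ` H" "b \<in> (\<lambda>v. v k) ` H" for a b
    proof -
      from that obtain v w where "v \<in> H" "w \<in> H" "a = v k" "b = w k" by auto
      then show ?thesis
        using vector_submoduleD(3)[OF H, of v w] by (auto intro!: image_eqI[where x = "\<lambda>i. v i \<oplus> w i"])
    qed
    show "r \<otimes> a \<in> (\<lambda>v. v k) ` H" if "a \<in> (\<lambda>v. v k) ` H" "r \<in> carrier R" for a r
    proof -
      from that obtain v where "v \<in> H" "a = v k" by auto
      then show ?thesis
        using vector_submoduleD(4)[OF H, of r v] that(2) by (auto intro!: image_eqI[where x = "\<lambda>i. r \<otimes> v i"])
    qed
  qed
  obtain A where A: "A \<subseteq> carrier R" "finite A" "(\<lambda>v. v k) ` G = Idl A"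
    using finetely_gen[OF lead[OF G]] by blast
  then have "A \<subseteq> (\<lambda>v. v k) ` G"
    using genideal_self by blast
  then obtain A1 where A1: "A1 \<subseteq> G" "finite A1" "A = (\<lambda>v. v k) ` A1"
    using A(2) by (meson finite_subset_image)
  obtain A2 where A2: "finite A2" "A2 \<subseteq> G \<inter> vectors R {..<k}"
    and min: "\<And>H. vector_submodule R {..<k} H \<Longrightarrow> A2 \<subseteq> H \<Longrightarrow> G \<inter> vectors R {..<k} \<subseteq> H"
    using Suc.IH[OF sub[OF G]] by (elim exE conjE) (metis (no_types))
  have "G \<subseteq> H" if H0: "vector_submodule R {..<Suc k} H" and AH0: "A1 \<union> A2 \<subseteq> H" for H
  proof
    fix v assume v: "v \<in> G"
    \<comment> \<open>Elements of \<open>H\<close> that are used to correct last entries must stay in \<open>G\<close>.\<close>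
    define H' where "H' = H \<inter> G"
    have H: "vector_submodule R {..<Suc k} H'" and AH: "A1 \<union> A2 \<subseteq> H'"
      using H0 G AH0 A1 A2 unfolding H'_def by (auto intro: vector_submodule_Int)
    have "G \<inter> vectors R {..<k} \<subseteq> H' \<inter> vectors R {..<k}"
      using AH A2 by (intro min sub H) auto
    moreover have "Idl A \<subseteq> (\<lambda>v. v k) ` H'"
      using AH A1 by (intro genideal_minimal lead H) auto
    then obtain h where h: "h \<in> H'" "v k = h k"
      using v A(3) by (metis (no_types, lifting) image_iff subsetD)
    have vh: "v i \<in> carrier R" "h i \<in> carrier R" for i
      using v h vector_submoduleD(5)[OF G] vector_submoduleD(5)[OF H] by auto
    have d: "(\<lambda>i. v i \<ominus> h i) \<in> G"
      using v h(1) vector_submodule_diff[OF G] by (auto simp: H'_def)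
    moreover have "supp R (\<lambda>i. v i \<ominus> h i) \<subseteq> {..<k}"
    proof -
      have "supp R (\<lambda>i. v i \<ominus> h i) \<subseteq> {..<Suc k}"
        using subsetD[OF vector_submoduleD(1)[OF G] d] by (simp add: vectors_iff)
      moreover have "k \<notin> supp R (\<lambda>i. v i \<ominus> h i)"
        using h(2) vh(2)[of k] by (auto simp: supp_def minus_eq r_neg)
      ultimately show ?thesis
        by (metis lessThan_Suc subset_insert)
    qed
    then have "(\<lambda>i. v i \<ominus> h i) \<in> vectors R {..<k}"
      using subsetD[OF vector_submoduleD(1)[OF G] d] by (simp add: vectors_iff)
    ultimately have "(\<lambda>i. (v i \<ominus> h i) \<oplus> h i) \<in> H'"
      using h(1) vector_submoduleD(3)[OF H] by blast
    moreover have "(\<lambda>i. (v i \<ominus> h i) \<oplus> h i) = v"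
      using vh by (auto simp: fun_eq_iff minus_eq a_assoc l_neg)
    ultimately show "v \<in> H"
      by (simp add: H'_def)
  qed
  then show ?case
    using A1 A2 by (intro exI[of _ "A1 \<union> A2"]) blast
qed

text \<open>
  The image of \<open>R\<^sup>N\<close> under the map defined by an enumeration of the generating set is a submodule
  that contains this set.
\<close>

lemma vector_submodule_generators:
  fixes k :: nat
  assumes G: "vector_submodule R {..<k} G"
  obtains N :: nat and g where "\<And>j. j < N \<Longrightarrow> g j \<in> G" "G = linear_extension R g ` vectors R {..<N}"
proof -
  obtain A where A: "finite A" "A \<subseteq> G"
    and min: "\<And>H. vector_submodule R {..<k} H \<Longrightarrow> A \<subseteq> H \<Longrightarrow> G \<subseteq> H"
    using vector_submodule_finitely_generated[OF G] by (elim exE conjE) (metis (no_types))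
  obtain N :: nat and g where g: "A = g ` {i. i < N}"
    using A(1) by (auto simp: finite_conv_nat_seg_image)
  have gG: "g j \<in> G" if "j < N" for j
    using that A(2) g by auto
  then have gV: "g j \<in> vectors R {..<k}" if "j \<in> {..<N}" for j
    using that vector_submoduleD(1)[OF G] by auto
  have "A \<subseteq> linear_extension R g ` vectors R {..<N}"
  proof
    fix v assume "v \<in> A"
    then obtain j where j: "j < N" "v = g j"
      using g by auto
    then have "v = linear_extension R g (\<lambda>c. if c = j then \<one> else \<zero>)"
      using linear_extension_single[of "{..<N}" g "{..<k}" j \<one>] gV vectors_carrier[OF gV[of j]]
      by (intro ext) simp
    then show "v \<in> linear_extension R g ` vectors R {..<N}"
      using single_vectors[of j "{..<N}" \<one>] j by blast
  qed
  then have "G \<subseteq> linear_extension R g ` vectors R {..<N}"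
    using gV by (intro min vector_submodule_image) auto
  moreover have "linear_extension R g ` vectors R {..<N} \<subseteq> G"
    using linear_extension_in_submodule[OF G, of "{..<N}" g] gG by auto
  ultimately show ?thesis
    using that gG by blast
qed

text \<open>
  Finitely many generators of the union occur in one member of the chain.
\<close>

lemma vector_submodule_chain_stable:
  fixes k :: nat
  assumes M: "\<And>m. vector_submodule R {..<k} (M m)" and mono: "\<And>m. M m \<subseteq> M (Suc m)"
  shows "\<exists>m. \<forall>n\<ge>m. M n = M m"
proof -
  have mono': "M m \<subseteq> M n" if "m \<le> n" for m n
    using mono that by (rule lift_Suc_mono_le)
  have "vector_submodule R {..<k} (\<Union>m. M m)"
    unfolding vector_submodule_def
  proof (intro conjI ballI)
    fix v w assume "v \<in> (\<Union>m. M m)" "w \<in> (\<Union>m. M m)"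
    then obtain m n where "v \<in> M m" "w \<in> M n" by blast
    then have "v \<in> M (max m n)" "w \<in> M (max m n)"
      using mono'[of m "max m n"] mono'[of n "max m n"] by auto
    then show "(\<lambda>i. v i \<oplus> w i) \<in> (\<Union>m. M m)"
      using vector_submoduleD(3)[OF M] by blast
  next
    show "(\<Union>m. M m) \<subseteq> vectors R {..<k}"
      using vector_submoduleD(1)[OF M] by blast
    show "(\<lambda>_. \<zero>) \<in> (\<Union>m. M m)"
      using vector_submoduleD(2)[OF M] by blast
  next
    fix a v assume "a \<in> carrier R" "v \<in> (\<Union>m. M m)"
    then show "(\<lambda>i. a \<otimes> v i) \<in> (\<Union>m. M m)"
      using vector_submoduleD(4)[OF M] by blast
  qed
  then obtain A where A: "finite A" "A \<subseteq> (\<Union>m. M m)"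
    and min: "\<And>H. vector_submodule R {..<k} H \<Longrightarrow> A \<subseteq> H \<Longrightarrow> (\<Union>m. M m) \<subseteq> H"
    using vector_submodule_finitely_generated by (metis (no_types, lifting))
  obtain m where "A \<subseteq> M m"
  proof -
    have "\<exists>m. A \<subseteq> M m"
      using A
    proof (induction A)
      case (insert x A)
      then obtain m n where "A \<subseteq> M m" "x \<in> M n" by blast
      then have "insert x A \<subseteq> M (max m n)"
        using mono'[of m "max m n"] mono'[of n "max m n"] by auto
      then show ?case by blast
    qed auto
    then show ?thesis using that by blast
  qed
  then have "(\<Union>m. M m) \<subseteq> M m"
    by (intro min M)
  then show ?thesis
    using mono' by (intro exI[of _ m]) blast
qed

end


section \<open>Powers of an ideal and a weak Artin-Rees lemma\<close>

context cring
begin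

lemma ideals_set_simps [simp]: "\<one>\<^bsub>ideals_set R\<^esub> = carrier R" "J \<otimes>\<^bsub>ideals_set R\<^esub> K = ideal_prod R J K"
  by (simp_all add: ideals_set_def)

lemma ideal_ideal_power:
  assumes "ideal I R"
  shows "ideal (I [^]\<^bsub>ideals_set R\<^esub> (n::nat)) R"
  by (induction n) (auto simp: oneideal assms ideal_prod_is_ideal)

lemma ideal_power_antimono:
  assumes "ideal I R" "m \<le> n"
  shows "I [^]\<^bsub>ideals_set R\<^esub> n \<subseteq> I [^]\<^bsub>ideals_set R\<^esub> (m::nat)"
proof -
  have "I [^]\<^bsub>ideals_set R\<^esub> Suc n \<subseteq> I [^]\<^bsub>ideals_set R\<^esub> n" for n :: nat
    using ideal_prod_inter[OF ideal_ideal_power[OF assms(1)] assms(1)] by auto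
  then show ?thesis
    using assms(2) by (rule lift_Suc_antimono_le)
qed

lemma ideal_power_add:
  assumes "ideal I R"
  shows "I [^]\<^bsub>ideals_set R\<^esub> (m + n) =
    ideal_prod R (I [^]\<^bsub>ideals_set R\<^esub> m) (I [^]\<^bsub>ideals_set R\<^esub> (n::nat))"
  by (induction n)
    (auto simp: ideal_prod_one ideal_prod_assoc ideal_ideal_power assms)

lemma power_in_ideal_power:
  assumes "x \<in> I" "ideal I R"
  shows "x [^] n \<in> I [^]\<^bsub>ideals_set R\<^esub> (n::nat)"
proof (induction n)
  case 0
  then show ?case by simp
next
  case (Suc n)
  then show ?case
    using assms(1) by (simp add: ideal_prod.prod)
qed

end

context noetherian_cring
begin

text \<open>
  If every element of \<open>I\<close> acts nilpotently on \<open>R\<^sup>k / L\<close>, then so does \<open>I\<close> itself.  The elements killed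
  by \<open>I\<^sup>n\<close> modulo \<open>L\<close> form a chain that stops at a submodule \<open>M m\<close> which contains every vector that
  \<open>I\<close> maps into it.  A vector outside \<open>M m\<close> could be multiplied by powers of one generator of \<open>I\<close> after
  the other until all of them map it into \<open>M m\<close> although it is itself still outside.
\<close>

lemma ideal_power_smult_subset:
  fixes k :: nat
  assumes I: "ideal I R" and L: "vector_submodule R {..<k} L"
    and nil: "\<And>x v. x \<in> I \<Longrightarrow> v \<in> vectors R {..<k} \<Longrightarrow> \<exists>e::nat. (\<lambda>i. x [^] e \<otimes> v i) \<in> L"
  obtains m where "\<And>a v. a \<in> I [^]\<^bsub>ideals_set R\<^esub> (m::nat) \<Longrightarrow> v \<in> vectors R {..<k} \<Longrightarrow> (\<lambda>i. a \<otimes> v i) \<in> L"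
proof -
  interpret I: ideal I R by fact
  define J where "J n = I [^]\<^bsub>ideals_set R\<^esub> n" for n :: nat
  have J: "ideal (J n) R" for n
    unfolding J_def by (rule ideal_ideal_power[OF I])
  have Jcarr: "a \<in> carrier R" if "a \<in> J n" for a n
    using J that by (rule ideal.Icarr)
  define M where "M n = {v \<in> vectors R {..<k}. \<forall>a\<in>J n. (\<lambda>i. a \<otimes> v i) \<in> L}" for n
  have LV: "L \<subseteq> vectors R {..<k}"
    by (rule vector_submoduleD(1)[OF L])
  have M: "vector_submodule R {..<k} (M n)" for n
    unfolding vector_submodule_def
  proof (intro conjI ballI)
    show "(\<lambda>_. \<zero>) \<in> M n"
      using vector_submoduleD(2)[OF L] Jcarr by (auto simp: M_def zero_vectors)
  next
    fix v w assume vw: "v \<in> M n" "w \<in> M n"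
    have "(\<lambda>i. a \<otimes> (v i \<oplus> w i)) = (\<lambda>i. a \<otimes> v i \<oplus> a \<otimes> w i)" if "a \<in> J n" for a
      using Jcarr[OF that] vw by (auto simp: r_distr vectors_carrier M_def)
    then show "(\<lambda>i. v i \<oplus> w i) \<in> M n"
      using vw vector_submoduleD(3)[OF L] by (auto simp: M_def add_vectors)
  next
    fix b v assume b: "b \<in> carrier R" and v: "v \<in> M n"
    have "(\<lambda>i. a \<otimes> (b \<otimes> v i)) = (\<lambda>i. b \<otimes> (a \<otimes> v i))" if "a \<in> J n" for a
      using Jcarr[OF that] v b by (auto simp: m_lcomm vectors_carrier M_def)
    then show "(\<lambda>i. b \<otimes> v i) \<in> M n"
      using v b vector_submoduleD(4)[OF L] by (auto simp: M_def smult_vectors)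
  qed (auto simp: M_def)
  have "M n \<subseteq> M (Suc n)" for n
    using ideal_power_antimono[OF I, of n "Suc n"] by (auto simp: M_def J_def)
  then obtain m where stable: "\<And>n. m \<le> n \<Longrightarrow> M n = M m"
    using vector_submodule_chain_stable[of k M, OF M] by meson
  have LM: "L \<subseteq> M m"
    using LV vector_submoduleD(4)[OF L] Jcarr by (auto simp: M_def)
  have sat: "v \<in> M m" if v: "v \<in> vectors R {..<k}" and Iv: "\<And>x. x \<in> I \<Longrightarrow> (\<lambda>i. x \<otimes> v i) \<in> M m" for v
  proof -
    have "(\<lambda>i. a \<otimes> v i) \<in> L" if "a \<in> J (Suc m)" for a
    proof -
      have "a \<in> ideal_prod R (J m) I"
        using that by (simp add: J_def)
      then show ?thesis
      proof induction
        case (prod i j)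
        have "(\<lambda>l. i \<otimes> j \<otimes> v l) = (\<lambda>l. i \<otimes> (j \<otimes> v l))"
          using prod v Jcarr by (auto simp: m_assoc vectors_carrier)
        then show ?case
          using Iv[OF prod(2)] prod(1) by (simp add: M_def)
      next
        case (sum s t)
        have "s \<in> carrier R" "t \<in> carrier R"
          using sum ideal_prod_in_carrier[OF J I] by auto
        then have "(\<lambda>l. (s \<oplus> t) \<otimes> v l) = (\<lambda>l. s \<otimes> v l \<oplus> t \<otimes> v l)"
          using v by (auto simp: l_distr vectors_carrier)
        then show ?case
          using sum vector_submoduleD(3)[OF L] by simp
      qed
    qed
    then have "v \<in> M (Suc m)"
      using v by (simp add: M_def)
    then show ?thesis
      using stable[of "Suc m"] by simp
  qed
  obtain A where A: "A \<subseteq> carrier R" "finite A" "I = Idl A"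
    using finetely_gen[OF I] by blast
  have "vectors R {..<k} \<subseteq> M m"
  proof (rule ccontr)
    assume "\<not> vectors R {..<k} \<subseteq> M m"
    then obtain v0 where v0: "v0 \<in> vectors R {..<k}" "v0 \<notin> M m" by blast
    have "\<exists>v. v \<in> vectors R {..<k} \<and> v \<notin> M m \<and> (\<forall>x\<in>B. (\<lambda>i. x \<otimes> v i) \<in> M m)"
      if "finite B" "B \<subseteq> I" for B
      using that
    proof (induction B)
      case empty
      then show ?case using v0 by blast
    next
      case (insert x B)
      then obtain v where v: "v \<in> vectors R {..<k}" "v \<notin> M m" "\<And>y. y \<in> B \<Longrightarrow> (\<lambda>i. y \<otimes> v i) \<in> M m"
        by blast
      have x: "x \<in> carrier R" and B: "B \<subseteq> carrier R"
        using insert I.a_subset by auto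
      have vc: "v i \<in> carrier R" for i
        using v(1) by (rule vectors_carrier)
      define P where "P e \<longleftrightarrow> (\<lambda>i. x [^] e \<otimes> v i) \<in> M m" for e :: nat
      have "\<exists>e. P e"
        using nil[of x v] insert.prems v(1) LM by (auto simp: P_def)
      moreover have "\<not> P 0"
        using v(2) vc by (simp add: P_def)
      \<comment> \<open>The last power of \<open>x\<close> that leaves the vector outside \<open>M m\<close>.\<close>
      ultimately obtain e where e: "\<not> P e" "P (Suc e)"
        using nat_induct[of "\<lambda>e. \<not> P e"] by blast
      let ?w = "\<lambda>i. x [^] e \<otimes> v i"
      have "(\<lambda>i. y \<otimes> ?w i) \<in> M m" if "y \<in> B" for y
      proof -
        have "(\<lambda>i. y \<otimes> ?w i) = (\<lambda>i. x [^] e \<otimes> (y \<otimes> v i))"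
          using that B x vc by (auto simp: m_lcomm)
        then show ?thesis
          using vector_submoduleD(4)[OF M, of "x [^] e"] v(3)[OF that] x by simp
      qed
      moreover have "(\<lambda>i. x \<otimes> ?w i) = (\<lambda>i. x [^] Suc e \<otimes> v i)"
        using x vc by (auto simp: m_assoc m_lcomm)
      ultimately show ?case
        using e v(1) x smult_vectors[OF v(1), of "x [^] e"] by (intro exI[of _ ?w]) (auto simp: P_def)
    qed
    moreover have "A \<subseteq> I"
      using A genideal_self[OF A(1)] by simp
    ultimately obtain v where v: "v \<in> vectors R {..<k}" "v \<notin> M m" "\<And>x. x \<in> A \<Longrightarrow> (\<lambda>i. x \<otimes> v i) \<in> M m"
      using A(2) by meson
    have vc: "v i \<in> carrier R" for i
      using v(1) by (rule vectors_carrier)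
    have "ideal {x \<in> carrier R. (\<lambda>i. x \<otimes> v i) \<in> M m} R"
    proof (rule ideal_addI)
      show "\<zero> \<in> {x \<in> carrier R. (\<lambda>i. x \<otimes> v i) \<in> M m}"
        using vector_submoduleD(2)[OF M] vc by simp
      show "a \<oplus> b \<in> {x \<in> carrier R. (\<lambda>i. x \<otimes> v i) \<in> M m}"
        if "a \<in> {x \<in> carrier R. (\<lambda>i. x \<otimes> v i) \<in> M m}" "b \<in> {x \<in> carrier R. (\<lambda>i. x \<otimes> v i) \<in> M m}" for a b
        using that vector_submoduleD(3)[OF M, of "\<lambda>i. a \<otimes> v i" m "\<lambda>i. b \<otimes> v i"] vc by (auto simp: l_distr)
      show "r \<otimes> a \<in> {x \<in> carrier R. (\<lambda>i. x \<otimes> v i) \<in> M m}"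
        if "a \<in> {x \<in> carrier R. (\<lambda>i. x \<otimes> v i) \<in> M m}" "r \<in> carrier R" for a r
        using that vector_submoduleD(4)[OF M, of r "\<lambda>i. a \<otimes> v i" m] vc by (auto simp: m_assoc)
    qed auto
    moreover have "A \<subseteq> {x \<in> carrier R. (\<lambda>i. x \<otimes> v i) \<in> M m}"
      using v(3) A(1) by blast
    ultimately have "Idl A \<subseteq> {x \<in> carrier R. (\<lambda>i. x \<otimes> v i) \<in> M m}"
      by (rule genideal_minimal)
    then have "v \<in> M m"
      using A(3) sat[OF v(1)] by blast
    then show False
      using v(2) by simp
  qed
  then show ?thesis
    using that[of m] by (auto simp: M_def J_def)
qed

text \<open>
  The \<open>I\<close>-adic topology of \<open>K\<close> is induced by that of \<open>R\<^sup>k\<close>: \<open>K \<inter> (I\<^sup>q)\<^sup>k \<subseteq> I\<^sup>u K\<close> for large \<open>q\<close>.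
  Let \<open>L\<close> be a maximal submodule with \<open>L \<inter> K = I\<^sup>u K\<close>; it exists by Zorn's lemma.  For \<open>x \<in> I\<close> choose
  \<open>e\<close> such that the submodules \<open>L : x\<^sup>n\<close> are constant for \<open>n \<ge> e\<close>.  If \<open>l + x\<^sup>e v\<close> is in \<open>K\<close>, then its
  multiple by \<open>x\<^sup>u\<close> is in \<open>I\<^sup>u K \<subseteq> L\<close>, hence \<open>x\<^sup>e\<^sup>+\<^sup>u v \<in> L\<close>, hence \<open>x\<^sup>e v \<in> L\<close>.  So \<open>L + x\<^sup>e R\<^sup>k\<close> has the same
  intersection with \<open>K\<close> as \<open>L\<close>, and \<open>x\<^sup>e R\<^sup>k \<subseteq> L\<close> by maximality.  Therefore \<open>I\<^sup>m R\<^sup>k \<subseteq> L\<close> for some \<open>m\<close>,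
  and \<open>K \<inter> (I\<^sup>m)\<^sup>k \<subseteq> L \<inter> K = I\<^sup>u K\<close>.
\<close>

lemma weak_Artin_Rees:
  fixes k u :: nat
  assumes I: "ideal I R" and K: "vector_submodule R {..<k} K"
  obtains m :: nat where "\<And>q v. m \<le> q \<Longrightarrow> v \<in> K \<Longrightarrow> (\<And>i. v i \<in> I [^]\<^bsub>ideals_set R\<^esub> q) \<Longrightarrow>
    v \<in> ideal_smult R (I [^]\<^bsub>ideals_set R\<^esub> u) K"
proof -
  interpret I: ideal I R by fact
  define J where "J n = I [^]\<^bsub>ideals_set R\<^esub> n" for n :: nat
  have J: "ideal (J n) R" for n
    unfolding J_def by (rule ideal_ideal_power[OF I])
  define H where "H = ideal_smult R (J u) K"
  have H: "vector_submodule R {..<k} H" "H \<subseteq> K"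
    unfolding H_def using vector_submodule_ideal_smult[OF K J] by auto
  define F where "F = {L. vector_submodule R {..<k} L \<and> L \<inter> K = H}"
  have "\<exists>L\<in>F. \<forall>X\<in>F. L \<subseteq> X \<longrightarrow> X = L"
  proof (rule subset_Zorn_nonempty)
    show "F \<noteq> {}"
      using H by (auto simp: F_def)
    fix C assume C: "C \<noteq> {}" "subset.chain F C"
    have sub: "vector_submodule R {..<k} L" "L \<inter> K = H" if "L \<in> C" for L
      using C(2) that by (auto simp: F_def subset.chain_def)
    have "vector_submodule R {..<k} (\<Union>C)"
      unfolding vector_submodule_def
    proof (intro conjI ballI)
      fix v w assume "v \<in> \<Union>C" "w \<in> \<Union>C"
      then obtain X Y where XY: "X \<in> C" "Y \<in> C" "v \<in> X" "w \<in> Y" by blast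
      then have "X \<subseteq> Y \<or> Y \<subseteq> X"
        using C(2) by (auto simp: subset_chain_def)
      then show "(\<lambda>i. v i \<oplus> w i) \<in> \<Union>C"
        using XY vector_submoduleD(3)[OF sub(1)] by blast
    next
      show "\<Union>C \<subseteq> vectors R {..<k}"
        using vector_submoduleD(1)[OF sub(1)] by blast
      show "(\<lambda>_. \<zero>) \<in> \<Union>C"
        using C(1) vector_submoduleD(2)[OF sub(1)] by blast
    next
      fix a v assume "a \<in> carrier R" "v \<in> \<Union>C"
      then show "(\<lambda>i. a \<otimes> v i) \<in> \<Union>C"
        using vector_submoduleD(4)[OF sub(1)] by blast
    qed
    moreover have "\<Union>C \<inter> K = H"
      using C(1) sub(2) by blast
    ultimately show "\<Union>C \<in> F"
      by (simp add: F_def)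
  qed
  then obtain L where L: "vector_submodule R {..<k} L" and LK: "L \<inter> K = H"
    and max: "\<And>X. vector_submodule R {..<k} X \<Longrightarrow> X \<inter> K = H \<Longrightarrow> L \<subseteq> X \<Longrightarrow> X = L"
    unfolding F_def by blast
  have LV: "L \<subseteq> vectors R {..<k}"
    by (rule vector_submoduleD(1)[OF L])
  have "\<exists>e::nat. (\<lambda>i. x [^] e \<otimes> v i) \<in> L" if x: "x \<in> I" and "v \<in> vectors R {..<k}" for x v
  proof -
    have xc: "x \<in> carrier R"
      using x I.Icarr by blast
    define M where "M e = {v \<in> vectors R {..<k}. (\<lambda>i. x [^] e \<otimes> v i) \<in> L}" for e :: nat
    have M: "vector_submodule R {..<k} (M e)" for e
      unfolding vector_submodule_def
    proof (intro conjI ballI)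
      show "(\<lambda>_. \<zero>) \<in> M e"
        using vector_submoduleD(2)[OF L] xc by (auto simp: M_def zero_vectors)
    next
      fix v w assume vw: "v \<in> M e" "w \<in> M e"
      have "(\<lambda>i. x [^] e \<otimes> (v i \<oplus> w i)) = (\<lambda>i. x [^] e \<otimes> v i \<oplus> x [^] e \<otimes> w i)"
        using xc vw by (auto simp: r_distr vectors_carrier M_def)
      then show "(\<lambda>i. v i \<oplus> w i) \<in> M e"
        using vw vector_submoduleD(3)[OF L] by (auto simp: M_def add_vectors)
    next
      fix b v assume b: "b \<in> carrier R" and v: "v \<in> M e"
      have "(\<lambda>i. x [^] e \<otimes> (b \<otimes> v i)) = (\<lambda>i. b \<otimes> (x [^] e \<otimes> v i))"
        using xc v b by (auto simp: m_lcomm vectors_carrier M_def)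
      then show "(\<lambda>i. b \<otimes> v i) \<in> M e"
        using v b vector_submoduleD(4)[OF L] by (auto simp: M_def smult_vectors)
    qed (auto simp: M_def)
    have "M e \<subseteq> M (Suc e)" for e
    proof
      fix v assume v: "v \<in> M e"
      then have "(\<lambda>i. x [^] Suc e \<otimes> v i) = (\<lambda>i. x \<otimes> (x [^] e \<otimes> v i))"
        using xc by (auto simp: M_def vectors_carrier m_assoc m_lcomm)
      then show "v \<in> M (Suc e)"
        using v vector_submoduleD(4)[OF L xc] by (auto simp: M_def)
    qed
    then obtain e where stable: "\<And>n. e \<le> n \<Longrightarrow> M n = M e"
      using vector_submodule_chain_stable[of k M, OF M] by meson
    define L' where "L' = {(\<lambda>i. l i \<oplus> x [^] e \<otimes> v i) | l v. l \<in> L \<and> v \<in> vectors R {..<k}}"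
    have L'I: "w \<in> L'" if "w = (\<lambda>i. l i \<oplus> x [^] e \<otimes> v i)" "l \<in> L" "v \<in> vectors R {..<k}" for w l v
      using that by (auto simp: L'_def)
    have lc: "l i \<in> carrier R" if "l \<in> L" for l i
      using subsetD[OF LV that] by (rule vectors_carrier)
    have L': "vector_submodule R {..<k} L'"
      unfolding vector_submodule_def
    proof (intro conjI ballI)
      show "L' \<subseteq> vectors R {..<k}"
        using LV xc by (auto simp: L'_def intro!: add_vectors smult_vectors)
      show "(\<lambda>_. \<zero>) \<in> L'"
        using vector_submoduleD(2)[OF L] zero_vectors xc
        by (intro L'I[of _ "\<lambda>_. \<zero>" "\<lambda>_. \<zero>"]) auto
    next
      fix w w' assume "w \<in> L'" "w' \<in> L'"
      then obtain l v l' v' where *: "l \<in> L" "v \<in> vectors R {..<k}" "l' \<in> L" "v' \<in> vectors R {..<k}"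
        "w = (\<lambda>i. l i \<oplus> x [^] e \<otimes> v i)" "w' = (\<lambda>i. l' i \<oplus> x [^] e \<otimes> v' i)"
        by (auto simp: L'_def)
      have "(\<lambda>i. w i \<oplus> w' i) = (\<lambda>i. (l i \<oplus> l' i) \<oplus> x [^] e \<otimes> (v i \<oplus> v' i))"
        using * xc lc by (auto simp: r_distr vectors_carrier a_ac)
      then show "(\<lambda>i. w i \<oplus> w' i) \<in> L'"
        using add_vectors[OF *(2,4)] vector_submoduleD(3)[OF L *(1,3)] by (intro L'I)
    next
      fix b w assume b: "b \<in> carrier R" "w \<in> L'"
      then obtain l v where *: "l \<in> L" "v \<in> vectors R {..<k}" "w = (\<lambda>i. l i \<oplus> x [^] e \<otimes> v i)"
        by (auto simp: L'_def)
      have "(\<lambda>i. b \<otimes> w i) = (\<lambda>i. (b \<otimes> l i) \<oplus> x [^] e \<otimes> (b \<otimes> v i))"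
        using * xc b lc by (auto simp: r_distr vectors_carrier m_lcomm)
      then show "(\<lambda>i. b \<otimes> w i) \<in> L'"
        using smult_vectors[OF *(2) b(1)] vector_submoduleD(4)[OF L b(1) *(1)] by (intro L'I)
    qed
    have LL': "L \<subseteq> L'"
    proof
      fix l assume l: "l \<in> L"
      then have "l = (\<lambda>i. l i \<oplus> x [^] e \<otimes> (\<lambda>_. \<zero>) i)"
        using xc lc by auto
      then show "l \<in> L'"
        using l zero_vectors by (rule L'I)
    qed
    have "L' \<inter> K \<subseteq> H"
    proof
      fix w assume w: "w \<in> L' \<inter> K"
      then obtain l v where *: "l \<in> L" "v \<in> vectors R {..<k}" "w = (\<lambda>i. l i \<oplus> x [^] e \<otimes> v i)"
        by (auto simp: L'_def)
      have xu: "x [^] u \<in> carrier R" "x [^] u \<in> J u"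
        using xc power_in_ideal_power[OF x I] by (auto simp: J_def)
      have "(\<lambda>i. x [^] u \<otimes> w i) \<in> L"
        using w xu(2) LK by (auto simp: H_def intro: ideal_smult.prod)
      then have "(\<lambda>i. x [^] u \<otimes> w i \<ominus> x [^] u \<otimes> l i) \<in> L"
        using vector_submodule_diff[OF L] vector_submoduleD(4)[OF L xu(1)] *(1) by blast
      moreover have "(\<lambda>i. x [^] u \<otimes> w i \<ominus> x [^] u \<otimes> l i) = (\<lambda>i. x [^] (e + u) \<otimes> v i)"
      proof
        fix i
        have c: "l i \<in> carrier R" "v i \<in> carrier R" "x [^] e \<in> carrier R"
          using * lc xc by (auto simp: vectors_carrier)
        have "x [^] u \<otimes> w i \<ominus> x [^] u \<otimes> l i = x [^] u \<otimes> (x [^] e \<otimes> v i)"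
          using c xu(1) unfolding *(3) by algebra
        also have "\<dots> = x [^] (e + u) \<otimes> v i"
          using c xu(1) xc by (simp add: nat_pow_mult[symmetric] m_ac)
        finally show "x [^] u \<otimes> w i \<ominus> x [^] u \<otimes> l i = x [^] (e + u) \<otimes> v i" .
      qed
      ultimately have "v \<in> M (e + u)"
        using *(2) by (simp add: M_def)
      then have "v \<in> M e"
        using stable[of "e + u"] by simp
      then have "w \<in> L"
        unfolding *(3) using *(1) vector_submoduleD(3)[OF L] by (auto simp: M_def)
      then show "w \<in> H"
        using w LK by blast
    qed
    then have "L' = L"
      using LL' LK by (intro max L') auto
    moreover have "(\<lambda>i. x [^] e \<otimes> v i) = (\<lambda>i. \<zero> \<oplus> x [^] e \<otimes> v i)"
      using xc that(2) by (auto simp: vectors_carrier)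
    then have "(\<lambda>i. x [^] e \<otimes> v i) \<in> L'"
      using vector_submoduleD(2)[OF L] that(2) by (rule L'I)
    ultimately show ?thesis by blast
  qed
  with I L obtain m where m: "\<And>a v. a \<in> J m \<Longrightarrow> v \<in> vectors R {..<k} \<Longrightarrow> (\<lambda>i. a \<otimes> v i) \<in> L"
    unfolding J_def using ideal_power_smult_subset by blast
  show ?thesis
  proof (rule that[of m])
    fix q v assume q: "m \<le> q" "v \<in> K" "\<And>i. v i \<in> I [^]\<^bsub>ideals_set R\<^esub> q"
    have vJ: "v i \<in> J m" for i
      using q ideal_power_antimono[OF I q(1)] by (auto simp: J_def)
    have v: "v \<in> vectors R {..<k}"
      using q(2) vector_submoduleD(1)[OF K] by blast
    define e where "e j = (\<lambda>c. if c = j then \<one> else \<zero>)" for j :: nat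
    have e: "e j \<in> vectors R {..<k}" if "j < k" for j
      using that unfolding e_def by (intro single_vectors) auto
    have "(\<lambda>i. \<Oplus>j\<in>{..<k}. \<one> \<otimes> (\<lambda>i. v j \<otimes> e j i) i) \<in> L"
      using m[OF vJ e] by (intro vector_submodule_finsum[OF L]) auto
    moreover have "(\<lambda>i. \<Oplus>j\<in>{..<k}. \<one> \<otimes> (\<lambda>i. v j \<otimes> e j i) i) = v"
    proof
      fix i
      have vc: "v j \<in> carrier R" for j
        using v by (rule vectors_carrier)
      have "(\<Oplus>j\<in>{..<k}. \<one> \<otimes> (\<lambda>i. v j \<otimes> e j i) i) = (\<Oplus>j\<in>{..<k}. if j = i then v i else \<zero>)"
        using vc by (intro finsum_cong') (auto simp: e_def)
      also have "\<dots> = v i"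
      proof (cases "i < k")
        case True
        then show ?thesis using vc by (simp add: finsum_delta)
      next
        case False
        then show ?thesis
          using vectors_outside[OF v, of i] by (intro trans[OF finsum_zeroI]) auto
      qed
      finally show "(\<Oplus>j\<in>{..<k}. \<one> \<otimes> (\<lambda>i. v j \<otimes> e j i) i) = v i" .
    qed
    ultimately show "v \<in> ideal_smult R (I [^]\<^bsub>ideals_set R\<^esub> u) K"
      using q(2) LK by (auto simp: H_def J_def)
  qed
qed

end


section \<open>Chains with coefficients in a submodule\<close>

text \<open>
  \<open>F \<otimes> G\<close> for the free module \<open>F\<close> on \<open>B\<close> and a submodule \<open>G\<close> of some \<open>R\<^sup>k\<close>.  The support is required to be
  finite in each component only; as all components from \<open>k\<close> on are \<open>0\<close>, it is finite altogether
  (\<open>module_chain_support\<close>).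
\<close>

definition module_chains :: "('a, 'r) ring_scheme \<Rightarrow> 'b set \<Rightarrow> (nat \<Rightarrow> 'a) set \<Rightarrow> ('b \<Rightarrow> nat \<Rightarrow> 'a) set" where
  "module_chains R B G = {z. (\<forall>b. z b \<in> G) \<and> (\<forall>i. (\<lambda>b. z b i) \<in> vectors R B)}"

definition chain_boundary ::
    "('a, 'r) ring_scheme \<Rightarrow> ('b \<Rightarrow> 'c \<Rightarrow> 'a) \<Rightarrow> ('b \<Rightarrow> nat \<Rightarrow> 'a) \<Rightarrow> 'c \<Rightarrow> nat \<Rightarrow> 'a" where
  "chain_boundary R D z = (\<lambda>c i. linear_extension R D (\<lambda>b. z b i) c)"

lemma module_chainsI:
  "(\<And>b. z b \<in> G) \<Longrightarrow> (\<And>i. (\<lambda>b. z b i) \<in> vectors R B) \<Longrightarrow> z \<in> module_chains R B G"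
  by (simp add: module_chains_def)

lemma module_chainsD:
  assumes "z \<in> module_chains R B G"
  shows "z b \<in> G" "(\<lambda>b. z b i) \<in> vectors R B"
  using assms by (auto simp: module_chains_def)

lemma module_chains_mono:
  "z \<in> module_chains R B G \<Longrightarrow> B \<subseteq> B' \<Longrightarrow> G \<subseteq> G' \<Longrightarrow> z \<in> module_chains R B' G'"
  unfolding module_chains_def using vectors_mono by blast

context cring
begin

lemma module_chain_support:
  assumes z: "z \<in> module_chains R B G" and G: "G \<subseteq> vectors R {..<k}"
  obtains S where "finite S" "S \<subseteq> B" "\<And>i. supp R (\<lambda>b. z b i) \<subseteq> S"
proof (rule that)
  have *: "(\<lambda>b. z b i) \<in> vectors R B" for i
    using z by (rule module_chainsD)
  show "finite (\<Union>i<k. supp R (\<lambda>b. z b i))" "(\<Union>i<k. supp R (\<lambda>b. z b i)) \<subseteq> B"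
    using * unfolding vectors_iff by blast+
  fix i
  show "supp R (\<lambda>b. z b i) \<subseteq> (\<Union>i<k. supp R (\<lambda>b. z b i))"
  proof (cases "i < k")
    case False
    have "z b i = \<zero>" for b
      using subsetD[OF G module_chainsD(1)[OF z]] False by (intro vectors_outside) auto
    then show ?thesis
      by (simp add: supp_def)
  qed blast
qed

context
  fixes D :: "'d \<Rightarrow> 'c \<Rightarrow> 'a" and B :: "'d set" and C :: "'c set"
  assumes D: "\<And>b. b \<in> B \<Longrightarrow> D b \<in> vectors R C"
begin

lemma chain_boundary_closed:
  assumes z: "z \<in> module_chains R B G" and G: "vector_submodule R {..<k} G"
  shows "chain_boundary R D z \<in> module_chains R C G"
proof (rule module_chainsI)
  obtain S where S: "finite S" "S \<subseteq> B" "\<And>i. supp R (\<lambda>b. z b i) \<subseteq> S"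
    using module_chain_support[OF z vector_submoduleD(1)[OF G]] by blast
  have zc: "z b i \<in> carrier R" for b i
    using vector_submoduleD(5)[OF G module_chainsD(1)[OF z]] .
  have Dc: "D b c \<in> carrier R" if "b \<in> S" for b c
    using D S(2) that by (meson subsetD vectors_carrier)
  fix c
  have "(\<lambda>i. \<Oplus>b\<in>S. D b c \<otimes> z b i) \<in> G"
    using S(1) Dc module_chainsD(1)[OF z] by (intro vector_submodule_finsum[OF G]) auto
  moreover have "chain_boundary R D z c = (\<lambda>i. \<Oplus>b\<in>S. D b c \<otimes> z b i)"
  proof
    fix i
    have "chain_boundary R D z c i = (\<Oplus>b\<in>S. z b i \<otimes> D b c)"
      unfolding chain_boundary_def using S Dc zc by (intro linear_extension_superset) auto
    also have "\<dots> = (\<Oplus>b\<in>S. D b c \<otimes> z b i)"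
      using Dc zc by (intro finsum_cong') (auto simp: m_comm)
    finally show "chain_boundary R D z c i = (\<Oplus>b\<in>S. D b c \<otimes> z b i)" .
  qed
  ultimately show "chain_boundary R D z c \<in> G"
    by simp
  show "(\<lambda>c. chain_boundary R D z c i) \<in> vectors R C" for i
    unfolding chain_boundary_def using D module_chainsD(2)[OF z] by (rule linear_extension_closed)
qed

text \<open>
  The boundary commutes with the change of coefficients along the linear map \<open>R\<^sup>N \<rightarrow> R\<^sup>k\<close> given by \<open>g\<close>.
\<close>

lemma chain_boundary_linear_extension:
  assumes z: "z \<in> module_chains R B (vectors R {..<N})"
    and g: "\<And>j. j < N \<Longrightarrow> g j \<in> vectors R {..<k::nat}"
  shows "chain_boundary R D (\<lambda>b. linear_extension R g (z b)) c i =
    linear_extension R g (chain_boundary R D z c) i"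
proof -
  obtain S where S: "finite S" "S \<subseteq> B" "\<And>i. supp R (\<lambda>b. z b i) \<subseteq> S"
    using module_chain_support[OF z subset_refl] by blast
  have zV: "z b \<in> vectors R {..<N}" for b
    using z by (rule module_chainsD)
  have zc: "z b i \<in> carrier R" for b i
    using zV by (rule vectors_carrier)
  have gc: "g j i \<in> carrier R" if "j < N" for i j
    using g[OF that] by (rule vectors_carrier)
  have Dc: "D b c \<in> carrier R" if "b \<in> S" for b c
    using D S(2) that by (meson subsetD vectors_carrier)
  have gz: "linear_extension R g (z b) i = (\<Oplus>j\<in>{..<N}. z b j \<otimes> g j i)" for b i
    using zV[of b] zc gc by (intro linear_extension_superset) (auto simp: vectors_iff)
  have gzc: "linear_extension R g (z b) i \<in> carrier R" for b i
    unfolding gz using zc gc by (intro finsum_closed) auto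
  have bz: "chain_boundary R D z c j = (\<Oplus>b\<in>S. z b j \<otimes> D b c)" for j
    unfolding chain_boundary_def using S Dc zc by (intro linear_extension_superset) auto
  have bV: "chain_boundary R D z c \<in> vectors R {..<N}"
    using chain_boundary_closed[OF z vector_submodule_vectors] by (rule module_chainsD)
  have "chain_boundary R D (\<lambda>b. linear_extension R g (z b)) c i
      = (\<Oplus>b\<in>S. (\<Oplus>j\<in>{..<N}. z b j \<otimes> g j i) \<otimes> D b c)"
    unfolding chain_boundary_def gz[symmetric]
  proof (rule linear_extension_superset)
    show "supp R (\<lambda>b. linear_extension R g (z b) i) \<subseteq> S"
    proof
      fix b assume b: "b \<in> supp R (\<lambda>b. linear_extension R g (z b) i)"
      show "b \<in> S"
      proof (rule ccontr)
        assume "b \<notin> S"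
        then have "z b j = \<zero>" for j
          using S(3)[of j] by (auto simp: supp_def)
        then have "linear_extension R g (z b) i = \<zero>"
          unfolding gz using gc by (intro finsum_zeroI) auto
        then show False
          using b by (simp add: supp_def)
      qed
    qed
  qed (use S gzc Dc in auto)
  also have "\<dots> = (\<Oplus>b\<in>S. \<Oplus>j\<in>{..<N}. z b j \<otimes> g j i \<otimes> D b c)"
    using zc gc Dc by (intro finsum_cong') (auto simp: finsum_ldistr)
  also have "\<dots> = (\<Oplus>j\<in>{..<N}. \<Oplus>b\<in>S. z b j \<otimes> g j i \<otimes> D b c)"
    using S zc gc Dc by (intro finsum_swap) auto
  also have "\<dots> = (\<Oplus>j\<in>{..<N}. (\<Oplus>b\<in>S. z b j \<otimes> D b c) \<otimes> g j i)"
  proof (intro finsum_cong' refl)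
    fix j assume j: "j \<in> {..<N}"
    have "(\<Oplus>b\<in>S. z b j \<otimes> g j i \<otimes> D b c) = (\<Oplus>b\<in>S. z b j \<otimes> D b c \<otimes> g j i)"
      using j zc gc Dc by (intro finsum_cong') (auto simp: m_ac)
    also have "\<dots> = (\<Oplus>b\<in>S. z b j \<otimes> D b c) \<otimes> g j i"
      using j S zc gc Dc by (intro finsum_ldistr[symmetric]) auto
    finally show "(\<Oplus>b\<in>S. z b j \<otimes> g j i \<otimes> D b c) = (\<Oplus>b\<in>S. z b j \<otimes> D b c) \<otimes> g j i" .
  qed (use zc gc Dc in auto)
  also have "\<dots> = linear_extension R g (chain_boundary R D z c) i"
    unfolding bz[symmetric] using bV gc
    by (intro linear_extension_superset[symmetric]) (auto simp: vectors_iff)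
  finally show ?thesis .
qed

end

lemma ideal_smult_image_lift:
  assumes J: "ideal J R" and g: "\<And>j. j \<in> C \<Longrightarrow> g j \<in> vectors R B"
    and "w \<in> ideal_smult R J (linear_extension R g ` vectors R C)"
  shows "\<exists>v\<in>vectors R C. (\<forall>i. v i \<in> J) \<and> w = linear_extension R g v"
proof -
  interpret J: ideal J R by fact
  show ?thesis
    using assms(3)
  proof induction
    case (prod a w)
    then obtain v where v: "v \<in> vectors R C" "w = linear_extension R g v" by blast
    have a: "a \<in> carrier R"
      using prod(1) by (rule J.Icarr)
    have "(\<lambda>i. a \<otimes> w i) = linear_extension R g (\<lambda>j. a \<otimes> v j)"
      unfolding v(2) using linear_extension_smult[OF g v(1) a] by (intro ext) simp
    then show ?case
      using smult_vectors[OF v(1) a] vectors_carrier[OF v(1)] J.I_r_closed[OF prod(1)]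
      by (intro bexI[of _ "\<lambda>j. a \<otimes> v j"]) auto
  next
    case (sum w w')
    then obtain v v' where v: "v \<in> vectors R C" "v' \<in> vectors R C"
      "w = linear_extension R g v" "w' = linear_extension R g v'" "\<forall>i. v i \<in> J" "\<forall>i. v' i \<in> J" by blast
    have "(\<lambda>i. w i \<oplus> w' i) = linear_extension R g (\<lambda>j. v j \<oplus> v' j)"
      unfolding v(3,4) using linear_extension_add[OF g v(1,2)] by (intro ext) simp
    then show ?case
      using add_vectors[OF v(1,2)] v(5,6) by (intro bexI[of _ "\<lambda>j. v j \<oplus> v' j"]) auto
  qed
qed

end

section \<open>Pro acyclicity for coefficients in a module\<close>

text \<open>
  What is needed of the standard resolutions over the rings \<open>\<int> \<ltimes> I\<^sup>r\<close>: their bases \<open>B r n\<close> and the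
  matrix \<open>D\<close> of their boundaries, read in \<open>R\<close>.  A chain with coefficients in \<open>I\<^sup>r\<close> is also one over
  \<open>\<int> \<ltimes> I\<^sup>r\<close>, and exactness is required for such chains only.  As all elements of \<open>I\<^sup>r\<close> act
  as zero on \<open>\<int>\<close>, the augmentation imposes no condition on them in degree \<open>0\<close>; with \<open>D = 0\<close> there,
  all degrees can be treated alike.
\<close>

locale tower_resolution = noetherian_cring R for R (structure) +
  fixes I :: "'a set" and B :: "nat \<Rightarrow> nat \<Rightarrow> 'g set" and D :: "'g \<Rightarrow> 'g \<Rightarrow> 'a"
  assumes ideal_I: "ideal I R"
    and basis_antimono: "\<And>r s n. r \<le> s \<Longrightarrow> B s n \<subseteq> B r n"
    and D_0: "\<And>r b. b \<in> B r 0 \<Longrightarrow> D b = (\<lambda>_. \<zero>)"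
    and D_Suc: "\<And>r n b. b \<in> B r (Suc n) \<Longrightarrow> D b \<in> vectors R (B r n)"
    and D_D: "\<And>r n b. b \<in> B r (Suc n) \<Longrightarrow> linear_extension R D (D b) = (\<lambda>_. \<zero>)"
    and exact: "\<And>r n c. c \<in> vectors R (B r n) \<Longrightarrow> (\<And>b. c b \<in> I [^]\<^bsub>ideals_set R\<^esub> r) \<Longrightarrow>
      linear_extension R D c = (\<lambda>_. \<zero>) \<Longrightarrow> \<exists>b\<in>B r (Suc n). D b = c"
begin

abbreviation J :: "nat \<Rightarrow> 'a set" where
  "J r \<equiv> I [^]\<^bsub>ideals_set R\<^esub> r"

lemma D_closed: "b \<in> B r n \<Longrightarrow> D b \<in> vectors R (B r (n - 1))"
  using D_0 D_Suc zero_vectors by (cases n) auto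

lemma ideal_J: "ideal (J r) R"
  by (rule ideal_ideal_power[OF ideal_I])

text \<open>
  The part of the induction step that is the same in all degrees.  The assumption \<open>fill\<close> is applied to
  the lift \<open>t\<close> of a cycle and to the vectors \<open>K\<close> with entries in \<open>I\<^sup>r\<close> that are relations between the
  generators \<open>g\<close> of \<open>G\<close>; it says that the boundary of \<open>t\<close>, whose values are such relations, also
  bounds a chain of such relations.
\<close>

lemma cycles_are_boundaries_step:
  fixes k n r :: nat
  assumes G: "vector_submodule R {..<k} G"
    and fill: "\<And>(N::nat) K. vector_submodule R {..<N} K \<Longrightarrow>
      \<exists>q\<ge>r. \<forall>z\<in>module_chains R (B q n) {v \<in> vectors R {..<N}. \<forall>i. v i \<in> J q}.
        (\<forall>c. chain_boundary R D z c \<in> K) \<longrightarrow>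
        (\<exists>w\<in>module_chains R (B r n) K. chain_boundary R D w = chain_boundary R D z)"
  shows "\<exists>q\<ge>r. \<forall>z\<in>module_chains R (B q n) (ideal_smult R (J q) G).
    chain_boundary R D z = (\<lambda>_ _. \<zero>) \<longrightarrow>
    (\<exists>y\<in>module_chains R (B r (Suc n)) G. chain_boundary R D y = z)"
proof -
  obtain N :: nat and g where gG: "\<And>j. j < N \<Longrightarrow> g j \<in> G"
    and G_eq: "G = linear_extension R g ` vectors R {..<N}"
    using vector_submodule_generators[OF G] by metis
  have g: "g j \<in> vectors R {..<k}" if "j < N" for j
    using gG[OF that] vector_submoduleD(1)[OF G] by blast
  have gc: "g j i \<in> carrier R" if "j < N" for j i
    using g[OF that] by (rule vectors_carrier)
  define V where "V s = {v \<in> vectors R {..<N}. \<forall>i. v i \<in> J s}" for s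
  have V: "vector_submodule R {..<N} (V s)" for s
    unfolding V_def by (rule vector_submodule_ideal_valued[OF ideal_J])
  have V_mono: "V s \<subseteq> V r" if "r \<le> s" for s
    using ideal_power_antimono[OF ideal_I that] unfolding V_def by blast
  define K where "K = V r \<inter> {v \<in> vectors R {..<N}. linear_extension R g v = (\<lambda>_. \<zero>)}"
  have K: "vector_submodule R {..<N} K"
    unfolding K_def using g by (intro vector_submodule_Int V vector_submodule_kernel) auto
  obtain q where q: "r \<le> q" and fill_q: "\<And>z. z \<in> module_chains R (B q n) (V q) \<Longrightarrow>
      (\<And>c. chain_boundary R D z c \<in> K) \<Longrightarrow>
      \<exists>w\<in>module_chains R (B r n) K. chain_boundary R D w = chain_boundary R D z"
    using fill[OF K] unfolding V_def by blast
  have "\<exists>y\<in>module_chains R (B r (Suc n)) G. chain_boundary R D y = z"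
    if z: "z \<in> module_chains R (B q n) (ideal_smult R (J q) G)"
      and cycle: "chain_boundary R D z = (\<lambda>_ _. \<zero>)" for z
  proof -
    have JG: "ideal_smult R (J q) G \<subseteq> vectors R {..<k}"
      using vector_submoduleD(1)[OF vector_submodule_ideal_smult(1)[OF G ideal_J]] .
    obtain S where S: "finite S" "S \<subseteq> B q n" "\<And>i. supp R (\<lambda>b. z b i) \<subseteq> S"
      using module_chain_support[OF z JG] by blast
    have "\<exists>v. v \<in> V q \<and> z b = linear_extension R g v" for b
    proof -
      have "z b \<in> ideal_smult R (J q) (linear_extension R g ` vectors R {..<N})"
        using module_chainsD(1)[OF z] G_eq by simp
      then show ?thesis
        using ideal_smult_image_lift[OF ideal_J, of "{..<N}" g "{..<k}"] g unfolding V_def by blast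
    qed
    then obtain lift where lift: "\<And>b. lift b \<in> V q" "\<And>b. z b = linear_extension R g (lift b)"
      by metis
    \<comment> \<open>A lift of \<open>0\<close> need not be \<open>0\<close>, so the lift must be cut off to have finite support.\<close>
    define t where "t b = (if b \<in> S then lift b else (\<lambda>_. \<zero>))" for b
    have tV: "t b \<in> V q" for b
      using lift(1) vector_submoduleD(2)[OF V] by (simp add: t_def)
    have t: "t \<in> module_chains R (B q n) (V q)"
    proof (rule module_chainsI[OF tV])
      show "(\<lambda>b. t b i) \<in> vectors R (B q n)" for i
        using S vector_submoduleD(5)[OF V tV] by (intro vectors_finiteI[of S]) (auto simp: t_def)
    qed
    have zt: "z = (\<lambda>b. linear_extension R g (t b))"
    proof
      fix b show "z b = linear_extension R g (t b)"
      proof (cases "b \<in> S")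
        case False
        then have "z b = (\<lambda>_. \<zero>)"
          using S(3) by (fastforce simp: supp_def)
        with False show ?thesis
          by (simp add: t_def linear_extension_def supp_def)
      qed (simp add: t_def lift)
    qed
    have t': "t \<in> module_chains R (B q n) (vectors R {..<N})"
      using module_chains_mono[OF t subset_refl] by (simp add: V_def)
    have bt: "chain_boundary R D t \<in> module_chains R (B q (n - 1)) (V q)"
      using D_closed t V by (rule chain_boundary_closed)
    have "chain_boundary R D t c \<in> K" for c
    proof -
      have "chain_boundary R D t c \<in> V q"
        using bt by (rule module_chainsD)
      moreover have "linear_extension R g (chain_boundary R D t c) i = \<zero>" for i
        using chain_boundary_linear_extension[where D = D and g = g and c = c and i = i, OF D_closed t' g] cycle
        by (simp flip: zt)
      ultimately show ?thesis
        using V_mono[OF q] by (auto simp: K_def V_def)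
    qed
    with t obtain w where w: "w \<in> module_chains R (B r n) K"
      and bw: "chain_boundary R D w = chain_boundary R D t"
      using fill_q by blast
    define c where "c j = (\<lambda>b. t b j \<ominus> w b j)" for j
    have tr: "t \<in> module_chains R (B r n) (V r)"
      using module_chains_mono[OF t basis_antimono[OF q] V_mono[OF q]] .
    have wr: "w \<in> module_chains R (B r n) (V r)"
      using module_chains_mono[OF w subset_refl] by (simp add: K_def)
    have c: "c j \<in> vectors R (B r n)" for j
      unfolding c_def using module_chainsD(2)[OF tr] module_chainsD(2)[OF wr] by (rule diff_vectors)
    have "\<exists>b\<in>B r (Suc n). D b = c j" for j
    proof (rule exact[OF c])
      fix b
      have "t b j \<in> J r" "w b j \<in> J r"
        using module_chainsD(1)[OF tr, of b] module_chainsD(1)[OF wr, of b] by (auto simp: V_def)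
      then show "c j b \<in> J r"
        using additive_subgroup.a_closed additive_subgroup.a_inv_closed ideal.axioms(1)[OF ideal_J]
        unfolding c_def minus_eq by metis
    next
      show "linear_extension R D (c j) = (\<lambda>_. \<zero>)"
      proof
        fix b
        have b: "linear_extension R D (\<lambda>b. w b j) b = linear_extension R D (\<lambda>b. t b j) b"
          using fun_cong[OF fun_cong[OF bw], of b j] by (simp add: chain_boundary_def)
        have "linear_extension R D (\<lambda>b. t b j) b \<in> carrier R"
          using linear_extension_closed[OF D_closed module_chainsD(2)[OF tr]] by (rule vectors_carrier)
        then show "linear_extension R D (c j) b = \<zero>"
          unfolding c_def
          using linear_extension_diff[OF D_closed module_chainsD(2)[OF tr] module_chainsD(2)[OF wr]] b
          by (simp add: minus_eq r_neg)
      qed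
    qed
    \<comment> \<open>Different components may be boundaries of the same basis element, so coefficients must be added.\<close>
    then obtain e where e: "\<And>j. e j \<in> B r (Suc n)" "\<And>j. D (e j) = c j"
      by metis
    define y where "y b i = (\<Oplus>j\<in>{..<N}. (if b = e j then \<one> else \<zero>) \<otimes> g j i)" for b i
    have yG: "y b \<in> G" for b
      unfolding y_def using gG by (intro vector_submodule_finsum[OF G]) auto
    have yc: "y b i \<in> carrier R" for b i
      by (rule vector_submoduleD(5)[OF G yG])
    have y0: "y b i = \<zero>" if "b \<notin> e ` {..<N}" for b i
      unfolding y_def using that gc by (intro finsum_zeroI) auto
    have y: "y \<in> module_chains R (B r (Suc n)) G"
    proof (rule module_chainsI[OF yG])
      show "(\<lambda>b. y b i) \<in> vectors R (B r (Suc n))" for i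
        using yc y0 e(1) by (intro vectors_finiteI[of "e ` {..<N}"]) auto
    qed
    moreover have "chain_boundary R D y = z"
    proof (intro ext)
      fix b i
      let ?S = "e ` {..<N}"
      have Dc: "D s b \<in> carrier R" if "s \<in> ?S" for s
        using that e(2) vectors_carrier[OF c] by auto
      have cw: "c j b \<in> carrier R" for j
        by (rule vectors_carrier[OF c])
      have tc: "t b \<in> vectors R {..<N}" and wc: "w b \<in> vectors R {..<N}"
        using module_chainsD(1)[OF t', of b] module_chainsD(1)[OF w, of b] by (auto simp: K_def)
      have "chain_boundary R D y b i = (\<Oplus>s\<in>?S. y s i \<otimes> D s b)"
        unfolding chain_boundary_def using y0 yc Dc
        by (intro linear_extension_superset) (auto simp: supp_def)
      also have "\<dots> = (\<Oplus>s\<in>?S. \<Oplus>j\<in>{..<N}. (if s = e j then \<one> else \<zero>) \<otimes> g j i \<otimes> D s b)"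
        using gc Dc unfolding y_def by (intro finsum_cong') (auto simp: finsum_ldistr)
      also have "\<dots> = (\<Oplus>j\<in>{..<N}. \<Oplus>s\<in>?S. (if s = e j then \<one> else \<zero>) \<otimes> g j i \<otimes> D s b)"
        using gc Dc by (intro finsum_swap) auto
      also have "\<dots> = (\<Oplus>j\<in>{..<N}. c j b \<otimes> g j i)"
      proof (intro finsum_cong' refl)
        fix j assume j: "j \<in> {..<N}"
        have "(\<Oplus>s\<in>?S. (if s = e j then \<one> else \<zero>) \<otimes> g j i \<otimes> D s b)
            = (\<Oplus>s\<in>?S. if s = e j then c j b \<otimes> g j i else \<zero>)"
          using j gc Dc cw e(2) by (intro finsum_cong') (auto simp: m_comm)
        also have "\<dots> = c j b \<otimes> g j i"
          using j gc cw by (intro finsum_delta) auto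
        finally show "(\<Oplus>s\<in>?S. (if s = e j then \<one> else \<zero>) \<otimes> g j i \<otimes> D s b) = c j b \<otimes> g j i" .
      qed (use gc cw in auto)
      also have "\<dots> = linear_extension R g (\<lambda>j. t b j \<ominus> w b j) i"
        unfolding c_def using gc diff_vectors[OF tc wc]
        by (intro linear_extension_superset[symmetric]) (auto simp: vectors_iff)
      also have "\<dots> = linear_extension R g (t b) i \<ominus> linear_extension R g (w b) i"
        using g tc wc by (intro linear_extension_diff[of "{..<N}" g "{..<k}"]) auto
      also have "\<dots> = z b i"
        using module_chainsD(1)[OF w, of b] subsetD[OF JG module_chainsD(1)[OF z, of b]]
          vectors_carrier fun_cong[OF zt, of b] by (fastforce simp: K_def minus_eq)
      finally show "chain_boundary R D y b i = z b i" .
    qed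
    ultimately show ?thesis by blast
  qed
  with q show ?thesis by blast
qed

text \<open>
  Applied to \<open>I\<^sup>r G\<close> in place of \<open>G\<close>, this is the vanishing of the pro group \<open>{Tor\<^sub>n(\<int>, I\<^sup>r G)}\<^sub>r\<close>.
  In degree \<open>0\<close> the lifted chain has boundary \<open>0\<close>.  In degree \<open>n + 1\<close> the induction hypothesis for
  the module of relations \<open>K\<close> yields \<open>u\<close>, and the Artin-Rees property yields \<open>q\<close>.
\<close>

lemma cycles_are_boundaries:
  fixes k r :: nat
  assumes "vector_submodule R {..<k} G"
  shows "\<exists>q\<ge>r. \<forall>z\<in>module_chains R (B q n) (ideal_smult R (J q) G).
    chain_boundary R D z = (\<lambda>_ _. \<zero>) \<longrightarrow>
    (\<exists>y\<in>module_chains R (B r (Suc n)) G. chain_boundary R D y = z)"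
  using assms
proof (induction n arbitrary: k r G)
  case 0
  show ?case
  proof (rule cycles_are_boundaries_step[OF 0])
    fix N :: nat and K assume K: "vector_submodule R {..<N} K"
    have "\<exists>w\<in>module_chains R (B r 0) K. chain_boundary R D w = chain_boundary R D z"
      if z: "z \<in> module_chains R (B r 0) {v \<in> vectors R {..<N}. \<forall>i. v i \<in> J r}" for z
    proof (intro bexI[of _ "\<lambda>_ _. \<zero>"])
      show "(\<lambda>_ _. \<zero>) \<in> module_chains R (B r 0) K"
        using vector_submoduleD(2)[OF K] zero_vectors by (intro module_chainsI)
      have "linear_extension R D f c = \<zero>" if "f \<in> vectors R (B r 0)" for f c
        using that D_0 by (intro linear_extension_eq_zeroI[OF D_closed]) auto
      then show "chain_boundary R D (\<lambda>_ _. \<zero>) = chain_boundary R D z"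
        using module_chainsD(2)[OF z] zero_vectors[of "B r 0"] by (simp add: chain_boundary_def)
    qed
    then show "\<exists>q\<ge>r. \<forall>z\<in>module_chains R (B q 0) {v \<in> vectors R {..<N}. \<forall>i. v i \<in> J q}.
        (\<forall>c. chain_boundary R D z c \<in> K) \<longrightarrow>
        (\<exists>w\<in>module_chains R (B r 0) K. chain_boundary R D w = chain_boundary R D z)"
      by blast
  qed
next
  case (Suc n)
  show ?case
  proof (rule cycles_are_boundaries_step[OF Suc.prems])
    fix N :: nat and K assume K: "vector_submodule R {..<N} K"
    obtain u where u: "u \<ge> r" and IH: "\<And>z. z \<in> module_chains R (B u n) (ideal_smult R (J u) K) \<Longrightarrow>
        chain_boundary R D z = (\<lambda>_ _. \<zero>) \<Longrightarrow>
        \<exists>w\<in>module_chains R (B r (Suc n)) K. chain_boundary R D w = z"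
      using Suc.IH[OF K] by blast
    obtain m :: nat where m: "\<And>q v. m \<le> q \<Longrightarrow> v \<in> K \<Longrightarrow> (\<And>i. v i \<in> J q) \<Longrightarrow> v \<in> ideal_smult R (J u) K"
      using weak_Artin_Rees[OF ideal_I K] by metis
    define q where "q = max u m"
    have "\<exists>w\<in>module_chains R (B r (Suc n)) K. chain_boundary R D w = chain_boundary R D z"
      if z: "z \<in> module_chains R (B q (Suc n)) {v \<in> vectors R {..<N}. \<forall>i. v i \<in> J q}"
        and zK: "\<And>c. chain_boundary R D z c \<in> K" for z
    proof (rule IH)
      have bz: "chain_boundary R D z \<in> module_chains R (B q n) {v \<in> vectors R {..<N}. \<forall>i. v i \<in> J q}"
        using D_Suc z vector_submodule_ideal_valued[OF ideal_J] by (rule chain_boundary_closed)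
      show "chain_boundary R D z \<in> module_chains R (B u n) (ideal_smult R (J u) K)"
      proof (rule module_chainsI)
        show "chain_boundary R D z c \<in> ideal_smult R (J u) K" for c
          using zK module_chainsD(1)[OF bz, of c] by (intro m[of q]) (auto simp: q_def)
        show "(\<lambda>c. chain_boundary R D z c i) \<in> vectors R (B u n)" for i
          using vectors_mono[OF basis_antimono[of u q n] module_chainsD(2)[OF bz]] by (simp add: q_def)
      qed
      show "chain_boundary R D (chain_boundary R D z) = (\<lambda>_ _. \<zero>)"
      proof (intro ext)
        fix c i
        have "linear_extension R D (linear_extension R D (\<lambda>b. z b i)) = (\<lambda>_. \<zero>)"
          using D_Suc D_D D_closed module_chainsD(2)[OF z]
          by (rule linear_extension_linear_extension_eq_zero)
        then show "chain_boundary R D (chain_boundary R D z) c i = \<zero>"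
          by (simp add: chain_boundary_def fun_eq_iff)
      qed
    qed
    moreover have "r \<le> q"
      using u by (simp add: q_def)
    ultimately show "\<exists>q\<ge>r. \<forall>z\<in>module_chains R (B q (Suc n)) {v \<in> vectors R {..<N}. \<forall>i. v i \<in> J q}.
        (\<forall>c. chain_boundary R D z c \<in> K) \<longrightarrow>
        (\<exists>w\<in>module_chains R (B r (Suc n)) K. chain_boundary R D w = chain_boundary R D z)"
      by blast
  qed
qed

end


section \<open>The unitization of an ideal\<close>

text \<open>
  The ring homomorphism \<open>\<int> \<ltimes> J \<rightarrow> R\<close> that extends the inclusion of \<open>J\<close>.  Together with the first
  projection it embeds \<open>\<int> \<ltimes> J\<close> into \<open>\<int> \<times> R\<close>, so that identities can be checked there.
\<close>

definition to_ring :: "('a, 'b) ring_scheme \<Rightarrow> int \<times> 'a \<Rightarrow> 'a" where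
  "to_ring R p = add_pow R (fst p) \<one>\<^bsub>R\<^esub> \<oplus>\<^bsub>R\<^esub> snd p"

locale unitization = cring R + ideal J R for R (structure) and J
begin

abbreviation A :: "(int \<times> 'a) ring" where
  "A \<equiv> int_unitization (R\<lparr>carrier := J\<rparr>)"

lemma carrier_A: "p \<in> carrier A \<longleftrightarrow> snd p \<in> J"
  by (cases p) (simp add: int_unitization_def)

lemma A_simps [simp]:
  "\<zero>\<^bsub>A\<^esub> = (0, \<zero>)" "\<one>\<^bsub>A\<^esub> = (1, \<zero>)" "p \<oplus>\<^bsub>A\<^esub> q = (fst p + fst q, snd p \<oplus> snd q)"
  by (cases p; cases q; simp add: int_unitization_def)+

lemma add_pow_J:
  assumes "x \<in> J"
  shows "add_pow (R\<lparr>carrier := J\<rparr>) (k :: int) x = add_pow R k x" "add_pow R k x \<in> J"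
proof -
  show "add_pow (R\<lparr>carrier := J\<rparr>) k x = add_pow R k x"
    using add.int_pow_consistent[OF a_subgroup assms, of k]
    by (simp add: add_pow_def[of "R\<lparr>carrier := J\<rparr>"])
  show "add_pow R k x \<in> J"
    using add.subgroup_int_pow_closed[OF a_subgroup assms] by simp
qed

lemma A_mult:
  assumes "p \<in> carrier A" "q \<in> carrier A"
  shows "p \<otimes>\<^bsub>A\<^esub> q = (fst p * fst q,
    add_pow R (fst p) \<one> \<otimes> snd q \<oplus> add_pow R (fst q) \<one> \<otimes> snd p \<oplus> snd p \<otimes> snd q)"
  using assms Icarr
  by (cases p; cases q) (simp add: int_unitization_def add_pow_J(1) add_pow_ldistr_int)

lemma fst_A_add: "fst (p \<oplus>\<^bsub>A\<^esub> q) = fst p + fst q"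
  by simp

lemma fst_A_mult: "fst (p \<otimes>\<^bsub>A\<^esub> q) = fst p * fst q"
  by (cases p; cases q) (simp add: int_unitization_def)

lemma to_ring_closed: "p \<in> carrier A \<Longrightarrow> to_ring R p \<in> carrier R"
  using Icarr by (simp add: to_ring_def carrier_A)

lemma to_ring_add:
  assumes "p \<in> carrier A" "q \<in> carrier A"
  shows "to_ring R (p \<oplus>\<^bsub>A\<^esub> q) = to_ring R p \<oplus> to_ring R q"
  using assms Icarr by (simp add: to_ring_def carrier_A add.int_pow_mult a_ac)

lemma to_ring_mult:
  assumes "p \<in> carrier A" "q \<in> carrier A"
  shows "to_ring R (p \<otimes>\<^bsub>A\<^esub> q) = to_ring R p \<otimes> to_ring R q"
proof -
  have c: "snd p \<in> carrier R" "snd q \<in> carrier R"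
    using assms Icarr by (auto simp: carrier_A)
  have 1: "add_pow R (fst p * fst q) \<one> = add_pow R (fst p) \<one> \<otimes> add_pow R (fst q) \<one>"
    by (simp add: add_pow_ldistr_int add.int_pow_pow mult.commute)
  define a b where "a = add_pow R (fst p) \<one>" and "b = add_pow R (fst q) \<one>"
  have "a \<in> carrier R" "b \<in> carrier R"
    by (simp_all add: a_def b_def)
  then show ?thesis
    using c unfolding A_mult[OF assms] to_ring_def fst_conv snd_conv 1 a_def[symmetric] b_def[symmetric]
    by algebra
qed

lemma A_eqI:
  assumes "p \<in> carrier A" "q \<in> carrier A" "fst p = fst q" "to_ring R p = to_ring R q"
  shows "p = q"
  using assms Icarr by (intro prod_eqI) (auto simp: to_ring_def carrier_A)

lemma A_closed:
  assumes "p \<in> carrier A" "q \<in> carrier A"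
  shows "p \<oplus>\<^bsub>A\<^esub> q \<in> carrier A" "p \<otimes>\<^bsub>A\<^esub> q \<in> carrier A"
  using assms by (auto simp: carrier_A A_mult I_l_closed)

lemma cring_A: "cring A"
proof (rule cringI)
  have c: "\<zero>\<^bsub>A\<^esub> \<in> carrier A" "\<one>\<^bsub>A\<^esub> \<in> carrier A"
    by (auto simp: carrier_A)
  show "abelian_group A"
  proof (rule abelian_groupI)
    show "\<exists>q\<in>carrier A. q \<oplus>\<^bsub>A\<^esub> p = \<zero>\<^bsub>A\<^esub>" if "p \<in> carrier A" for p
      using that Icarr by (intro bexI[of _ "(- fst p, \<ominus> snd p)"]) (auto simp: carrier_A l_neg)
  qed (use c A_closed Icarr in \<open>auto simp: carrier_A a_ac\<close>)
  have one: "to_ring R \<one>\<^bsub>A\<^esub> = \<one>"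
    by (simp add: to_ring_def)
  show "Group.comm_monoid A"
  proof (rule comm_monoidI)
    fix p q s assume *: "p \<in> carrier A" "q \<in> carrier A" "s \<in> carrier A"
    show "p \<otimes>\<^bsub>A\<^esub> q \<otimes>\<^bsub>A\<^esub> s = p \<otimes>\<^bsub>A\<^esub> (q \<otimes>\<^bsub>A\<^esub> s)"
      using * by (intro A_eqI) (simp_all add: A_closed to_ring_mult to_ring_closed m_assoc fst_A_mult)
  next
    fix p q assume *: "p \<in> carrier A" "q \<in> carrier A"
    show "p \<otimes>\<^bsub>A\<^esub> q = q \<otimes>\<^bsub>A\<^esub> p"
      using * by (intro A_eqI) (simp_all add: A_closed to_ring_mult to_ring_closed m_comm fst_A_mult)
  next
    fix p assume *: "p \<in> carrier A"
    show "\<one>\<^bsub>A\<^esub> \<otimes>\<^bsub>A\<^esub> p = p"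
      using * c one
      by (intro A_eqI) (simp_all add: A_closed to_ring_mult to_ring_closed fst_A_mult)
  qed (use c A_closed in auto)
  fix p q s assume *: "p \<in> carrier A" "q \<in> carrier A" "s \<in> carrier A"
  show "(p \<oplus>\<^bsub>A\<^esub> q) \<otimes>\<^bsub>A\<^esub> s = p \<otimes>\<^bsub>A\<^esub> s \<oplus>\<^bsub>A\<^esub> q \<otimes>\<^bsub>A\<^esub> s"
    using *
    by (intro A_eqI)
      (simp_all add: A_closed to_ring_mult to_ring_add to_ring_closed l_distr fst_A_mult fst_A_add
        distrib_right del: A_simps(3))
qed

lemma ring_hom_cring_to_ring: "ring_hom_cring A R (to_ring R)"
proof (rule ring_hom_cring.intro)
  show "ring_hom_cring_axioms A R (to_ring R)"
  proof (rule ring_hom_cring_axioms.intro, rule ring_hom_memI)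
    show "to_ring R \<one>\<^bsub>A\<^esub> = \<one>"
      by (simp add: to_ring_def)
  qed (auto simp: to_ring_closed to_ring_mult to_ring_add simp del: A_simps)
qed (auto simp: cring_A cring_axioms)

interpretation A: cring A
  by (rule cring_A)

interpretation to_ring: ring_hom_cring A R "to_ring R"
  by (rule ring_hom_cring_to_ring)

lemma fst_finsum:
  assumes "finite S" "f \<in> S \<rightarrow> carrier A"
  shows "fst (\<Oplus>\<^bsub>A\<^esub>s\<in>S. f s) = (\<Sum>s\<in>S. fst (f s))"
  using assms by (induction S) auto

lemma to_ring_vectors:
  assumes "f \<in> vectors A B"
  shows "(\<lambda>b. to_ring R (f b)) \<in> vectors R B"
proof (rule vectors_finiteI[of "supp A f"])
  show "to_ring R (f b) = \<zero>" if "b \<notin> supp A f" for b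
    using that to_ring.hom_zero by (simp add: supp_def)
qed (use assms in \<open>auto simp: vectors_iff to_ring_closed\<close>)

lemma to_ring_linear_extension:
  assumes f: "f \<in> vectors A B" and D: "\<And>b. b \<in> B \<Longrightarrow> D b \<in> vectors A C"
  shows "to_ring R (linear_extension A D f c) =
    linear_extension R (\<lambda>b c. to_ring R (D b c)) (\<lambda>b. to_ring R (f b)) c"
proof -
  have *: "finite (supp A f)" "supp A f \<subseteq> B" "\<And>b. f b \<in> carrier A"
    using f by (auto simp: vectors_iff)
  have Dc: "D b c \<in> carrier A" if "b \<in> supp A f" for b
    using D *(2) that by (meson subsetD vectors_carrier)
  have "to_ring R (linear_extension A D f c) = (\<Oplus>b\<in>supp A f. to_ring R (f b) \<otimes> to_ring R (D b c))"
    unfolding linear_extension_def using * Dc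
    by (subst to_ring.hom_finsum) (auto simp: o_def to_ring_mult to_ring_closed intro!: finsum_cong')
  also have "\<dots> = linear_extension R (\<lambda>b c. to_ring R (D b c)) (\<lambda>b. to_ring R (f b)) c"
  proof (rule linear_extension_superset[symmetric])
    show "supp R (\<lambda>b. to_ring R (f b)) \<subseteq> supp A f"
      using to_ring.hom_zero by (auto simp: supp_def)
  qed (use * Dc to_ring_closed in auto)
  finally show ?thesis .
qed

lemma fst_linear_extension:
  assumes f: "f \<in> vectors A B" and D: "\<And>b. b \<in> B \<Longrightarrow> D b \<in> vectors A C"
  shows "fst (linear_extension A D f c) = (\<Sum>b\<in>supp A f. fst (f b) * fst (D b c))"
proof -
  have *: "finite (supp A f)" "supp A f \<subseteq> B" "\<And>b. f b \<in> carrier A"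
    using f by (auto simp: vectors_iff)
  have Dc: "D b c \<in> carrier A" if "b \<in> supp A f" for b
    using D *(2) that by (meson subsetD vectors_carrier)
  show ?thesis
    unfolding linear_extension_def using * Dc
    by (subst fst_finsum) (auto simp: A_mult intro!: A.m_closed sum.cong)
qed

lemma augmentation_ideal_vectors:
  assumes "z \<in> vectors R B" "\<And>b. z b \<in> J"
  shows "(\<lambda>b. (0, z b)) \<in> vectors A B"
  using assms by (intro vectors_finiteI[of "supp R z"]) (auto simp: vectors_iff carrier_A supp_def)

lemma to_ring_augmentation_ideal: "x \<in> carrier R \<Longrightarrow> to_ring R (0, x) = x"
  by (simp add: to_ring_def add_pow_def)

text \<open>
  The ring \<open>\<int> \<ltimes> J\<close> acts on its ideal \<open>{0} \<times> J\<close> through \<open>to_ring\<close>.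
\<close>

lemma linear_extension_augmentation_ideal:
  assumes z: "z \<in> vectors R B" "\<And>b. z b \<in> J" and D: "\<And>b. b \<in> B \<Longrightarrow> D b \<in> vectors A C"
  shows "linear_extension A D (\<lambda>b. (0, z b)) c = (0, linear_extension R (\<lambda>b c. to_ring R (D b c)) z c)"
proof -
  have v: "(\<lambda>b. (0, z b)) \<in> vectors A B"
    using z by (rule augmentation_ideal_vectors)
  have w: "linear_extension A D (\<lambda>b. (0, z b)) \<in> vectors A C"
    using D v by (rule A.linear_extension_closed)
  have "to_ring R (linear_extension A D (\<lambda>b. (0, z b)) c) = linear_extension R (\<lambda>b c. to_ring R (D b c)) z c"
    using to_ring_linear_extension[OF v D] vectors_carrier[OF z(1)] by (simp add: to_ring_augmentation_ideal)
  moreover have f: "fst (linear_extension A D (\<lambda>b. (0, z b)) c) = 0"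
    using fst_linear_extension[OF v D] by simp
  moreover have "snd (linear_extension A D (\<lambda>b. (0, z b)) c) \<in> carrier R"
    using vectors_carrier[OF w] Icarr by (simp add: carrier_A)
  ultimately show ?thesis
    by (metis prod.collapse to_ring_augmentation_ideal)
qed

end


section \<open>The standard resolutions of the integers\<close>

lemma abelian_monoid_int_module: "abelian_monoid int_module"
  by (rule abelian_monoidI) (auto simp: int_module_def)

lemma zero_int_module [simp]: "\<zero>\<^bsub>int_module\<^esub> = 0"
  by (simp add: int_module_def)

lemma smult_int_module [simp]: "p \<odot>\<^bsub>int_module\<^esub> k = fst p * k"
  by (cases p) (simp add: int_module_def)

text \<open>
  The rings \<open>\<int> \<ltimes> J\<close> for ideals \<open>J\<close> of \<open>R\<close> share zero and addition, so everything that is defined by these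
  alone is independent of \<open>J\<close>.  Products and sums over sets refer to the carrier and are different.
\<close>

lemma linear_combination_carrier_update:
  "linear_combination (int_unitization (R\<lparr>carrier := J\<rparr>)) l = linear_combination (int_unitization R) l"
  by (induction l) (auto simp: int_unitization_def)

lemma gen_boundary_carrier_update:
  "gen_boundary (int_unitization (R\<lparr>carrier := J\<rparr>)) b = gen_boundary (int_unitization R) b"
  by (cases b) (auto simp: linear_combination_carrier_update, simp add: int_unitization_def)

lemma supp_carrier_update:
  "supp (int_unitization (R\<lparr>carrier := J\<rparr>)) f = supp (int_unitization R) f"
  by (simp add: supp_def int_unitization_def)

lemma augment_carrier_update:
  "augment (int_unitization (R\<lparr>carrier := J\<rparr>)) int_module f = augment (int_unitization R) int_module f"
  by (simp add: augment_def supp_carrier_update)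

lemma res_basis_Suc:
  "b \<in> res_basis A M (Suc n) \<longleftrightarrow> (\<exists>l. b = Rel l \<and> set l \<subseteq> carrier A \<times> res_basis A M n \<and>
    (if n = 0 then augment A M (linear_combination A l) = \<zero>\<^bsub>M\<^esub>
     else boundary A (linear_combination A l) = (\<lambda>_. \<zero>\<^bsub>A\<^esub>)))"
  by (cases n) (simp_all only: res_basis.simps mem_Collect_eq if_True if_False nat.simps simp_thms)

text \<open>
  The matrix over \<open>R\<close> of the boundary maps.  It is taken over \<open>\<int> \<ltimes> R\<close> in order to have one function that
  serves all ideals \<open>J\<close> (\<open>ring_boundary_eq\<close>).
\<close>

definition ring_boundary :: "('a, 'b) ring_scheme \<Rightarrow> (int \<times> 'a, int) res_gen \<Rightarrow> (int \<times> 'a, int) res_gen \<Rightarrow> 'a"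
  where "ring_boundary R b c = to_ring R (gen_boundary (int_unitization R) b c)"

context unitization
begin

abbreviation basis :: "nat \<Rightarrow> (int \<times> 'a, int) res_gen set" where
  "basis n \<equiv> res_basis A int_module n"

interpretation A: cring A
  by (rule cring_A)

lemma gen_boundary_closed: "b \<in> basis (Suc n) \<Longrightarrow> gen_boundary A b \<in> vectors A (basis n)"
  by (cases n) (auto intro!: A.linear_combination_vectors)

lemma gen_boundary_basis_0: "b \<in> basis 0 \<Longrightarrow> gen_boundary A b = (\<lambda>_. \<zero>\<^bsub>A\<^esub>)"
  by auto

lemma gen_boundary_closed': "b \<in> basis n \<Longrightarrow> gen_boundary A b \<in> vectors A (basis (n - 1))"
  using gen_boundary_closed gen_boundary_basis_0 A.zero_vectors by (cases n) auto

lemma boundary_closed: "f \<in> vectors A (basis (Suc n)) \<Longrightarrow> boundary A f \<in> vectors A (basis n)"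
  unfolding boundary_eq_linear_extension by (rule A.linear_extension_closed[OF gen_boundary_closed])

lemma boundary_gen_boundary:
  assumes "b \<in> basis (Suc n)"
  shows "boundary A (gen_boundary A b) = (\<lambda>_. \<zero>\<^bsub>A\<^esub>)"
proof (cases n)
  case 0
  then have "gen_boundary A b \<in> vectors A (basis 0)"
    using gen_boundary_closed assms by blast
  then show ?thesis
    unfolding boundary_eq_linear_extension
    using A.linear_extension_eq_zeroI[of "basis 0" "gen_boundary A" "basis 0", OF gen_boundary_closed'[of _ 0, unfolded diff_0_eq_0]] gen_boundary_basis_0
    by (intro ext) simp
next
  case (Suc m)
  with assms show ?thesis by auto
qed

lemma boundary_boundary:
  assumes "f \<in> vectors A (basis (Suc n))"
  shows "boundary A (boundary A f) = (\<lambda>_. \<zero>\<^bsub>A\<^esub>)"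
  unfolding boundary_eq_linear_extension
  by (rule A.linear_extension_linear_extension_eq_zero[where C = "basis n" and C' = "basis (n - 1)"])
    (use assms gen_boundary_closed gen_boundary_closed' boundary_gen_boundary
      in \<open>auto simp: boundary_eq_linear_extension\<close>)

text \<open>
  Any list that expresses the cycle in terms of the basis is itself a basis element of the next degree.
\<close>

lemma resolution_exact:
  assumes f: "f \<in> vectors A (basis n)" and "boundary A f = (\<lambda>_. \<zero>\<^bsub>A\<^esub>)"
    and "n = 0 \<Longrightarrow> augment A int_module f = 0"
  shows "\<exists>b\<in>basis (Suc n). gen_boundary A b = f"
proof -
  obtain l where l: "set l \<subseteq> carrier A \<times> basis n" "f = linear_combination A l"
    using A.vectors_linear_combination[OF f] by blast
  then have "Rel l \<in> basis (Suc n)"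
    using assms(2,3) unfolding res_basis_Suc by (intro exI[of _ l]) auto
  moreover have "gen_boundary A (Rel l) = f"
    using l(2) by simp
  ultimately show ?thesis by blast
qed

lemma augment_augmentation_ideal: "augment A int_module (\<lambda>b. (0, z b)) = 0"
  using abelian_monoid.finsum_zeroI[OF abelian_monoid_int_module, of _ "\<lambda>_. 0"] by (simp add: augment_def)

lemma ring_boundary_eq: "ring_boundary R b c = to_ring R (gen_boundary A b c)"
  by (simp add: ring_boundary_def gen_boundary_carrier_update)

lemma ring_boundary_closed: "b \<in> basis (Suc n) \<Longrightarrow> ring_boundary R b \<in> vectors R (basis n)"
  using to_ring_vectors[OF gen_boundary_closed, of b n]
  by (simp flip: ring_boundary_eq)

lemma to_ring_zero: "to_ring R \<zero>\<^bsub>A\<^esub> = \<zero>"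
  by (simp add: to_ring_augmentation_ideal)

lemma to_ring_boundary:
  assumes "f \<in> vectors A (basis n)"
  shows "to_ring R (boundary A f c) = linear_extension R (ring_boundary R) (\<lambda>b. to_ring R (f b)) c"
  using to_ring_linear_extension[OF assms gen_boundary_closed']
  by (simp add: boundary_eq_linear_extension flip: ring_boundary_eq)

lemma boundary_augmentation_ideal:
  assumes "z \<in> vectors R (basis n)" "\<And>b. z b \<in> J"
  shows "boundary A (\<lambda>b. (0, z b)) c = (0, linear_extension R (ring_boundary R) z c)"
  using linear_extension_augmentation_ideal[OF assms gen_boundary_closed']
  by (simp add: boundary_eq_linear_extension flip: ring_boundary_eq)

end

text \<open>
  The two boundary maps are sums in different rings; they agree because their values agree in \<open>\<int> \<times> R\<close>.
\<close>

lemma boundary_subring: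
  fixes R (structure)
  assumes J1: "unitization R J1" and J2: "unitization R J2" and "J1 \<subseteq> J2"
    and f: "f \<in> vectors (int_unitization (R\<lparr>carrier := J1\<rparr>)) (unitization.basis R J1 n)"
    and sub: "unitization.basis R J1 n \<subseteq> unitization.basis R J2 n"
  shows "boundary (int_unitization (R\<lparr>carrier := J1\<rparr>)) f = boundary (int_unitization (R\<lparr>carrier := J2\<rparr>)) f"
    and "f \<in> vectors (int_unitization (R\<lparr>carrier := J2\<rparr>)) (unitization.basis R J2 n)"
proof -
  interpret J1: unitization R J1 by fact
  interpret J2: unitization R J2 by fact
  interpret A1: cring J1.A by (rule J1.cring_A)
  interpret A2: cring J2.A by (rule J2.cring_A)
  have c: "p \<in> carrier J2.A" if "p \<in> carrier J1.A" for p
    using that assms(3) by (auto simp: J1.carrier_A J2.carrier_A)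
  show f2: "f \<in> vectors J2.A (J2.basis n)"
    using f c sub unfolding vectors_iff by (auto simp: supp_carrier_update)
  have b1: "boundary J1.A f c \<in> carrier J1.A" for c
    unfolding boundary_eq_linear_extension
    using A1.linear_extension_closed[OF J1.gen_boundary_closed' f] by (rule vectors_carrier)
  have b2: "boundary J2.A f c \<in> carrier J2.A" for c
    unfolding boundary_eq_linear_extension
    using A2.linear_extension_closed[OF J2.gen_boundary_closed' f2] by (rule vectors_carrier)
  show "boundary J1.A f = boundary J2.A f"
  proof
    fix d
    show "boundary J1.A f d = boundary J2.A f d"
    proof (rule J2.A_eqI)
      show "fst (boundary J1.A f d) = fst (boundary J2.A f d)"
        unfolding boundary_eq_linear_extension
        using J1.fst_linear_extension[where D = "gen_boundary J1.A", OF f J1.gen_boundary_closed']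
          J2.fst_linear_extension[where D = "gen_boundary J2.A", OF f2 J2.gen_boundary_closed']
        by (simp add: supp_carrier_update gen_boundary_carrier_update)
      show "to_ring R (boundary J1.A f d) = to_ring R (boundary J2.A f d)"
        using J1.to_ring_boundary[OF f] J2.to_ring_boundary[OF f2] by simp
    qed (use b1 b2 c in auto)
  qed
qed

lemma basis_mono:
  fixes R (structure)
  assumes J1: "unitization R J1" and J2: "unitization R J2" and "J1 \<subseteq> J2"
  shows "unitization.basis R J1 n \<subseteq> unitization.basis R J2 n"
proof -
  interpret J1: unitization R J1 by fact
  interpret J2: unitization R J2 by fact
  interpret A1: cring J1.A by (rule J1.cring_A)
  have c: "carrier J1.A \<subseteq> carrier J2.A"
    using assms(3) by (auto simp: J1.carrier_A J2.carrier_A)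
  show ?thesis
  proof (induction n rule: nat_induct)
    case 0
    show ?case by simp
  next
    case (Suc n)
    have *: "boundary J2.A (linear_combination J2.A l) = boundary J1.A (linear_combination J1.A l)"
      if "set l \<subseteq> carrier J1.A \<times> J1.basis n" for l
      using boundary_subring(1)[OF assms A1.linear_combination_vectors[OF that] Suc]
      by (simp add: linear_combination_carrier_update)
    have z: "\<zero>\<^bsub>J2.A\<^esub> = \<zero>\<^bsub>J1.A\<^esub>"
      by simp
    show ?case
    proof
      fix b assume "b \<in> J1.basis (Suc n)"
      then obtain l where l: "b = Rel l" "set l \<subseteq> carrier J1.A \<times> J1.basis n"
        "if n = 0 then augment J1.A int_module (linear_combination J1.A l) = 0
         else boundary J1.A (linear_combination J1.A l) = (\<lambda>_. \<zero>\<^bsub>J1.A\<^esub>)"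
        unfolding res_basis_Suc zero_int_module by (elim exE conjE) (rule that)
      have "set l \<subseteq> carrier J2.A \<times> J2.basis n"
        using l(2) Sigma_mono[OF c Suc] by (rule subset_trans)
      moreover have "if n = 0 then augment J2.A int_module (linear_combination J2.A l) = 0
         else boundary J2.A (linear_combination J2.A l) = (\<lambda>_. \<zero>\<^bsub>J2.A\<^esub>)"
        using l(3) unfolding *[OF l(2)] z
        by (simp only: linear_combination_carrier_update augment_carrier_update)
      ultimately show "b \<in> J2.basis (Suc n)"
        unfolding res_basis_Suc l(1) zero_int_module by (intro exI[of _ l] conjI refl)
    qed
  qed
qed

locale noetherian_ideal = noetherian_cring R + ideal I R for R (structure) and I
begin

abbreviation Ipow :: "nat \<Rightarrow> 'a set" where
  "Ipow r \<equiv> I [^]\<^bsub>ideals_set R\<^esub> r"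

abbreviation U :: "nat \<Rightarrow> (int \<times> 'a) ring" where
  "U r \<equiv> int_unitization (R\<lparr>carrier := Ipow r\<rparr>)"

abbreviation U_basis :: "nat \<Rightarrow> nat \<Rightarrow> (int \<times> 'a, int) res_gen set" where
  "U_basis r n \<equiv> res_basis (U r) int_module n"

lemma unitization_power: "unitization R (Ipow r)"
  by (intro unitization.intro cring_axioms ideal_ideal_power ideal_axioms)

lemma tower: "tower_resolution R I U_basis (ring_boundary R)"
proof (rule tower_resolution.intro, rule noetherian_cring_axioms, rule tower_resolution_axioms.intro)
  show "ideal I R" by (rule ideal_axioms)
  fix r n
  interpret J: unitization R "Ipow r" by (rule unitization_power)
  interpret A: cring "U r" by (rule J.cring_A)
  show "U_basis s n \<subseteq> U_basis r n" if "r \<le> s" for s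
    using basis_mono[OF unitization_power unitization_power ideal_power_antimono[OF ideal_axioms that]] .
  show "ring_boundary R b = (\<lambda>_. \<zero>)" if "b \<in> U_basis r 0" for b
    using J.gen_boundary_basis_0[OF that] J.to_ring_zero by (simp add: fun_eq_iff J.ring_boundary_eq)
  show "ring_boundary R b \<in> vectors R (U_basis r n)" if "b \<in> U_basis r (Suc n)" for b
    using that by (rule J.ring_boundary_closed)
  show "linear_extension R (ring_boundary R) (ring_boundary R b) = (\<lambda>_. \<zero>)" if "b \<in> U_basis r (Suc n)" for b
    using J.to_ring_boundary[OF J.gen_boundary_closed[OF that]] J.boundary_gen_boundary[OF that] J.to_ring_zero
    by (simp add: fun_eq_iff flip: J.ring_boundary_eq)
  show "\<exists>b\<in>U_basis r (Suc n). ring_boundary R b = c"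
    if c: "c \<in> vectors R (U_basis r n)" "\<And>b. c b \<in> Ipow r"
      and cycle: "linear_extension R (ring_boundary R) c = (\<lambda>_. \<zero>)" for c
  proof -
    have "boundary (U r) (\<lambda>b. (0, c b)) = (\<lambda>_. \<zero>\<^bsub>U r\<^esub>)"
      using J.boundary_augmentation_ideal[OF c] cycle by (simp add: fun_eq_iff)
    then obtain b where b: "b \<in> U_basis r (Suc n)" "gen_boundary (U r) b = (\<lambda>b. (0, c b))"
      using J.resolution_exact[OF J.augmentation_ideal_vectors[OF c]] J.augment_augmentation_ideal by blast
    then have "ring_boundary R b = c"
      using vectors_carrier[OF c(1)] by (simp add: fun_eq_iff J.ring_boundary_eq J.to_ring_augmentation_ideal)
    with b show ?thesis by blast
  qed
qed

text \<open>
  A cycle of \<open>F \<otimes> \<int>\<close> in degree \<open>n + 1\<close> is represented by an \<open>f\<close> whose boundary \<open>(0, x)\<close> has coefficients in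
  \<open>I\<^sup>s\<close>.  For \<open>s = q + r\<close> these are in \<open>I\<^sup>q G\<close> with \<open>G = I\<^sup>r \<subseteq> R\<^sup>1\<close>, so \<open>x\<close> is the boundary of an
  \<open>I\<^sup>r\<close>-valued chain \<open>y\<close>.
  Then \<open>f - (0, y)\<close> is a cycle of \<open>F\<close>, hence a boundary.
\<close>

lemma pro_exactness:
  "\<exists>s\<ge>r. \<forall>f\<in>vectors (U s) (U_basis s (Suc n)). (\<forall>c. fst (boundary (U s) f c) = 0) \<longrightarrow>
    (\<exists>y d. y \<in> vectors R (U_basis r (Suc n)) \<and> (\<forall>b. y b \<in> Ipow r) \<and>
      d \<in> vectors (U r) (U_basis r (Suc (Suc n))) \<and>
      f = (\<lambda>b. (0, y b) \<oplus>\<^bsub>U r\<^esub> boundary (U r) d b))"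
proof -
  interpret T: tower_resolution R I U_basis "ring_boundary R"
    by (rule tower)
  define G where "G = {v \<in> vectors R {..<1::nat}. \<forall>i. v i \<in> Ipow r}"
  have G: "vector_submodule R {..<1} G"
    unfolding G_def by (rule vector_submodule_ideal_valued[OF T.ideal_J])
  obtain q where q: "q \<ge> r" and Q: "\<And>z. z \<in> module_chains R (U_basis q n) (ideal_smult R (Ipow q) G) \<Longrightarrow>
      chain_boundary R (ring_boundary R) z = (\<lambda>_ _. \<zero>) \<Longrightarrow>
      \<exists>y\<in>module_chains R (U_basis r (Suc n)) G. chain_boundary R (ring_boundary R) y = z"
    using T.cycles_are_boundaries[OF G] by blast
  define s where "s = q + r"
  have s: "s \<ge> r" "s \<ge> q"
    by (simp_all add: s_def)
  interpret Js: unitization R "Ipow s" by (rule unitization_power)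
  interpret Jr: unitization R "Ipow r" by (rule unitization_power)
  interpret As: cring "U s" by (rule Js.cring_A)
  interpret Ar: cring "U r" by (rule Jr.cring_A)
  have "\<exists>y d. y \<in> vectors R (U_basis r (Suc n)) \<and> (\<forall>b. y b \<in> Ipow r) \<and>
      d \<in> vectors (U r) (U_basis r (Suc (Suc n))) \<and>
      f = (\<lambda>b. (0, y b) \<oplus>\<^bsub>U r\<^esub> boundary (U r) d b)"
    if f: "f \<in> vectors (U s) (U_basis s (Suc n))" and f0: "\<And>c. fst (boundary (U s) f c) = 0" for f
  proof -
    define x where "x c = snd (boundary (U s) f c)" for c
    have bf: "boundary (U s) f \<in> vectors (U s) (U_basis s n)"
      by (rule Js.boundary_closed[OF f])
    have bfx: "boundary (U s) f = (\<lambda>c. (0, x c))"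
      using f0 by (auto simp: fun_eq_iff x_def prod_eq_iff)
    have xs: "x c \<in> Ipow s" for c
      using vectors_carrier[OF bf, of c] by (simp add: Js.carrier_A x_def)
    then have xc: "x c \<in> carrier R" for c
      by (rule Js.Icarr)
    have x: "x \<in> vectors R (U_basis s n)"
      using Js.to_ring_vectors[OF bf] xc by (simp add: bfx Js.to_ring_augmentation_ideal)
    define z where "z c i = (if i = 0 then x c else \<zero>)" for c and i :: nat
    have zG: "(\<lambda>i::nat. if i = 0 then a else \<zero>) \<in> ideal_smult R (Ipow q) G" if "a \<in> Ipow s" for a
    proof -
      have "a \<in> ideal_prod R (Ipow q) (Ipow r)"
        using that ideal_power_add[OF ideal_axioms] by (simp add: s_def)
      then show ?thesis
      proof induction
        case (prod a b)
        have ab: "a \<in> carrier R" "b \<in> carrier R"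
          using prod ideal.Icarr[OF T.ideal_J] by auto
        have "(\<lambda>i::nat. if i = 0 then b else \<zero>) \<in> G"
          using single_vectors[of "0::nat" "{..<1}" b] ab prod(2) Jr.zero_closed by (simp add: G_def)
        from ideal_smult.prod[OF prod(1) this, of R]
        show ?case
          using ab by (auto simp: if_distrib cong: if_cong)
      next
        case (sum a b)
        have "(\<lambda>i::nat. (if i = 0 then a else \<zero>) \<oplus> (if i = 0 then b else \<zero>))
            = (\<lambda>i. if i = 0 then a \<oplus> b else \<zero>)"
          by auto
        with ideal_smult.sum[OF sum(3,4)] show ?case
          by simp
      qed
    qed
    have "z \<in> module_chains R (U_basis q n) (ideal_smult R (Ipow q) G)"
    proof (rule module_chainsI)
      show "z b \<in> ideal_smult R (Ipow q) G" for b
        using zG[OF xs[of b]] by (simp add: z_def[abs_def])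
      show "(\<lambda>b. z b i) \<in> vectors R (U_basis q n)" for i
        using vectors_mono[OF T.basis_antimono[OF s(2)] x] zero_vectors by (cases "i = 0") (auto simp: z_def)
    qed
    moreover have "linear_extension R (ring_boundary R) x = (\<lambda>_. \<zero>)"
      using Js.boundary_augmentation_ideal[OF x xs] Js.boundary_boundary[OF f]
      by (simp add: bfx fun_eq_iff)
    then have "chain_boundary R (ring_boundary R) z = (\<lambda>_ _. \<zero>)"
      unfolding chain_boundary_def
      by (intro ext, rename_tac c i, case_tac "i = 0") (simp_all add: z_def, simp add: linear_extension_def supp_def)
    ultimately obtain y where y: "y \<in> module_chains R (U_basis r (Suc n)) G"
      and yz: "chain_boundary R (ring_boundary R) y = z"
      using Q by blast
    define y0 where "y0 b = y b 0" for b
    have y0: "y0 \<in> vectors R (U_basis r (Suc n))" "\<And>b. y0 b \<in> Ipow r"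
      using module_chainsD(2)[OF y, of 0] module_chainsD(1)[OF y] by (auto simp: y0_def[abs_def] G_def)
    have y0': "(\<lambda>b. (0, y0 b)) \<in> vectors (U r) (U_basis r (Suc n))"
      using y0 by (rule Jr.augmentation_ideal_vectors)
    have "linear_extension R (ring_boundary R) y0 c = x c" for c
      using fun_cong[OF fun_cong[OF yz], of c 0] by (simp add: chain_boundary_def z_def y0_def[abs_def])
    then have by0: "boundary (U r) (\<lambda>b. (0, y0 b)) = (\<lambda>c. (0, x c))"
      using Jr.boundary_augmentation_ideal[OF y0] by (simp add: fun_eq_iff)
    have fr: "f \<in> vectors (U r) (U_basis r (Suc n))" and bfr: "boundary (U r) f = (\<lambda>c. (0, x c))"
      using boundary_subring[OF Js.unitization_axioms Jr.unitization_axioms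
          ideal_power_antimono[OF ideal_axioms s(1)] f T.basis_antimono[OF s(1)]] bfx by auto
    define g where "g b = f b \<ominus>\<^bsub>U r\<^esub> (0, y0 b)" for b
    have g: "g \<in> vectors (U r) (U_basis r (Suc n))"
      unfolding g_def[abs_def] by (rule Ar.diff_vectors[OF fr y0'])
    have "boundary (U r) g c = \<zero>\<^bsub>U r\<^esub>" for c
    proof -
      have "boundary (U r) g c = (0, x c) \<ominus>\<^bsub>U r\<^esub> (0, x c)"
        using Ar.linear_extension_diff[OF Jr.gen_boundary_closed fr y0', where c = c] bfr by0
        by (simp add: boundary_eq_linear_extension g_def[abs_def])
      moreover have "(0, x c) \<in> carrier (U r)"
        using vectors_carrier[OF Jr.boundary_closed[OF fr], of c] by (simp add: bfr)
      ultimately show ?thesis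
        using Ar.r_right_minus_eq by simp
    qed
    then obtain b where b: "b \<in> U_basis r (Suc (Suc n))" "gen_boundary (U r) b = g"
      using Jr.resolution_exact[OF g] by blast
    define d where "d = (\<lambda>c. if c = b then \<one>\<^bsub>U r\<^esub> else \<zero>\<^bsub>U r\<^esub>)"
    have d: "d \<in> vectors (U r) (U_basis r (Suc (Suc n)))"
      unfolding d_def using b(1) Ar.one_closed by (rule Ar.single_vectors)
    have gb: "gen_boundary (U r) b' \<in> vectors (U r) (U_basis r (Suc n))"
      if "b' \<in> U_basis r (Suc (Suc n))" for b'
      using that by (rule Jr.gen_boundary_closed)
    have "boundary (U r) d c = g c" for c
      unfolding boundary_eq_linear_extension d_def
      using Ar.linear_extension_single[OF gb b(1) Ar.one_closed, where c = c]
        b(2) vectors_carrier[OF g] Ar.l_one by (simp del: Jr.A_simps)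
    moreover have "f c = (0, y0 c) \<oplus>\<^bsub>U r\<^esub> g c" for c
    proof -
      have "f c \<in> carrier (U r)" "(0, y0 c) \<in> carrier (U r)"
        using vectors_carrier[OF fr] vectors_carrier[OF y0'] by auto
      then show ?thesis
        unfolding g_def by (simp only: Ar.minus_eq) (metis Ar.a_comm Ar.a_inv_closed Ar.a_assoc Ar.r_neg Ar.l_zero Ar.a_closed)
    qed
    ultimately show ?thesis
      using y0 d by (intro exI[of _ y0] exI[of _ d]) (simp add: fun_eq_iff)
  qed
  with s(1) show ?thesis by blast
qed

end


section \<open>The tensor product of a free module with the integers\<close>

lemma carrier_int_module [simp]: "carrier int_module = UNIV"
  by (simp add: int_module_def)

lemma add_int_module [simp]: "k \<oplus>\<^bsub>int_module\<^esub> l = k + l"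
  by (simp add: int_module_def)

lemma frag_of_diff_carrier:
  assumes "p \<in> S" "q \<in> S" "p' \<in> S"
  shows "frag_of p - frag_of q \<in> carrier (free_Abelian_group S)"
    and "frag_of p - frag_of q - frag_of p' \<in> carrier (free_Abelian_group S)"
proof -
  have "Poly_Mapping.keys (frag_of p - frag_of q) \<subseteq> S"
    using keys_diff[of "frag_of p" "frag_of q"] assms by auto
  then show "frag_of p - frag_of q \<in> carrier (free_Abelian_group S)" by simp
  then show "frag_of p - frag_of q - frag_of p' \<in> carrier (free_Abelian_group S)"
    using keys_diff[of "frag_of p - frag_of q" "frag_of p'"] assms by auto
qed

lemma quotient_map_coset:
  assumes "group G" "subgroup H G" "h ` H0 \<subseteq> H" "\<one>\<^bsub>G\<^esub> \<in> h ` H0" "h x \<in> carrier G"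
    and hom: "\<And>k. k \<in> H0 \<Longrightarrow> h (k \<otimes>\<^bsub>G0\<^esub> x) = h k \<otimes>\<^bsub>G\<^esub> h x"
  shows "quotient_map G H h (H0 #>\<^bsub>G0\<^esub> x) = H #>\<^bsub>G\<^esub> h x"
proof -
  interpret G: group G by fact
  interpret H: subgroup H G by fact
  show ?thesis
  proof (intro equalityI subsetI)
    fix u assume "u \<in> quotient_map G H h (H0 #>\<^bsub>G0\<^esub> x)"
    then obtain a k where ak: "a \<in> H" "k \<in> H0" "u = a \<otimes>\<^bsub>G\<^esub> h (k \<otimes>\<^bsub>G0\<^esub> x)"
      by (auto simp: quotient_map_def set_mult_def r_coset_def)
    then have hk: "h k \<in> H" using assms(3) by blast
    then have "u = (a \<otimes>\<^bsub>G\<^esub> h k) \<otimes>\<^bsub>G\<^esub> h x"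
      using ak hom assms(5) by (simp add: G.m_assoc)
    then show "u \<in> H #>\<^bsub>G\<^esub> h x"
      using ak hk by (auto simp: r_coset_def)
  next
    fix u assume "u \<in> H #>\<^bsub>G\<^esub> h x"
    then obtain a where a: "a \<in> H" "u = a \<otimes>\<^bsub>G\<^esub> h x"
      by (auto simp: r_coset_def)
    obtain e where e: "e \<in> H0" "h e = \<one>\<^bsub>G\<^esub>"
      using assms(4) by auto
    have "u = a \<otimes>\<^bsub>G\<^esub> h (e \<otimes>\<^bsub>G0\<^esub> x)"
      using a e hom[OF e(1)] assms(5) by simp
    then show "u \<in> quotient_map G H h (H0 #>\<^bsub>G0\<^esub> x)"
      using a e by (auto simp: quotient_map_def set_mult_def r_coset_def)
  qed
qed

context unitization
begin

interpretation A: cring A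
  by (rule cring_A)

abbreviation pairs :: "'c set \<Rightarrow> (('c \<Rightarrow> int \<times> 'a) \<times> int \<Rightarrow>\<^sub>0 int) monoid" where
  "pairs B \<equiv> free_Abelian_group (vectors A B \<times> UNIV)"

abbreviation relations :: "'c set \<Rightarrow> (('c \<Rightarrow> int \<times> 'a) \<times> int \<Rightarrow>\<^sub>0 int) set" where
  "relations B \<equiv> tensor_kernel A (free_module A B) int_module"

lemma add_free_module [simp]: "f \<oplus>\<^bsub>free_module S B\<^esub> g = (\<lambda>b. f b \<oplus>\<^bsub>S\<^esub> g b)"
  by (simp add: free_module_def)

lemma smult_free_module [simp]: "a \<odot>\<^bsub>free_module S B\<^esub> f = (\<lambda>b. a \<otimes>\<^bsub>S\<^esub> f b)"
  by (simp add: free_module_def)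

lemma tensor_relators_carrier:
  "tensor_relators A (free_module A B) int_module \<subseteq> carrier (pairs B)"
  unfolding tensor_relators_def
  by (auto simp del: carrier_free_Abelian_group_iff A_simps
      intro!: frag_of_diff_carrier A.add_vectors A.smult_vectors)

lemma relations_eq: "relations B = generate (pairs B) (tensor_relators A (free_module A B) int_module)"
  by (simp add: tensor_kernel_def)

lemma subgroup_relations: "subgroup (relations B) (pairs B)"
  unfolding relations_eq
  using group.generate_is_subgroup[OF group_free_Abelian_group tensor_relators_carrier] .

lemma relations_carrier: "x \<in> relations B \<Longrightarrow> Poly_Mapping.keys x \<subseteq> vectors A B \<times> UNIV"
  using subgroup.mem_carrier[OF subgroup_relations] by auto

lemma relations_zero: "0 \<in> relations B"
  using subgroup.one_closed[OF subgroup_relations] by simp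

lemma relations_add:
  assumes "x \<in> relations B" "y \<in> relations B"
  shows "x + y \<in> relations B"
  using subgroup.m_closed[OF subgroup_relations assms] by simp

lemma relations_minus:
  assumes "x \<in> relations B"
  shows "- x \<in> relations B"
  using subgroup.m_inv_closed[OF subgroup_relations assms] inv_free_Abelian_group[OF relations_carrier[OF assms]]
  by simp

lemma relations_diff:
  assumes "x \<in> relations B" "y \<in> relations B"
  shows "x - y \<in> relations B"
  using relations_add[OF assms(1) relations_minus[OF assms(2)]] by simp

lemma relators_relations: "x \<in> tensor_relators A (free_module A B) int_module \<Longrightarrow> x \<in> relations B"
  unfolding relations_eq by (rule generate.incl)

lemma relation_add_left:
  assumes "f \<in> vectors A B" "g \<in> vectors A B"
  shows "frag_of (\<lambda>b. f b \<oplus>\<^bsub>A\<^esub> g b, k) - frag_of (f, k) - frag_of (g, k) \<in> relations B"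
proof (rule relators_relations)
  show "frag_of (\<lambda>b. f b \<oplus>\<^bsub>A\<^esub> g b, k) - frag_of (f, k) - frag_of (g, k)
      \<in> tensor_relators A (free_module A B) int_module"
    unfolding tensor_relators_def add_free_module
    by (rule UnI1, rule UnI1, rule CollectI, intro exI conjI, rule refl) (use assms in simp_all)
qed

lemma relation_add_right:
  assumes "f \<in> vectors A B"
  shows "frag_of (f, k + l) - frag_of (f, k) - frag_of (f, l) \<in> relations B"
proof (rule relators_relations)
  show "frag_of (f, k + l) - frag_of (f, k) - frag_of (f, l)
      \<in> tensor_relators A (free_module A B) int_module"
    unfolding tensor_relators_def add_int_module
    by (rule UnI1, rule UnI2, rule CollectI, intro exI conjI, rule refl) (use assms in simp_all)
qed

lemma relation_smult:
  assumes "f \<in> vectors A B" "a \<in> carrier A"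
  shows "frag_of (\<lambda>b. a \<otimes>\<^bsub>A\<^esub> f b, k) - frag_of (f, fst a * k) \<in> relations B"
proof (rule relators_relations)
  show "frag_of (\<lambda>b. a \<otimes>\<^bsub>A\<^esub> f b, k) - frag_of (f, fst a * k)
      \<in> tensor_relators A (free_module A B) int_module"
    unfolding tensor_relators_def smult_free_module smult_int_module
    by (rule UnI2, rule CollectI, intro exI conjI, rule refl) (use assms in simp_all)
qed

lemma relations_induct [consumes 1, case_names zero diff add_left add_right smult]:
  assumes "x \<in> relations B" and "P 0" and "\<And>x y. P x \<Longrightarrow> P y \<Longrightarrow> P (x - y)"
    and add_l: "\<And>f g k. f \<in> vectors A B \<Longrightarrow> g \<in> vectors A B \<Longrightarrow>
      P (frag_of (\<lambda>b. f b \<oplus>\<^bsub>A\<^esub> g b, k) - frag_of (f, k) - frag_of (g, k))"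
    and add_r: "\<And>f k l. f \<in> vectors A B \<Longrightarrow> P (frag_of (f, k + l) - frag_of (f, k) - frag_of (f, l))"
    and smult: "\<And>f a k. f \<in> vectors A B \<Longrightarrow> a \<in> carrier A \<Longrightarrow>
      P (frag_of (\<lambda>b. a \<otimes>\<^bsub>A\<^esub> f b, k) - frag_of (f, fst a * k))"
  shows "P x"
proof -
  have rel: "P y" if "y \<in> tensor_relators A (free_module A B) int_module" for y
    using that add_l add_r smult unfolding tensor_relators_def
    by (auto simp del: A_simps)
  have minus: "P (- y)" if "P y" for y
    using assms(3)[OF assms(2) that] by simp
  have plus: "P (y + z)" if "P y" "P z" for y z
    using assms(3)[OF that(1) minus[OF that(2)]] by simp
  have "x \<in> generate (pairs B) (tensor_relators A (free_module A B) int_module)"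
    using assms(1) by (simp add: relations_eq)
  then show ?thesis
  proof induction
    case (inv h)
    then have "inv\<^bsub>pairs B\<^esub> h = - h"
      using subsetD[OF tensor_relators_carrier inv] by (intro inv_free_Abelian_group) simp
    then show ?case
      using rel[OF inv] minus by simp
  qed (use assms(2) rel plus in auto)
qed

text \<open>
  The functional \<open>f \<otimes> k \<mapsto> k \<cdot> fst (f b)\<close> is well defined on the tensor product; it is realised as a
  homomorphism into the free abelian group on one element.
\<close>

lemma relations_augmentation:
  assumes "frag_of (f, 1) \<in> relations B"
  shows "fst (f b) = 0"
proof -
  define h where "h = frag_extend (\<lambda>(f :: 'c \<Rightarrow> int \<times> 'a, k). frag_cmul (k * fst (f b)) (frag_of ()))"
  have h: "h (frag_of (f, k)) = frag_cmul (k * fst (f b)) (frag_of ())" for f k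
    by (simp add: h_def)
  have "h (frag_of (f, 1)) = 0"
    using assms
  proof (induction rule: relations_induct)
    case (diff x y)
    then show ?case by (simp add: h_def frag_extend_diff)
  next
    case (add_left f g k)
    have "h (frag_of (\<lambda>b. f b \<oplus>\<^bsub>A\<^esub> g b, k) - frag_of (f, k) - frag_of (g, k))
      = h (frag_of (\<lambda>b. f b \<oplus>\<^bsub>A\<^esub> g b, k)) - h (frag_of (f, k)) - h (frag_of (g, k))"
      by (simp only: h_def frag_extend_diff)
    then show ?case
      by (simp add: h frag_cmul_distrib distrib_left)
  next
    case (add_right f k l)
    have "h (frag_of (f, k + l) - frag_of (f, k) - frag_of (f, l))
      = h (frag_of (f, k + l)) - h (frag_of (f, k)) - h (frag_of (f, l))"
      by (simp only: h_def frag_extend_diff)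
    then show ?case
      by (simp add: h frag_cmul_distrib distrib_right)
  next
    case (smult f a k)
    have "h (frag_of (\<lambda>b. a \<otimes>\<^bsub>A\<^esub> f b, k) - frag_of (f, fst a * k))
      = h (frag_of (\<lambda>b. a \<otimes>\<^bsub>A\<^esub> f b, k)) - h (frag_of (f, fst a * k))"
      by (simp only: h_def frag_extend_diff)
    then show ?case
      by (simp add: h fst_A_mult ac_simps)
  qed (simp add: h_def)
  then have "frag_cmul (fst (f b)) (frag_of ()) = 0"
    by (simp add: h)
  then show ?thesis
    by (metis frag_cmul_eq_0_iff frag_of_nonzero)
qed

text \<open>
  The element \<open>f \<otimes> 1\<close> of the tensor product.
\<close>

definition tensor_one :: "'c set \<Rightarrow> ('c \<Rightarrow> int \<times> 'a) \<Rightarrow> (('c \<Rightarrow> int \<times> 'a) \<times> int \<Rightarrow>\<^sub>0 int) set" where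
  "tensor_one B f = relations B #>\<^bsub>pairs B\<^esub> frag_of (f, 1)"

lemma coset_eqI:
  assumes "x - y \<in> relations B"
  shows "relations B #>\<^bsub>pairs B\<^esub> x = relations B #>\<^bsub>pairs B\<^esub> y"
proof -
  have "\<exists>k'\<in>relations B. k + x = k' + y" if "k \<in> relations B" for k
    using relations_add[OF that assms] by (intro bexI[of _ "k + (x - y)"]) auto
  moreover have "\<exists>k'\<in>relations B. k + y = k' + x" if "k \<in> relations B" for k
    using relations_diff[OF that assms] by (intro bexI[of _ "k - (x - y)"]) auto
  ultimately show ?thesis
    by (auto simp: r_coset_def)
qed

text \<open>
  Every element has the form \<open>f \<otimes> 1\<close>, because \<open>f \<otimes> k = (k, 0) f \<otimes> 1\<close>.
\<close>

lemma coset_eq_tensor_one: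
  assumes "Poly_Mapping.keys x \<subseteq> vectors A B \<times> UNIV"
  shows "\<exists>f\<in>vectors A B. x - frag_of (f, 1) \<in> relations B"
  using assms
proof (induction rule: free_Abelian_group_induct[consumes 1, case_names zero diff frag_of])
  case zero
  have "frag_of (\<lambda>b. \<zero>\<^bsub>A\<^esub> \<oplus>\<^bsub>A\<^esub> \<zero>\<^bsub>A\<^esub>, 1) - frag_of (\<lambda>_. \<zero>\<^bsub>A\<^esub>, 1) - frag_of (\<lambda>_. \<zero>\<^bsub>A\<^esub>, 1) \<in> relations B"
    by (rule relation_add_left) (rule A.zero_vectors)+
  then have "0 - frag_of (\<lambda>_. \<zero>\<^bsub>A\<^esub>, 1) \<in> relations B"
    by simp
  then show ?case
    using A.zero_vectors by blast
next
  case (diff x y)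
  then obtain f g where f: "f \<in> vectors A B" "x - frag_of (f, 1) \<in> relations B"
    and g: "g \<in> vectors A B" "y - frag_of (g, 1) \<in> relations B" by blast
  let ?d = "\<lambda>b. f b \<ominus>\<^bsub>A\<^esub> g b"
  have d: "?d \<in> vectors A B"
    using f(1) g(1) by (rule A.diff_vectors)
  have "?d b \<oplus>\<^bsub>A\<^esub> g b = f b" for b
    using vectors_carrier[OF f(1)] vectors_carrier[OF g(1)]
    by (simp add: A.minus_eq A.a_assoc A.l_neg del: A_simps)
  then have "frag_of (f, 1) - frag_of (?d, 1) - frag_of (g, 1) \<in> relations B"
    using relation_add_left[where k = 1, OF d g(1)] by simp
  from relations_add[OF relations_diff[OF f(2) g(2)] this]
  have "x - y - frag_of (?d, 1) \<in> relations B"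
    by (simp add: algebra_simps)
  with d show ?case by blast
next
  case (frag_of p)
  obtain f k where p: "p = (f, k)" and f: "f \<in> vectors A B"
    using frag_of by (cases p) auto
  have k: "(k, \<zero>) \<in> carrier A"
    by (simp add: carrier_A)
  have "frag_of (\<lambda>b. (k, \<zero>) \<otimes>\<^bsub>A\<^esub> f b, 1) - frag_of (f, k) \<in> relations B"
    using relation_smult[where k = 1, OF f k] by simp
  from relations_minus[OF this] show ?case
    unfolding p using A.smult_vectors[OF f k] by (intro bexI) auto
qed

lemma group_tensor: "group (tensor A (free_module A B) int_module)"
proof -
  have "relations B \<lhd> pairs B"
    using comm_group.normal_iff_subgroup[OF abelian_free_Abelian_group] subgroup_relations by blast
  then show ?thesis
    unfolding tensor_def by (simp add: normal.factorgroup_is_group)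
qed

lemma carrier_tensor: "carrier (tensor A (free_module A B) int_module) = tensor_one B ` vectors A B"
proof -
  have "carrier (tensor A (free_module A B) int_module) = (\<lambda>x. relations B #>\<^bsub>pairs B\<^esub> x) ` carrier (pairs B)"
    by (auto simp: tensor_def FactGroup_def RCOSETS_def)
  also have "\<dots> = tensor_one B ` vectors A B"
  proof (intro equalityI subsetI)
    fix X assume "X \<in> (\<lambda>x. relations B #>\<^bsub>pairs B\<^esub> x) ` carrier (pairs B)"
    then obtain x where x: "Poly_Mapping.keys x \<subseteq> vectors A B \<times> UNIV" "X = relations B #>\<^bsub>pairs B\<^esub> x"
      by auto
    obtain f where "f \<in> vectors A B" "x - frag_of (f, 1) \<in> relations B"
      using coset_eq_tensor_one[OF x(1)] by blast
    then show "X \<in> tensor_one B ` vectors A B"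
      unfolding x(2) tensor_one_def using coset_eqI[of x "frag_of (f, 1)"] by blast
  qed (auto simp: tensor_one_def)
  finally show ?thesis .
qed

lemma one_tensor: "\<one>\<^bsub>tensor A (free_module A B) int_module\<^esub> = relations B"
  by (simp add: tensor_def FactGroup_def)

lemma tensor_one_add:
  assumes f: "f \<in> vectors A B" and g: "g \<in> vectors A B"
  shows "tensor_one B f \<otimes>\<^bsub>tensor A (free_module A B) int_module\<^esub> tensor_one B g
    = tensor_one B (\<lambda>b. f b \<oplus>\<^bsub>A\<^esub> g b)"
proof -
  have "relations B \<lhd> pairs B"
    using comm_group.normal_iff_subgroup[OF abelian_free_Abelian_group] subgroup_relations by blast
  then have "tensor_one B f \<otimes>\<^bsub>tensor A (free_module A B) int_module\<^esub> tensor_one B g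
      = relations B #>\<^bsub>pairs B\<^esub> (frag_of (f, 1) + frag_of (g, 1))"
    unfolding tensor_one_def tensor_def carrier_int_module using f g
    by (simp add: normal.rcos_sum)
  also have "\<dots> = tensor_one B (\<lambda>b. f b \<oplus>\<^bsub>A\<^esub> g b)"
    unfolding tensor_one_def
    using relations_minus[OF relation_add_left[where k = 1, OF f g]]
    by (intro coset_eqI) (simp add: algebra_simps del: A_simps)
  finally show ?thesis .
qed

lemma tensor_one_eq_oneD:
  assumes "tensor_one B f = relations B"
  shows "fst (f b) = 0"
proof -
  have "0 + frag_of (f, 1) \<in> tensor_one B f"
    using relations_zero unfolding tensor_one_def r_coset_def by fastforce
  then show ?thesis
    using assms relations_augmentation by simp
qed

lemma tensor_one_eq_oneI:
  assumes "frag_of (f, 1) \<in> relations B"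
  shows "tensor_one B f = relations B"
proof -
  have "tensor_one B f = relations B #>\<^bsub>pairs B\<^esub> 0"
    unfolding tensor_one_def using assms by (intro coset_eqI) simp
  then show ?thesis
    by (simp add: r_coset_def)
qed

text \<open>
  Coefficients in \<open>{0} \<times> J\<close> can be moved to the factor \<open>\<int>\<close>, on which they act as zero.
\<close>

lemma tensor_one_augmentation_ideal:
  assumes "z \<in> vectors R B" "\<And>b. z b \<in> J"
  shows "tensor_one B (\<lambda>b. (0, z b)) = relations B"
proof (rule tensor_one_eq_oneI)
  have "frag_of (\<lambda>b. (0, z b), 1) \<in> relations B"
    if "finite S" "S \<subseteq> B" "supp R z \<subseteq> S" "\<And>b. z b \<in> J" for S z
    using that
  proof (induction S arbitrary: z)
    case empty
    then have "(\<lambda>b. (0, z b)) = (\<lambda>_. \<zero>\<^bsub>A\<^esub>)"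
      by (auto simp: supp_def)
    then show ?case
      using relations_minus[OF relation_add_left[where B = B and k = 1, OF A.zero_vectors A.zero_vectors]] by simp
  next
    case (insert s S)
    define e where "e = (\<lambda>c. if c = s then \<one>\<^bsub>A\<^esub> else \<zero>\<^bsub>A\<^esub>)"
    have e: "e \<in> vectors A B"
      unfolding e_def using insert.prems by (intro A.single_vectors A.one_closed) auto
    have a: "(0, z s) \<in> carrier A"
      using insert.prems by (simp add: carrier_A)
    let ?g = "\<lambda>b. (0, z b) :: int \<times> 'a" and ?h = "\<lambda>b. (0, (z(s := \<zero>)) b) :: int \<times> 'a"
    have h: "frag_of (?h, 1) \<in> relations B"
      using insert.prems zero_closed by (intro insert.IH) (auto simp: supp_def)
    then have h': "?h \<in> vectors A B"
      using relations_carrier by fastforce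
    have "frag_of (e, 0) \<in> relations B"
      using relations_minus[OF relation_add_right[where k = 0 and l = 0, OF e]] by simp
    from relations_add[OF relation_smult[where k = 1, OF e a]] this
    have "frag_of (\<lambda>b. (0, z s) \<otimes>\<^bsub>A\<^esub> e b, 1) \<in> relations B"
      by force
    from relations_add[OF relations_add[OF relation_add_left[where k = 1, OF A.smult_vectors[OF e a] h'] this] h]
    have "frag_of (\<lambda>b. ((0, z s) \<otimes>\<^bsub>A\<^esub> e b) \<oplus>\<^bsub>A\<^esub> ?h b, 1) \<in> relations B"
      by simp
    moreover have "((0, z s) \<otimes>\<^bsub>A\<^esub> e b) \<oplus>\<^bsub>A\<^esub> ?h b = ?g b" for b
      using A.r_one[OF a] A.r_null[OF a] insert.prems(3) Icarr by (auto simp: e_def)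
    ultimately show ?case
      by simp
  qed
  then show "frag_of (\<lambda>b. (0, z b), 1) \<in> relations B"
    using assms by (auto simp: vectors_iff)
qed

end


section \<open>Tor and its transition maps\<close>

lemma tensor_map_tensor_one:
  fixes R (structure)
  assumes J1: "unitization R J1" and J2: "unitization R J2"
  defines "A1 \<equiv> int_unitization (R\<lparr>carrier := J1\<rparr>)" and "A2 \<equiv> int_unitization (R\<lparr>carrier := J2\<rparr>)"
  assumes sub: "J1 \<subseteq> J2"
    and g: "\<And>f. f \<in> vectors A1 B1 \<Longrightarrow> g f \<in> vectors A2 B2"
    and g_add: "\<And>f f'. f \<in> vectors A1 B1 \<Longrightarrow> f' \<in> vectors A1 B1 \<Longrightarrow>
      g (\<lambda>b. f b \<oplus>\<^bsub>A1\<^esub> f' b) = (\<lambda>c. g f c \<oplus>\<^bsub>A2\<^esub> g f' c)"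
    and g_smult: "\<And>a f. a \<in> carrier A1 \<Longrightarrow> f \<in> vectors A1 B1 \<Longrightarrow>
      g (\<lambda>b. a \<otimes>\<^bsub>A1\<^esub> f b) = (\<lambda>c. a \<otimes>\<^bsub>A2\<^esub> g f c)"
    and f: "f \<in> vectors A1 B1"
  shows "tensor_map A2 (free_module A2 B2) int_module g id (unitization.tensor_one R J1 B1 f)
    = unitization.tensor_one R J2 B2 (g f)"
proof -
  interpret J1: unitization R J1 by fact
  interpret J2: unitization R J2 by fact
  note g = g[unfolded A1_def A2_def] and g_add = g_add[unfolded A1_def A2_def]
    and g_smult = g_smult[unfolded A1_def A2_def] and f = f[unfolded A1_def]
  define h where "h = frag_extend (\<lambda>(x :: 'c \<Rightarrow> int \<times> 'a, y :: int). frag_of (g x, id y))"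
  have h: "h (frag_of (x, k)) = frag_of (g x, k)" for x k
    by (simp add: h_def)
  have h_diff: "h (x - y) = h x - h y" for x y
    by (simp add: h_def frag_extend_diff)
  have "h x \<in> J2.relations B2" if "x \<in> J1.relations B1" for x
    using that
  proof (induction rule: J1.relations_induct)
    case zero
    show ?case by (simp add: h_def J2.relations_zero)
  next
    case (diff x y)
    then show ?case by (simp add: h_diff J2.relations_diff)
  next
    case (add_left f f' k)
    then show ?case
      using J2.relation_add_left[OF g[OF add_left(1)] g[OF add_left(2)], of k] g_add[OF add_left]
      by (simp only: h_diff h)
  next
    case (add_right f k l)
    then show ?case
      using J2.relation_add_right[OF g[OF add_right], of k l]
      by (simp only: h_diff h)
  next
    case (smult f a k)
    have "a \<in> carrier J2.A"
      using smult(2) sub by (auto simp: J1.carrier_A J2.carrier_A)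
    then show ?case
      using J2.relation_smult[OF g[OF smult(1)], of a k] g_smult[OF smult(2,1)]
      by (simp only: h_diff h)
  qed
  then have "quotient_map (J2.pairs B2) (J2.relations B2) h (J1.relations B1 #>\<^bsub>J1.pairs B1\<^esub> frag_of (f, 1))
      = J2.relations B2 #>\<^bsub>J2.pairs B2\<^esub> h (frag_of (f, 1))"
  proof (intro quotient_map_coset J2.subgroup_relations group_free_Abelian_group)
    show "\<one>\<^bsub>J2.pairs B2\<^esub> \<in> h ` J1.relations B1"
      using J1.relations_zero by (auto simp: h_def intro!: image_eqI[of _ _ 0])
    show "h (frag_of (f, 1)) \<in> carrier (J2.pairs B2)"
      using g[OF f] by (simp add: h A2_def)
  qed (auto simp: h_def frag_extend_add)
  then show ?thesis
    by (simp add: tensor_map_def A2_def J1.tensor_one_def J2.tensor_one_def h_def case_prod_unfold)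
qed

lemma resolution_map_id:
  assumes "abelian_monoid A'" "f \<in> vectors A B" "carrier A \<subseteq> carrier A'" "\<zero>\<^bsub>A'\<^esub> = \<zero>\<^bsub>A\<^esub>"
  shows "resolution_map A A' id id f = f"
proof
  fix c
  interpret abelian_monoid A' by fact
  have c: "f c \<in> carrier A'"
    using vectors_carrier[OF assms(2)] assms(3) by blast
  show "resolution_map A A' id id f c = f c"
  proof (cases "c \<in> supp A f")
    case True
    then have "{b \<in> supp A f. map_res_gen id id b = c} = {c}"
      by (auto simp: res_gen.map_id)
    then show ?thesis
      using c by (simp add: resolution_map_def)
  next
    case False
    then have "{b \<in> supp A f. map_res_gen id id b = c} = {}"
      by (auto simp: res_gen.map_id)
    with False show ?thesis
      using assms(4) by (simp only: resolution_map_def finsum_empty) (simp add: supp_def)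
  qed
qed

context unitization
begin

interpretation A: cring A
  by (rule cring_A)

abbreviation chains :: "nat \<Rightarrow> (((int \<times> 'a, int) res_gen \<Rightarrow> int \<times> 'a) \<times> int \<Rightarrow>\<^sub>0 int) set monoid" where
  "chains n \<equiv> Tor_chains A int_module int_module n"

abbreviation boundaries :: "nat \<Rightarrow> (((int \<times> 'a, int) res_gen \<Rightarrow> int \<times> 'a) \<times> int \<Rightarrow>\<^sub>0 int) set set" where
  "boundaries n \<equiv> Tor_boundaries A int_module int_module n"

lemma chains_eq: "chains n = tensor A (free_module A (basis n)) int_module"
  by (simp add: Tor_chains_def resolution_def)

lemma group_chains: "group (chains n)"
  unfolding chains_eq by (rule group_tensor)

lemma carrier_chains: "carrier (chains n) = tensor_one (basis n) ` vectors A (basis n)"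
  unfolding chains_eq by (rule carrier_tensor)

lemma one_chains: "\<one>\<^bsub>chains n\<^esub> = relations (basis n)"
  unfolding chains_eq by (rule one_tensor)

lemma mult_chains:
  assumes "f \<in> vectors A (basis n)" "g \<in> vectors A (basis n)"
  shows "tensor_one (basis n) f \<otimes>\<^bsub>chains n\<^esub> tensor_one (basis n) g = tensor_one (basis n) (\<lambda>b. f b \<oplus>\<^bsub>A\<^esub> g b)"
  unfolding chains_eq using assms by (rule tensor_one_add)

lemma boundary_add:
  assumes "f \<in> vectors A (basis (Suc n))" "g \<in> vectors A (basis (Suc n))"
  shows "boundary A (\<lambda>b. f b \<oplus>\<^bsub>A\<^esub> g b) = (\<lambda>c. boundary A f c \<oplus>\<^bsub>A\<^esub> boundary A g c)"
  unfolding boundary_eq_linear_extension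
  by (intro ext A.linear_extension_add[OF gen_boundary_closed assms])

lemma boundary_smult:
  assumes "f \<in> vectors A (basis (Suc n))" "a \<in> carrier A"
  shows "boundary A (\<lambda>b. a \<otimes>\<^bsub>A\<^esub> f b) = (\<lambda>c. a \<otimes>\<^bsub>A\<^esub> boundary A f c)"
  unfolding boundary_eq_linear_extension
  by (intro ext A.linear_extension_smult[OF gen_boundary_closed assms])

lemma Tor_boundary_tensor_one:
  assumes "f \<in> vectors A (basis (Suc n))"
  shows "Tor_boundary A int_module int_module n (tensor_one (basis (Suc n)) f) = tensor_one (basis n) (boundary A f)"
  unfolding Tor_boundary_def resolution_def
  using unitization_axioms unitization_axioms subset_refl boundary_closed boundary_add boundary_smult assms
  by (rule tensor_map_tensor_one)

lemma boundaries_eq: "boundaries n = (\<lambda>d. tensor_one (basis n) (boundary A d)) ` vectors A (basis (Suc n))"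
  unfolding Tor_boundaries_def carrier_chains image_image
  using Tor_boundary_tensor_one by (rule image_cong[OF refl])

lemma boundaries_subset: "boundaries n \<subseteq> carrier (chains n)"
  unfolding boundaries_eq carrier_chains using boundary_closed by blast

lemma subgroup_boundaries: "subgroup (boundaries n) (chains n)"
proof (rule group.subgroupI[OF group_chains boundaries_subset])
  show "boundaries n \<noteq> {}"
    using A.zero_vectors unfolding boundaries_eq by blast
next
  fix X Y assume "X \<in> boundaries n" "Y \<in> boundaries n"
  then obtain d e where de: "d \<in> vectors A (basis (Suc n))" "e \<in> vectors A (basis (Suc n))"
    and XY: "X = tensor_one (basis n) (boundary A d)" "Y = tensor_one (basis n) (boundary A e)"
    unfolding boundaries_eq by blast
  have "X \<otimes>\<^bsub>chains n\<^esub> Y = tensor_one (basis n) (boundary A (\<lambda>b. d b \<oplus>\<^bsub>A\<^esub> e b))"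
    unfolding XY boundary_add[OF de] using de by (intro mult_chains boundary_closed)
  then show "X \<otimes>\<^bsub>chains n\<^esub> Y \<in> boundaries n"
    unfolding boundaries_eq using A.add_vectors[OF de] by blast
next
  fix X assume X: "X \<in> boundaries n"
  then obtain d where d: "d \<in> vectors A (basis (Suc n))" "X = tensor_one (basis n) (boundary A d)"
    unfolding boundaries_eq by blast
  let ?e = "\<lambda>b. (\<ominus>\<^bsub>A\<^esub> \<one>\<^bsub>A\<^esub>) \<otimes>\<^bsub>A\<^esub> d b"
  let ?Y = "tensor_one (basis n) (boundary A ?e)"
  have e: "?e \<in> vectors A (basis (Suc n))"
    using A.smult_vectors[OF d(1)] by blast
  have "(\<lambda>b. ?e b \<oplus>\<^bsub>A\<^esub> d b) = (\<lambda>_. \<zero>\<^bsub>A\<^esub>)"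
    using vectors_carrier[OF d(1)] by (simp add: A.l_minus A.l_neg del: A_simps)
  moreover have "boundary A (\<lambda>_. \<zero>\<^bsub>A\<^esub>) = (\<lambda>_. \<zero>\<^bsub>A\<^esub>)"
    by (auto simp: boundary_def supp_def fun_eq_iff)
  ultimately have "boundary A (\<lambda>b. ?e b \<oplus>\<^bsub>A\<^esub> d b) = (\<lambda>_. \<zero>\<^bsub>A\<^esub>)"
    by simp
  then have "?Y \<otimes>\<^bsub>chains n\<^esub> X = tensor_one (basis n) (\<lambda>_. (0, \<zero>))"
    using mult_chains[OF boundary_closed[OF e] boundary_closed[OF d(1)]] boundary_add[OF e d(1)] d(2) by simp
  also have "\<dots> = \<one>\<^bsub>chains n\<^esub>"
    unfolding one_chains using zero_vectors zero_closed by (intro tensor_one_augmentation_ideal)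
  finally have "?Y \<otimes>\<^bsub>chains n\<^esub> X = \<one>\<^bsub>chains n\<^esub>" .
  moreover have Y: "?Y \<in> boundaries n"
    unfolding boundaries_eq using e by blast
  ultimately have "inv\<^bsub>chains n\<^esub> X = ?Y"
    using group.inv_equality[OF group_chains] boundaries_subset X by blast
  with Y show "inv\<^bsub>chains n\<^esub> X \<in> boundaries n" by simp
qed

text \<open>
  The class of \<open>f \<otimes> 1\<close> modulo boundaries.  It is a Tor class if \<open>f \<otimes> 1\<close> is a cycle, but the
  transition maps are computed for arbitrary \<open>f\<close>.
\<close>

definition tor_class :: "nat \<Rightarrow> ((int \<times> 'a, int) res_gen \<Rightarrow> int \<times> 'a)
    \<Rightarrow> (((int \<times> 'a, int) res_gen \<Rightarrow> int \<times> 'a) \<times> int \<Rightarrow>\<^sub>0 int) set set" where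
  "tor_class n f = boundaries n #>\<^bsub>chains n\<^esub> tensor_one (basis n) f"

lemma Tor_cyclesD:
  assumes "X \<in> Tor_cycles A int_module int_module (Suc n)"
  shows "\<exists>f\<in>vectors A (basis (Suc n)). X = tensor_one (basis (Suc n)) f \<and> (\<forall>b. fst (boundary A f b) = 0)"
proof -
  have "X \<in> carrier (chains (Suc n))" "Tor_boundary A int_module int_module n X = \<one>\<^bsub>chains n\<^esub>"
    using assms by (auto simp: kernel_def)
  moreover from this obtain f where f: "f \<in> vectors A (basis (Suc n))" "X = tensor_one (basis (Suc n)) f"
    unfolding carrier_chains by blast
  ultimately have "tensor_one (basis n) (boundary A f) = relations (basis n)"
    using Tor_boundary_tensor_one[OF f(1)] one_chains by simp
  then have "\<forall>b. fst (boundary A f b) = 0"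
    by (intro allI tensor_one_eq_oneD)
  with f show ?thesis by blast
qed

lemma Tor_classE:
  assumes "X \<in> carrier (Tor A int_module int_module (Suc n))"
  obtains f where "f \<in> vectors A (basis (Suc n))" "X = tor_class (Suc n) f" "\<And>b. fst (boundary A f b) = 0"
proof -
  obtain Y where "Y \<in> Tor_cycles A int_module int_module (Suc n)" "X = boundaries (Suc n) #>\<^bsub>chains (Suc n)\<^esub> Y"
    using assms by (auto simp: Tor_def FactGroup_def RCOSETS_def r_coset_def simp del: Tor_cycles.simps)
  with Tor_cyclesD[of Y n] that show ?thesis
    unfolding tor_class_def by blast
qed

lemma one_Tor: "\<one>\<^bsub>Tor A int_module int_module n\<^esub> = boundaries n"
  by (simp add: Tor_def FactGroup_def)

text \<open>
  The summand \<open>(0, y)\<close> vanishes in \<open>F \<otimes> \<int>\<close>, and the other one is a boundary.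
\<close>

lemma tor_class_trivial:
  assumes y: "y \<in> vectors R (basis n)" "\<And>b. y b \<in> J" and d: "d \<in> vectors A (basis (Suc n))"
  shows "tor_class n (\<lambda>b. (0, y b) \<oplus>\<^bsub>A\<^esub> boundary A d b) = \<one>\<^bsub>Tor A int_module int_module n\<^esub>"
proof -
  interpret C: group "chains n" by (rule group_chains)
  let ?b = "tensor_one (basis n) (boundary A d)"
  have b: "?b \<in> boundaries n"
    unfolding boundaries_eq using d by blast
  then have bC: "?b \<in> carrier (chains n)"
    using boundaries_subset by blast
  have "tensor_one (basis n) (\<lambda>b. (0, y b) \<oplus>\<^bsub>A\<^esub> boundary A d b)
      = tensor_one (basis n) (\<lambda>b. (0, y b)) \<otimes>\<^bsub>chains n\<^esub> ?b"
    using augmentation_ideal_vectors[OF y] boundary_closed[OF d] by (rule mult_chains[symmetric])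
  also have "\<dots> = ?b"
    using bC tensor_one_augmentation_ideal[OF y] by (simp flip: one_chains)
  finally show ?thesis
    unfolding tor_class_def one_Tor using C.coset_join2[OF bC subgroup_boundaries b] by simp
qed

end

lemma Tor_map_tor_class:
  fixes R (structure)
  assumes J1: "unitization R J1" and J2: "unitization R J2" and sub: "J1 \<subseteq> J2"
  defines "A1 \<equiv> int_unitization (R\<lparr>carrier := J1\<rparr>)" and "A2 \<equiv> int_unitization (R\<lparr>carrier := J2\<rparr>)"
  assumes f: "f \<in> vectors A1 (res_basis A1 int_module n)"
  shows "Tor_map A1 A2 int_module int_module id id id n (unitization.tor_class R J1 n f)
    = unitization.tor_class R J2 n f"
proof -
  interpret J1: unitization R J1 by fact
  interpret J2: unitization R J2 by fact
  interpret A2: cring J2.A by (rule J2.cring_A)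
  interpret A1: cring J1.A by (rule J1.cring_A)
  interpret C1: group "J1.chains n" by (rule J1.group_chains)
  interpret C2: group "J2.chains n" by (rule J2.group_chains)
  have c: "carrier J1.A \<subseteq> carrier J2.A"
    using sub by (auto simp: J1.carrier_A J2.carrier_A)
  have incl: "x \<in> vectors J2.A (J2.basis m)" if "x \<in> vectors J1.A (J1.basis m)" for x m
    using boundary_subring(2)[OF J1 J2 sub that basis_mono[OF J1 J2 sub]] .
  define h where "h = tensor_map J2.A (free_module J2.A (J2.basis n)) int_module (resolution_map J1.A J2.A id id) id"
  have id: "resolution_map J1.A J2.A id id x = x" if "x \<in> vectors J1.A (J1.basis m)" for x m
    using that c A2.abelian_monoid_axioms by (intro resolution_map_id) auto
  have h: "h (J1.tensor_one (J1.basis n) x) = J2.tensor_one (J2.basis n) x"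
    if x: "x \<in> vectors J1.A (J1.basis n)" for x
  proof -
    have "h (J1.tensor_one (J1.basis n) x)
        = J2.tensor_one (J2.basis n) (resolution_map J1.A J2.A id id x)"
      unfolding h_def
    proof (rule tensor_map_tensor_one[OF J1 J2 sub])
      fix f f' assume "f \<in> vectors J1.A (J1.basis n)" "f' \<in> vectors J1.A (J1.basis n)"
      then show "resolution_map J1.A J2.A id id (\<lambda>b. f b \<oplus>\<^bsub>J1.A\<^esub> f' b) =
          (\<lambda>c. resolution_map J1.A J2.A id id f c \<oplus>\<^bsub>J2.A\<^esub> resolution_map J1.A J2.A id id f' c)"
        using id[OF A1.add_vectors[of f _ f']] id by simp
    next
      fix a f assume a: "a \<in> carrier J1.A" and f: "f \<in> vectors J1.A (J1.basis n)"
      have "a \<otimes>\<^bsub>J1.A\<^esub> f b = a \<otimes>\<^bsub>J2.A\<^esub> f b" for b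
        using J1.A_mult[OF a vectors_carrier[OF f]] J2.A_mult[OF subsetD[OF c a] subsetD[OF c vectors_carrier[OF f]]]
        by (rule trans[OF _ sym])
      then show "resolution_map J1.A J2.A id id (\<lambda>b. a \<otimes>\<^bsub>J1.A\<^esub> f b) =
          (\<lambda>c. a \<otimes>\<^bsub>J2.A\<^esub> resolution_map J1.A J2.A id id f c)"
        using id[OF A1.smult_vectors[OF f a]] id[OF f] by simp
    qed (use x id incl in auto)
    then show ?thesis
      using id[OF x] by simp
  qed
  have bound: "h (J1.tensor_one (J1.basis n) (boundary J1.A d)) \<in> J2.boundaries n"
    if d: "d \<in> vectors J1.A (J1.basis (Suc n))" for d
  proof -
    have "boundary J1.A d = boundary J2.A d"
      using boundary_subring(1)[OF J1 J2 sub d basis_mono[OF J1 J2 sub]] .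
    then show ?thesis
      using h[OF J1.boundary_closed[OF d]] incl[OF d] unfolding J2.boundaries_eq by auto
  qed
  have "quotient_map (J2.chains n) (J2.boundaries n) h
      (J1.boundaries n #>\<^bsub>J1.chains n\<^esub> J1.tensor_one (J1.basis n) f)
    = J2.boundaries n #>\<^bsub>J2.chains n\<^esub> h (J1.tensor_one (J1.basis n) f)"
  proof (rule quotient_map_coset[OF C2.group_axioms J2.subgroup_boundaries])
    show "h ` J1.boundaries n \<subseteq> J2.boundaries n"
      using bound unfolding J1.boundaries_eq by blast
    have z: "(\<lambda>_. \<zero>\<^bsub>J1.A\<^esub>) \<in> vectors J1.A (J1.basis n)"
      by (rule A1.zero_vectors)
    have "J1.tensor_one (J1.basis n) (\<lambda>_. \<zero>\<^bsub>J1.A\<^esub>) = \<one>\<^bsub>J1.chains n\<^esub>"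
      "J2.tensor_one (J2.basis n) (\<lambda>_. \<zero>\<^bsub>J1.A\<^esub>) = \<one>\<^bsub>J2.chains n\<^esub>"
      using J1.tensor_one_augmentation_ideal[OF J1.zero_vectors] J2.tensor_one_augmentation_ideal[OF J1.zero_vectors]
      by (auto simp: J1.one_chains J2.one_chains)
    then have "\<one>\<^bsub>J2.chains n\<^esub> = h \<one>\<^bsub>J1.chains n\<^esub>"
      using h[OF z] by simp
    then show "\<one>\<^bsub>J2.chains n\<^esub> \<in> h ` J1.boundaries n"
      using subgroup.one_closed[OF J1.subgroup_boundaries] by blast
    show "h (J1.tensor_one (J1.basis n) f) \<in> carrier (J2.chains n)"
      using h[OF f[unfolded A1_def]] incl[OF f[unfolded A1_def]] unfolding J2.carrier_chains by auto
    fix X assume "X \<in> J1.boundaries n"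
    then obtain d where d: "d \<in> vectors J1.A (J1.basis (Suc n))" "X = J1.tensor_one (J1.basis n) (boundary J1.A d)"
      unfolding J1.boundaries_eq by blast
    have bd: "boundary J1.A d \<in> vectors J1.A (J1.basis n)"
      by (rule J1.boundary_closed[OF d(1)])
    have fA: "f \<in> vectors J1.A (J1.basis n)"
      using f by (simp add: A1_def)
    have "h (X \<otimes>\<^bsub>J1.chains n\<^esub> J1.tensor_one (J1.basis n) f)
        = J2.tensor_one (J2.basis n) (\<lambda>b. boundary J1.A d b \<oplus>\<^bsub>J1.A\<^esub> f b)"
      unfolding d(2) J1.mult_chains[OF bd fA] by (rule h[OF A1.add_vectors[OF bd fA]])
    also have "\<dots> = h X \<otimes>\<^bsub>J2.chains n\<^esub> h (J1.tensor_one (J1.basis n) f)"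
      unfolding d(2) h[OF bd] h[OF fA] J2.mult_chains[OF incl[OF bd] incl[OF fA]] by simp
    finally show "h (X \<otimes>\<^bsub>J1.chains n\<^esub> J1.tensor_one (J1.basis n) f)
        = h X \<otimes>\<^bsub>J2.chains n\<^esub> h (J1.tensor_one (J1.basis n) f)" .
  qed
  then show ?thesis
    using h[OF f[unfolded A1_def]]
    by (simp add: Tor_map_def A1_def A2_def J1.tor_class_def J2.tor_class_def h_def resolution_def)
qed

context noetherian_ideal
begin

lemma transition_tor_class:
  assumes "f \<in> vectors (U (r + k)) (U_basis (r + k) n)"
  shows "transition (\<lambda>r. Tor_map (U (Suc r)) (U r) int_module int_module id id id n) r k
      (unitization.tor_class R (Ipow (r + k)) n f) = unitization.tor_class R (Ipow r) n f"
  using assms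
proof (induction k)
  case 0
  show ?case by simp
next
  case (Suc k)
  have sub: "Ipow (Suc (r + k)) \<subseteq> Ipow (r + k)"
    by (rule ideal_power_antimono[OF ideal_axioms]) simp
  have f: "f \<in> vectors (U (Suc (r + k))) (U_basis (Suc (r + k)) n)"
    using Suc.prems by simp
  have "f \<in> vectors (U (r + k)) (U_basis (r + k) n)"
    using boundary_subring(2)[OF unitization_power unitization_power sub f]
      basis_mono[OF unitization_power unitization_power sub] .
  then show ?case
    using Suc.IH Tor_map_tor_class[OF unitization_power unitization_power sub f]
    by (simp only: transition.simps comp_apply add_Suc_right)
qed

lemma pro_Tor_unital_ideal: "pro_Tor_unital R I"
  unfolding pro_Tor_unital_def pro_zero_def unitized_power_def
proof (intro allI impI)
  fix m r :: nat
  assume "0 < m"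
  then obtain n where n: "m = Suc n"
    using not0_implies_Suc by blast
  interpret Jr: unitization R "Ipow r" by (rule unitization_power)
  obtain s where s: "s \<ge> r" and S: "\<And>f. f \<in> vectors (U s) (U_basis s (Suc n)) \<Longrightarrow>
      (\<And>c. fst (boundary (U s) f c) = 0) \<Longrightarrow>
      \<exists>y d. y \<in> vectors R (U_basis r (Suc n)) \<and> (\<forall>b. y b \<in> Ipow r) \<and>
        d \<in> vectors (U r) (U_basis r (Suc (Suc n))) \<and> f = (\<lambda>b. (0, y b) \<oplus>\<^bsub>U r\<^esub> boundary (U r) d b)"
    using pro_exactness[of r n] by blast
  interpret Js: unitization R "Ipow s" by (rule unitization_power)
  have "transition (\<lambda>r. Tor_map (U (Suc r)) (U r) int_module int_module id id id m) r (s - r) X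
      = \<one>\<^bsub>Tor (U r) int_module int_module m\<^esub>"
    if X: "X \<in> carrier (Tor (U s) int_module int_module m)" for X
  proof -
    obtain f where f: "f \<in> vectors (U s) (U_basis s (Suc n))" and Xf: "X = Js.tor_class (Suc n) f"
      and "\<And>b. fst (boundary (U s) f b) = 0"
      using Js.Tor_classE X unfolding n by blast
    then obtain y d where y: "y \<in> vectors R (U_basis r (Suc n))" "\<And>b. y b \<in> Ipow r"
      and d: "d \<in> vectors (U r) (U_basis r (Suc (Suc n)))"
      and fyd: "f = (\<lambda>b. (0, y b) \<oplus>\<^bsub>U r\<^esub> boundary (U r) d b)"
      using S by blast
    have "transition (\<lambda>r. Tor_map (U (Suc r)) (U r) int_module int_module id id id m) r (s - r) X
        = Jr.tor_class m f"
      using transition_tor_class[of f r "s - r" m] f s unfolding Xf n by simp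
    also have "\<dots> = \<one>\<^bsub>Tor (U r) int_module int_module m\<^esub>"
      unfolding fyd n by (rule Jr.tor_class_trivial[OF y d])
    finally show ?thesis .
  qed
  with s show "\<exists>s\<ge>r. \<forall>x\<in>carrier (Tor (U s) int_module int_module m).
      transition (\<lambda>r. Tor_map (U (Suc r)) (U r) int_module int_module id id id m) r (s - r) x
      = \<one>\<^bsub>Tor (U r) int_module int_module m\<^esub>"
    by blast
qed

end

theorem theorem0p3:
  fixes R :: "('a, 'b) ring_scheme" and I :: "'a set"
  assumes "cring R" and "noetherian_ring R" and "ideal I R"
  shows "pro_Tor_unital R I"
proof -
  interpret noetherian_ideal R I
    using assms by (simp add: noetherian_ideal_def noetherian_cring_def)
  show ?thesis
    by (rule pro_Tor_unital_ideal)
qed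


end
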